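(* For every finite abelian $p$-group $F$, $$\Delta_0\big(\mathbf{Moment}[F]\big)=\frac{1}{|F|}\sum_{\phi\in \mathrm{Hom}(\mathbb{Z}_p,F)}\mathbf{Moment}\big[\mathrm{coker}(\phi:\mathbb{Z}_p\to F)\big].$$
   Context: Fix a prime $p$. $X_0$ is the set of isomorphism classes of finite abelian $p$-groups; $X_1$ is the set of isomorphism classes of finitely generated $\mathbb{Z}_p$-modules of $\mathbb{Q}_p$-rank $1$. The random operator $d$ from $X_1$ to $X_0$: $d(H)$ is the quotient of $H$ by (the submodule generated by) a Haar-random element of $H$ (almost surely finite). The random operator $d^*$ from $X_0$ to $X_1$: $d^*(G)$ is the middle term of the extension $0\to\mathbb{Z}_p\to H\to G\to 0$ corresponding to a uniformly random element of the finite group $\mathrm{Ext}(G,\mathbb{Z}_p)$. $\Delta_0=d\,d^*$ (first $d^*$, then $d$, independent choices) is a random operator from $X_0$ to $X_0$; it acts linearly on measures by $(\Delta_0\nu)(G')=\sum_{G}\nu(G)\,\mathbb{P}(\Delta_0(G)\cong G')$. $\mu_0(G)=c_0/|\mathrm{Aut}(G)|$ with $c_0=\prod_{i\ge1}(1-p^{-i})$. For a finite abelian $p$-group $F$, $\mathbf{Moment}[F]$ is the measure on $X_0$ whose value at $G$ is $\#\mathrm{Sur}(G,F)\,\mu_0(G)$, where $\mathrm{Sur}(G,F)$ is the set of surjective homomorphisms $G\to F$. *)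

theory Defs
  imports "HOL-Probability.Probability" "HOL-Algebra.Module" "HOL-Algebra.AbelCoset" "HOL-Algebra.Bij"
begin

section \<open>The ring of p-adic integers\<close>

text \<open>The inverse limit of the rings of residues modulo \<open>p ^ n\<close>: \<open>x n\<close> is the canonical
  representative of the residue class of \<open>x\<close> modulo \<open>p ^ n\<close>.\<close>

type_synonym padic = "nat \<Rightarrow> int"

definition Zp :: "nat \<Rightarrow> padic ring" where
  "Zp p = \<lparr>carrier = {x. \<forall>n. 0 \<le> x n \<and> x n < int p ^ n \<and> x (Suc n) mod int p ^ n = x n},
           mult = (\<lambda>x y n. (x n * y n) mod int p ^ n),
           one = (\<lambda>n. 1 mod int p ^ n),
           zero = (\<lambda>n. 0),
           add = (\<lambda>x y n. (x n + y n) mod int p ^ n)\<rparr>"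


section \<open>Modules\<close>

text \<open>The locale name is qualified because \<open>HOL.Modules\<close> also declares a locale \<open>module\<close>.\<close>

definition mod_hom ::
    "('r, 'm) ring_scheme \<Rightarrow> ('r, 'a, 'n) module_scheme \<Rightarrow> ('r, 'b, 'k) module_scheme \<Rightarrow> ('a \<Rightarrow> 'b) set" where
  "mod_hom R M N = {f \<in> hom (add_monoid M) (add_monoid N).
     \<forall>a\<in>carrier R. \<forall>x\<in>carrier M. f (a \<odot>\<^bsub>M\<^esub> x) = a \<odot>\<^bsub>N\<^esub> f x}"

definition mod_iso ::
    "('r, 'm) ring_scheme \<Rightarrow> ('r, 'a, 'n) module_scheme \<Rightarrow> ('r, 'b, 'k) module_scheme \<Rightarrow> ('a \<Rightarrow> 'b) set" where
  "mod_iso R M N = {f \<in> mod_hom R M N. bij_betw f (carrier M) (carrier N)}"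

definition fin_gen :: "('r, 'm) ring_scheme \<Rightarrow> ('r, 'a, 'n) module_scheme \<Rightarrow> bool" where
  "fin_gen R M \<longleftrightarrow> (\<exists>S. finite S \<and> S \<subseteq> carrier M \<and>
     (\<forall>N. submodule N R M \<and> S \<subseteq> N \<longrightarrow> N = carrier M))"

definition lin_indep :: "('r, 'm) ring_scheme \<Rightarrow> ('r, 'a, 'n) module_scheme \<Rightarrow> 'a set \<Rightarrow> bool" where
  "lin_indep R M S \<longleftrightarrow> finite S \<and> S \<subseteq> carrier M \<and>
     (\<forall>a \<in> S \<rightarrow> carrier R. (\<Oplus>\<^bsub>M\<^esub>s\<in>S. a s \<odot>\<^bsub>M\<^esub> s) = \<zero>\<^bsub>M\<^esub> \<longrightarrow> (\<forall>s\<in>S. a s = \<zero>\<^bsub>R\<^esub>))"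

text \<open>Over a domain, this is the dimension of the module tensored with the field of fractions;
  for \<open>Zp p\<close> it is the rank over the p-adic numbers.\<close>

definition has_rank :: "('r, 'm) ring_scheme \<Rightarrow> ('r, 'a, 'n) module_scheme \<Rightarrow> nat \<Rightarrow> bool" where
  "has_rank R M r \<longleftrightarrow> (\<exists>S. lin_indep R M S \<and> card S = r) \<and> (\<forall>S. lin_indep R M S \<longrightarrow> card S \<le> r)"


section \<open>Isomorphism classes\<close>

text \<open>Every finite group has an isomorphic copy with carrier in \<open>nat\<close>, and every finitely generated
  \<open>Zp p\<close>-module of rank 1 (being the direct sum of \<open>Zp p\<close> and a finite group) has one with carrier
  in \<open>padic \<times> nat\<close>.  Isomorphism classes are therefore formed inside these types, whereas
  \<open>class0\<close> and \<open>class1\<close> send an object over any type to its class (and an object that is not of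
  the required kind to the empty set, which is not an isomorphism class).\<close>

definition fin_ab_p_group :: "nat \<Rightarrow> ('a, 'm) monoid_scheme \<Rightarrow> bool" where
  "fin_ab_p_group p G \<longleftrightarrow> comm_group G \<and> finite (carrier G) \<and> (\<exists>k. order G = p ^ k)"

definition class0 :: "nat \<Rightarrow> ('a, 'm) monoid_scheme \<Rightarrow> nat monoid set" where
  "class0 p G = {G'. fin_ab_p_group p G' \<and> G' \<cong> G}"

definition X0 :: "nat \<Rightarrow> nat monoid set set" where
  "X0 p = class0 p ` {G :: nat monoid. fin_ab_p_group p G}"

definition rank1_module :: "nat \<Rightarrow> (padic, 'a, 'm) module_scheme \<Rightarrow> bool" where
  "rank1_module p H \<longleftrightarrow> Module.module (Zp p) H \<and> fin_gen (Zp p) H \<and> has_rank (Zp p) H 1"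

type_synonym padic_module = "(padic, padic \<times> nat) module"

definition class1 :: "nat \<Rightarrow> (padic, 'a, 'm) module_scheme \<Rightarrow> padic_module set" where
  "class1 p H = {H'. rank1_module p H' \<and> mod_iso (Zp p) H' H \<noteq> {}}"

definition X1 :: "nat \<Rightarrow> padic_module set set" where
  "X1 p = class1 p ` {H :: padic_module. rank1_module p H}"

definition rep :: "'a set \<Rightarrow> 'a" where
  "rep c = (SOME x. x \<in> c)"


section \<open>Haar measure and the random operator d\<close>

text \<open>The canonical topology of a finitely generated \<open>Zp p\<close>-module \<open>H\<close> is the p-adic one, with the
  cosets of the submodules \<open>p ^ n H\<close> as a basis.  Haar measure is normalised to total mass 1.\<close>

definition padic_topology :: "nat \<Rightarrow> (padic, 'a, 'm) module_scheme \<Rightarrow> 'a topology" where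
  "padic_topology p H =
     topology_generated_by (\<Union>n. a_rcosets\<^bsub>H\<^esub> (add_pow H (p ^ n) ` carrier H))"

definition is_haar :: "nat \<Rightarrow> (padic, 'a, 'm) module_scheme \<Rightarrow> 'a measure \<Rightarrow> bool" where
  "is_haar p H M \<longleftrightarrow> space M = carrier H \<and>
     sets M = sigma_sets (carrier H) {U. openin (padic_topology p H) U} \<and>
     emeasure M (carrier H) = 1 \<and>
     (\<forall>A\<in>sets M. \<forall>h\<in>carrier H. emeasure M (h <+\<^bsub>H\<^esub> A) = emeasure M A)"

definition haar :: "nat \<Rightarrow> (padic, 'a, 'm) module_scheme \<Rightarrow> 'a measure" where
  "haar p H = (THE M. is_haar p H M)"

definition quot_elem :: "nat \<Rightarrow> (padic, 'a, 'm) module_scheme \<Rightarrow> 'a \<Rightarrow> 'a set monoid" where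
  "quot_elem p H h = H A_Mod {a \<odot>\<^bsub>H\<^esub> h |a. a \<in> carrier (Zp p)}"

text \<open>The law of \<open>d(H)\<close>.  The isomorphism type of a finite quotient is that of its additive group,
  since group homomorphisms between finite abelian p-groups are \<open>Zp p\<close>-linear.  The null event that
  the quotient is infinite is sent to the empty set.\<close>

definition d_law :: "nat \<Rightarrow> padic_module set \<Rightarrow> nat monoid set measure" where
  "d_law p c = distr (haar p (rep c)) (count_space UNIV) (\<lambda>h. class0 p (quot_elem p (rep c) h))"


section \<open>Extensions and the random operator d-star\<close>

text \<open>Short exact sequences \<open>0 \<rightarrow> Zp p \<rightarrow> H \<rightarrow> G \<rightarrow> 0\<close>, represented as triples \<open>(H, i, q)\<close>.  A group
  homomorphism from a \<open>Zp p\<close>-module to a finite abelian p-group is automatically \<open>Zp p\<close>-linear, so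
  linearity is demanded of \<open>i\<close> only.  As a set, \<open>H\<close> is in bijection with the product of \<open>Zp p\<close>
  and \<open>G\<close>, so every extension is equivalent to one with carrier in \<open>padic \<times> 'g\<close>.\<close>

type_synonym 'g extension =
  "(padic, padic \<times> 'g) module \<times> (padic \<Rightarrow> padic \<times> 'g) \<times> (padic \<times> 'g \<Rightarrow> 'g)"

definition Zp_self :: "nat \<Rightarrow> (padic, padic) module" where
  "Zp_self p = ring.extend (Zp p) \<lparr>smult = mult (Zp p)\<rparr>"

definition is_extension :: "nat \<Rightarrow> ('g, 'm) monoid_scheme \<Rightarrow> 'g extension \<Rightarrow> bool" where
  "is_extension p G = (\<lambda>(H, i, q). Module.module (Zp p) H \<and>
     i \<in> mod_hom (Zp p) (Zp_self p) H \<and> inj_on i (carrier (Zp p)) \<and>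
     q \<in> epi (add_monoid H) G \<and> kernel (add_monoid H) G q = i ` carrier (Zp p))"

definition ext_equiv :: "nat \<Rightarrow> ('g, 'm) monoid_scheme \<Rightarrow> ('g extension \<times> 'g extension) set" where
  "ext_equiv p G = {((H, i, q), (H', i', q')).
     is_extension p G (H, i, q) \<and> is_extension p G (H', i', q') \<and>
     (\<exists>f \<in> mod_iso (Zp p) H H'.
        (\<forall>a\<in>carrier (Zp p). f (i a) = i' a) \<and> (\<forall>x\<in>carrier H. q' (f x) = q x))}"

text \<open>The underlying set of the group \<open>Ext(G, Zp p)\<close>; only its uniform distribution is needed.\<close>

definition Ext :: "nat \<Rightarrow> ('g, 'm) monoid_scheme \<Rightarrow> 'g extension set set" where
  "Ext p G = Collect (is_extension p G) // ext_equiv p G"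

definition dstar_law :: "nat \<Rightarrow> nat monoid set \<Rightarrow> padic_module set pmf" where
  "dstar_law p c = map_pmf (\<lambda>e. class1 p (fst (rep e))) (pmf_of_set (Ext p (rep c)))"


section \<open>The operator Delta0 and the moment measures\<close>

text \<open>\<open>Delta0_prob p c c'\<close> is the probability that \<open>\<Delta>\<^sub>0\<close> sends the class \<open>c\<close> to the class \<open>c'\<close>.\<close>

definition Delta0_prob :: "nat \<Rightarrow> nat monoid set \<Rightarrow> nat monoid set \<Rightarrow> ennreal" where
  "Delta0_prob p c c' = (\<integral>\<^sup>+ m. emeasure (d_law p m) {c'} \<partial>measure_pmf (dstar_law p c))"

definition Delta0 :: "nat \<Rightarrow> nat monoid set measure \<Rightarrow> nat monoid set measure" where
  "Delta0 p \<nu> = point_measure (X0 p)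
     (\<lambda>c'. \<integral>\<^sup>+ c. emeasure \<nu> {c} * Delta0_prob p c c' \<partial>count_space (X0 p))"

text \<open>Sets of homomorphisms are restricted to extensional functions, which is needed for
  their cardinalities to be the intended ones.\<close>

definition Sur :: "('a, 'm) monoid_scheme \<Rightarrow> ('b, 'n) monoid_scheme \<Rightarrow> ('a \<Rightarrow> 'b) set" where
  "Sur G F = epi G F \<inter> extensional (carrier G)"

definition Zp_Hom :: "nat \<Rightarrow> ('b, 'n) monoid_scheme \<Rightarrow> (padic \<Rightarrow> 'b) set" where
  "Zp_Hom p F = hom (add_monoid (Zp p)) F \<inter> extensional (carrier (Zp p))"

definition coker :: "nat \<Rightarrow> ('b, 'n) monoid_scheme \<Rightarrow> (padic \<Rightarrow> 'b) \<Rightarrow> 'b set monoid" where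
  "coker p F \<phi> = F Mod (\<phi> ` carrier (Zp p))"

definition c0 :: "nat \<Rightarrow> real" where
  "c0 p = prodinf (\<lambda>i. 1 - 1 / real p ^ Suc i)"

definition mu0 :: "nat \<Rightarrow> ('a, 'm) monoid_scheme \<Rightarrow> real" where
  "mu0 p G = c0 p / real (card (auto G))"

definition Moment :: "nat \<Rightarrow> ('b, 'n) monoid_scheme \<Rightarrow> nat monoid set measure" where
  "Moment p F = point_measure (X0 p) (\<lambda>c. ennreal (real (card (Sur (rep c) F)) * mu0 p (rep c)))"

end

theory Submission
  imports Defs "HOL-Algebra.Sylow" "HOL-Algebra.Multiplicative_Group" "HOL-Number_Theory.Cong"
begin

text \<open>Extensions of a finite group \<open>G\<close> by \<open>\<int>\<^sub>p\<close> are classified by characters \<open>\<chi>\<close> of \<open>G\<close>: the extension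
  \<open>H\<close> is the fibre product of \<open>\<chi> : G \<rightarrow> \<rat>\<^sub>p/\<int>\<^sub>p\<close> with the projection \<open>\<rat>\<^sub>p \<rightarrow> \<rat>\<^sub>p/\<int>\<^sub>p\<close>. By duality, a
  homomorphism from \<open>H\<close> to a finite group \<open>K\<close> amounts to a pair \<open>(E, \<theta>)\<close> of a subgroup \<open>E\<close> of
  \<open>G \<times> K\<close> projecting onto \<open>G\<close> and a character \<open>\<theta>\<close> of \<open>E\<close> that is injective on \<open>E \<inter> (1 \<times> K)\<close> and
  whose power with exponent \<open>|E \<inter> (1 \<times> K)|\<close> is \<open>\<chi>\<close>. Summing over \<open>\<chi>\<close>, that is over all
  extensions, removes the last condition.

  The probability that \<open>\<Delta>\<^sub>0\<close> sends \<open>G\<close> to \<open>K\<close> is governed by surjections \<open>H \<rightarrow> K\<close> with cyclic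
  kernel, which correspond to the pairs for which \<open>E\<close> also projects onto \<open>K\<close> and \<open>\<theta>\<close> is also
  injective on \<open>E \<inter> (G \<times> 1)\<close>. This condition is symmetric in \<open>G\<close> and \<open>K\<close>, so \<open>\<Delta>\<^sub>0\<close> is reversible with
  respect to \<open>\<mu>\<^sub>0\<close>, and it remains to compute the expected number of surjections from \<open>\<Delta>\<^sub>0(G)\<close> to
  \<open>F\<close>. A surjection \<open>H \<rightarrow> F\<close> kills a Haar-random element with probability \<open>1/|F|\<close>, and the pairs
  with \<open>E\<close> projecting onto \<open>F\<close> correspond to \<open>\<phi> : \<int>\<^sub>p \<rightarrow> F\<close>, a surjection from \<open>G\<close> onto
  \<open>coker \<phi>\<close> with fibre product \<open>E\<close>, and one of the \<open>|G|\<close> characters of \<open>E\<close> with a prescribed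
  value at \<open>(1, \<phi> 1)\<close>.\<close>

section \<open>Characters of finite abelian groups\<close>

text \<open>An extension \<open>H\<close> treats \<open>G\<close> and \<open>K\<close> differently,
  so the symmetry has to be found in data in which \<open>H\<close> no longer occurs. For
  \<open>\<psi> : H -> K\<close> the map \<open>(q, \<psi>)\<close> into \<open>G x K\<close> has
  kernel \<open>i (p^j Z_p)\<close>, where \<open>p^j\<close> is the order of
  \<open>\<psi> (i Z_p)\<close>; its image \<open>E\<close> is therefore a finite quotient of
  \<open>H\<close>. Of the embedding \<open>(lam / p^k, q)\<close> of \<open>H\<close> in
  \<open>Q_p x G\<close> there remains on \<open>E\<close> the function \<open>lam / p^(k+j)\<close>
  modulo \<open>Z_p\<close>, and this is \<theta>. Cyclic kernels enter because the quotient of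
  \<open>H\<close> by \<open>h\<close> is isomorphic to \<open>K\<close> exactly when
  \<open>h\<close> generates the kernel of a surjection onto \<open>K\<close>. Such a kernel has
  Haar measure \<open>1/|K|\<close>, its generators are the fraction \<open>1 - 1/p\<close> of it,
  and \<open>|Aut K|\<close> surjections share it. These factors depend on \<open>K\<close> alone;
  their counterparts for \<open>G\<close> are the weight \<open>1/|G|\<close> of one extension and
  the factor \<open>1/|Aut G|\<close> in \<open>mu0\<close>. Complex roots of unity stand for
  \<open>Q_p/Z_p\<close>: extending a character to one more element amounts to extracting an
  \<open>r\<close>-th root of a nonzero number, which has \<open>r\<close> solutions.\<close>

definition chars :: "('a, 'm) monoid_scheme \<Rightarrow> 'a set \<Rightarrow> ('a \<Rightarrow> complex) set" where
  "chars G S = {\<theta> \<in> extensional S. \<theta> \<one>\<^bsub>G\<^esub> = 1 \<and> (\<forall>x\<in>S. \<forall>y\<in>S. \<theta> (x \<otimes>\<^bsub>G\<^esub> y) = \<theta> x * \<theta> y)}"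

lemma charsD:
  assumes "\<theta> \<in> chars G S"
  shows "\<theta> \<in> extensional S" "\<theta> \<one>\<^bsub>G\<^esub> = 1" "\<And>x y. x \<in> S \<Longrightarrow> y \<in> S \<Longrightarrow> \<theta> (x \<otimes>\<^bsub>G\<^esub> y) = \<theta> x * \<theta> y"
  using assms by (auto simp: chars_def)

lemma chars_pow:
  assumes "group G" "subgroup S G" "\<theta> \<in> chars G S" "x \<in> S"
  shows "\<theta> (x [^]\<^bsub>G\<^esub> (n::nat)) = \<theta> x ^ n"
proof -
  interpret group G by fact
  have "x [^]\<^bsub>G\<^esub> n \<in> S \<and> \<theta> (x [^]\<^bsub>G\<^esub> n) = \<theta> x ^ n"
    by (induction n) (use assms in \<open>auto simp: charsD subgroup.one_closed subgroup.m_closed\<close>)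
  then show ?thesis by simp
qed

lemma chars_inv:
  assumes "group G" "subgroup S G" "\<theta> \<in> chars G S" "x \<in> S"
  shows "\<theta> (inv\<^bsub>G\<^esub> x) * \<theta> x = 1" "\<theta> x \<noteq> 0"
proof -
  interpret group G by fact
  have "x \<in> carrier G" "inv\<^bsub>G\<^esub> x \<in> S" using assms subgroup.mem_carrier subgroup.m_inv_closed by metis+
  then show *: "\<theta> (inv\<^bsub>G\<^esub> x) * \<theta> x = 1" using charsD[OF assms(3)] assms(4) by (metis l_inv)
  then show "\<theta> x \<noteq> 0" by auto
qed

lemma chars_eqI:
  assumes "\<theta> \<in> chars G S" "\<theta>' \<in> chars G S" "\<And>x. x \<in> S \<Longrightarrow> \<theta> x = \<theta>' x"
  shows "\<theta> = \<theta>'"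
  using assms charsD(1) extensionalityI by metis

lemma (in group) subgroup_nat_pow_closed:
  "subgroup S G \<Longrightarrow> x \<in> S \<Longrightarrow> x [^] (n::nat) \<in> S"
  by (induction n) (auto simp: subgroup.one_closed subgroup.m_closed)

text \<open>The step from \<open>S\<close> to the subgroup generated by \<open>S\<close> and one
  element \<open>y\<close>. With \<open>r\<close> the order of \<open>y\<close> modulo
  \<open>S\<close>, the only relation that ties \<open>y\<close> to \<open>S\<close> is that
  \<open>y^r\<close> lies in \<open>S\<close>, so a character of \<open>S\<close> extends with any
  value \<open>d\<close> at \<open>y\<close> that satisfies
  \<open>d^r = \<kappa> (y^r)\<close>.\<close>

lemma (in comm_group) adjoin_element:
  assumes fin: "finite (carrier G)" and S: "subgroup S G" and y: "y \<in> carrier G"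
  obtains r S' where "(r::nat) > 0" "y [^] r \<in> S" "subgroup S' G" "S \<subseteq> S'" "y \<in> S'" "card S' = r * card S"
    "\<And>T. subgroup T G \<Longrightarrow> S \<subseteq> T \<Longrightarrow> y \<in> T \<Longrightarrow> S' \<subseteq> T"
    "S' = {y [^] (n::nat) \<otimes> s |n s. s \<in> S}"
    "\<And>\<kappa> d. \<kappa> \<in> chars G S \<Longrightarrow> d ^ r = \<kappa> (y [^] r) \<Longrightarrow>
       \<exists>\<theta>\<in>chars G S'. (\<forall>x\<in>S. \<theta> x = \<kappa> x) \<and> \<theta> y = d"
proof -
  interpret S: subgroup S G by fact
  define r where "r = (LEAST r::nat. r > 0 \<and> y [^] r \<in> S)"
  have "y [^] order G \<in> S" "order G > 0"
    using pow_order_eq_1[OF y] fin by (auto simp: order_gt_0_iff_finite)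
  then have "r > 0 \<and> y [^] r \<in> S"
    unfolding r_def by (intro LeastI[of "\<lambda>r::nat. r > 0 \<and> y [^] r \<in> S"]) simp
  then have r: "r > 0" "y [^] r \<in> S" by simp_all
  have r_least: "r \<le> m" if "m > 0" "y [^] m \<in> S" for m :: nat
    unfolding r_def using that by (intro Least_le) auto
  have rdvd: "r dvd m" if m: "y [^] m \<in> S" for m :: nat
  proof -
    have eq: "y [^] m = (y [^] r) [^] (m div r) \<otimes> y [^] (m mod r)"
      using y by (simp add: nat_pow_pow nat_pow_mult)
    have P: "(y [^] r) [^] (m div r) \<in> S"
      by (rule subgroup_nat_pow_closed[OF S r(2)])
    have "y [^] (m mod r) = inv ((y [^] r) [^] (m div r)) \<otimes> y [^] m"
      unfolding eq using y by (simp add: inv_solve_left)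
    then have "y [^] (m mod r) \<in> S" using m P by auto
    then show ?thesis using r_least[of "m mod r"] r(1)
      by (metis dvd_eq_mod_eq_0 gr0I leD mod_less_divisor)
  qed
  define S' where "S' = {y [^] (n::nat) \<otimes> s |n s. s \<in> S}"
  have S'1: "y [^] n \<otimes> s \<in> S'" if "s \<in> S" for n :: nat and s unfolding S'_def using that by blast
  have sub: "S' \<subseteq> carrier G" using y by (auto simp: S'_def)
  have SS': "S \<subseteq> S'"
  proof
    fix s assume "s \<in> S"
    then have "y [^] (0::nat) \<otimes> s = s" "y [^] (0::nat) \<otimes> s \<in> S'" using S'1[of s 0] by auto
    then show "s \<in> S'" by metis
  qed
  have yS': "y \<in> S'" using S'1[OF S.one_closed, of 1] y by simp
  have subg: "subgroup S' G"
  proof (rule subgroupI)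
    show "S' \<noteq> {}" using yS' by auto
    fix a assume "a \<in> S'"
    then obtain n :: nat and s where a: "a = y [^] n \<otimes> s" "s \<in> S" by (auto simp: S'_def)
    \<comment> \<open>Inverses without negative exponents: \<open>y^(m+n) = (y^r)^n\<close> lies in
      \<open>S\<close>, so \<open>y^m\<close> inverts \<open>y^n\<close> modulo
      \<open>S\<close>.\<close>
    define m where "m = r * n - n"
    have "m + n = r * n" unfolding m_def using r(1) by simp
    then have "y [^] m \<otimes> y [^] n = y [^] (r * n)" using y by (simp add: nat_pow_mult)
    also have "\<dots> = (y [^] r) [^] n" using y by (simp add: nat_pow_pow)
    also have "\<dots> \<in> S" by (rule subgroup_nat_pow_closed[OF S r(2)])
    finally have inS: "y [^] m \<otimes> y [^] n \<in> S" .
    have "inv a = y [^] m \<otimes> (inv (y [^] m \<otimes> y [^] n) \<otimes> inv s)"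
      unfolding a(1) using y a(2) by (simp add: inv_mult m_ac) (simp add: m_assoc[symmetric])
    also have "\<dots> \<in> S'" using inS a(2) by (intro S'1) auto
    finally show "inv a \<in> S'" .
    fix b assume "b \<in> S'"
    then obtain n' :: nat and s' where b: "b = y [^] n' \<otimes> s'" "s' \<in> S" by (auto simp: S'_def)
    have "a \<otimes> b = y [^] (n + n') \<otimes> (s \<otimes> s')"
      unfolding a b nat_pow_mult[OF y, symmetric] using y a(2) b(2) by (simp add: m_ac)
    also have "\<dots> \<in> S'" using a b by (intro S'1) auto
    finally show "a \<otimes> b \<in> S'" .
  qed (use sub in auto)
  have least: "S' \<subseteq> T" if "subgroup T G" "S \<subseteq> T" "y \<in> T" for T
    unfolding S'_def using that by (auto intro!: subgroup.m_closed[OF that(1)] subgroup_nat_pow_closed)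
  \<comment> \<open>Two representations of one element differ by a power of \<open>y^r\<close> moved
    from one factor to the other. This serves both the count of \<open>S'\<close> and the definition
    of the extended character.\<close>
  have wd: "r dvd n' - n \<and> s = y [^] (n' - n) \<otimes> s'"
    if "y [^] n \<otimes> s = y [^] n' \<otimes> s'" "s \<in> S" "s' \<in> S" "n \<le> n'" for n n' :: nat and s s'
  proof -
    have "y [^] n \<otimes> s = y [^] n \<otimes> (y [^] (n' - n) \<otimes> s')"
      using that y by (simp add: m_assoc[symmetric] nat_pow_mult)
    then have s: "s = y [^] (n' - n) \<otimes> s'" using that y by simp
    then have "y [^] (n' - n) = s \<otimes> inv s'" using that y by (simp add: m_assoc)
    then have "y [^] (n' - n) \<in> S" using that by simp
    then show ?thesis using rdvd s by blast
  qed
  have "bij_betw (\<lambda>(n::nat, s). y [^] n \<otimes> s) ({..<r} \<times> S) S'"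
    unfolding bij_betw_def
  proof
    have "n = n' \<and> s = s'" if "y [^] n \<otimes> s = y [^] n' \<otimes> s'" "s \<in> S" "s' \<in> S" "n < r" "n' < r" "n \<le> n'" for n n' :: nat and s s'
    proof -
      have "r dvd n' - n" "n' - n < r" using wd that by auto
      then have "n = n'" using that(6) by (metis dvd_imp_le leD le_antisym zero_less_diff not_less)
      then show ?thesis using wd[OF that(1,2,3,6)] that by simp
    qed
    then show "inj_on (\<lambda>(n::nat, s). y [^] n \<otimes> s) ({..<r} \<times> S)"
      by (auto simp: inj_on_def) (metis nat_le_linear)+
    have "y [^] n \<otimes> s \<in> (\<lambda>(n::nat, s). y [^] n \<otimes> s) ` ({..<r} \<times> S)" if "s \<in> S" for n :: nat and s
    proof (rule image_eqI[of _ _ "(n mod r, (y [^] r) [^] (n div r) \<otimes> s)"])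
      show "y [^] n \<otimes> s = (case (n mod r, (y [^] r) [^] (n div r) \<otimes> s) of (n, s) \<Rightarrow> y [^] n \<otimes> s)"
        using y that by (simp add: m_assoc[symmetric] nat_pow_pow nat_pow_mult)
      have "(y [^] r) [^] (n div r) \<in> S" by (rule subgroup_nat_pow_closed[OF S r(2)])
      then show "(n mod r, (y [^] r) [^] (n div r) \<otimes> s) \<in> {..<r} \<times> S" using r that by auto
    qed
    then show "(\<lambda>(n::nat, s). y [^] n \<otimes> s) ` ({..<r} \<times> S) = S'" using S'1 by (auto simp: S'_def)
  qed
  then have card: "card S' = r * card S" by (simp add: bij_betw_same_card[symmetric] card_cartesian_product)
  have ext: "\<exists>\<theta>\<in>chars G S'. (\<forall>x\<in>S. \<theta> x = \<kappa> x) \<and> \<theta> y = d"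
    if \<kappa>: "\<kappa> \<in> chars G S" and d: "d ^ r = \<kappa> (y [^] r)" for \<kappa> d
  proof -
    \<comment> \<open>The value is read off an arbitrary representation \<open>y^n s\<close>;
      \<open>key\<close> makes the choice harmless.\<close>
    define \<theta> where "\<theta> = restrict (\<lambda>x. SOME z. \<exists>n s. s \<in> S \<and> x = y [^] n \<otimes> s \<and> z = d ^ n * \<kappa> s) S'"
    have key: "d ^ n * \<kappa> s = d ^ n' * \<kappa> s'"
      if h: "y [^] n \<otimes> s = y [^] n' \<otimes> s'" "s \<in> S" "s' \<in> S" "n \<le> n'" for n n' :: nat and s s'
    proof -
      obtain t where t: "n' - n = r * t" using wd[OF h] by (auto elim: dvdE)
      have "s = (y [^] r) [^] t \<otimes> s'" using wd[OF h] t y by (simp add: nat_pow_pow)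
      then have "\<kappa> s = \<kappa> ((y [^] r) [^] t) * \<kappa> s'"
        using charsD(3)[OF \<kappa>] r(2) h subgroup_nat_pow_closed[OF S] by metis
      also have "\<kappa> ((y [^] r) [^] t) = d ^ (n' - n)"
        using chars_pow[OF is_group S \<kappa> r(2)] d t by (simp add: power_mult)
      finally show ?thesis using h(4) by (simp add: power_add[symmetric] mult.assoc[symmetric])
    qed
    have \<theta>: "\<theta> (y [^] n \<otimes> s) = d ^ n * \<kappa> s" if s: "s \<in> S" for n :: nat and s
    proof -
      have "(SOME z. \<exists>n' s'. s' \<in> S \<and> y [^] n \<otimes> s = y [^] n' \<otimes> s' \<and> z = d ^ n' * \<kappa> s') = d ^ n * \<kappa> s"
        by (rule some_equality) (use s key in \<open>blast, metis nat_le_linear\<close>)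
      then show ?thesis using S'1[OF s] by (simp add: \<theta>_def)
    qed
    have \<theta>S: "\<theta> s = \<kappa> s" if "s \<in> S" for s using \<theta>[OF that, of 0] that by simp
    moreover have "\<theta> y = d" using \<theta>[OF S.one_closed, of 1] y charsD(2)[OF \<kappa>] by simp
    moreover have "\<theta> (a \<otimes> b) = \<theta> a * \<theta> b" if "a \<in> S'" "b \<in> S'" for a b
    proof -
      obtain n n' :: nat and s s' where a: "a = y [^] n \<otimes> s" "s \<in> S" "b = y [^] n' \<otimes> s'" "s' \<in> S"
        using \<open>a \<in> S'\<close> \<open>b \<in> S'\<close> by (auto simp: S'_def)
      have "a \<otimes> b = y [^] (n + n') \<otimes> (s \<otimes> s')"
        unfolding a nat_pow_mult[OF y, symmetric] using y a(2,4) by (simp add: m_ac)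
      then show ?thesis using a \<theta>[of "s \<otimes> s'" "n + n'"] \<theta>[of s n] \<theta>[of s' n'] charsD(3)[OF \<kappa>, of s s']
        by (simp add: power_add)
    qed
    ultimately have "\<theta> \<in> chars G S'"
      using charsD(2)[OF \<kappa>] S.one_closed by (auto simp: chars_def \<theta>_def)
    then show ?thesis using \<theta>S \<open>\<theta> y = d\<close> by blast
  qed
  show ?thesis by (rule that[OF r subg SS' yS' card least S'_def ext])
qed

text \<open>Induction on what \<open>S\<close> lacks of \<open>T\<close>. Adjoining \<open>y\<close>
  leaves \<open>r\<close> choices for the value at \<open>y\<close>, the \<open>r\<close>-th roots
  of the nonzero number \<open>\<kappa> (y^r)\<close>, and multiplies the order of the subgroup by
  the same \<open>r\<close>; so the number of extensions is the index of \<open>S\<close> in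
  \<open>T\<close>.\<close>

lemma (in comm_group) card_chars_extending:
  assumes fin: "finite (carrier G)" and S: "subgroup S G" and T: "subgroup T G" and "S \<subseteq> T" "\<kappa> \<in> chars G S"
  shows "card {\<theta> \<in> chars G T. \<forall>x\<in>S. \<theta> x = \<kappa> x} * card S = card T \<and>
    finite {\<theta> \<in> chars G T. \<forall>x\<in>S. \<theta> x = \<kappa> x}"
  using S \<open>S \<subseteq> T\<close> \<open>\<kappa> \<in> chars G S\<close>
proof (induction "card T - card S" arbitrary: S \<kappa> rule: less_induct)
  case (less S \<kappa>)
  have finT: "finite T" using fin T subgroup.subset finite_subset by metis
  show ?case
  proof (cases "S = T")
    case True
    then have "{\<theta> \<in> chars G T. \<forall>x\<in>S. \<theta> x = \<kappa> x} = {\<kappa>}" using less.prems chars_eqI by blast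
    then show ?thesis using True by simp
  next
    case False
    then obtain y where y: "y \<in> T" "y \<notin> S" using less.prems by auto
    have yG: "y \<in> carrier G" using y(1) T subgroup.mem_carrier by metis
    obtain r S' where r: "r > 0" "y [^] r \<in> S" "subgroup S' G" "S \<subseteq> S'" "y \<in> S'" "card S' = r * card S"
      and least: "\<And>T. subgroup T G \<Longrightarrow> S \<subseteq> T \<Longrightarrow> y \<in> T \<Longrightarrow> S' \<subseteq> T"
      and S'def: "S' = {y [^] (n::nat) \<otimes> s |n s. s \<in> S}"
      and ext: "\<And>\<kappa> d. \<kappa> \<in> chars G S \<Longrightarrow> d ^ r = \<kappa> (y [^] r) \<Longrightarrow>
       \<exists>\<theta>\<in>chars G S'. (\<forall>x\<in>S. \<theta> x = \<kappa> x) \<and> \<theta> y = d"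
      by (rule adjoin_element[OF fin less.prems(1) yG]) (rule that; (assumption | blast))
    have S'T: "S' \<subseteq> T" using least T less.prems y by blast
    define D where "D = {d. d ^ r = \<kappa> (y [^] r)}"
    have D: "card D = r" "finite D"
      unfolding D_def using r(1) chars_inv(2)[OF is_group less.prems(1,3) r(2)]
      by (auto intro!: card_nth_roots finite_nth_roots)
    obtain \<Theta> where \<Theta>: "\<And>d. d \<in> D \<Longrightarrow> \<Theta> d \<in> chars G S' \<and> (\<forall>x\<in>S. \<Theta> d x = \<kappa> x) \<and> \<Theta> d y = d"
    proof -
      have "\<forall>d\<in>D. \<exists>\<theta>. \<theta> \<in> chars G S' \<and> (\<forall>x\<in>S. \<theta> x = \<kappa> x) \<and> \<theta> y = d"
        using ext[OF less.prems(3)] unfolding D_def by blast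
      then show ?thesis by (elim bchoice[THEN exE]) (use that in blast)
    qed
    let ?E = "\<lambda>d. {\<theta> \<in> chars G T. \<forall>x\<in>S'. \<theta> x = \<Theta> d x}"
    have "S \<subset> S'" using r(4,5) y by auto
    then have "card S < card S'" using S'T finT by (meson finite_subset psubset_card_mono)
    moreover have "card S' \<le> card T" using S'T finT card_mono by blast
    ultimately have lt: "card T - card S' < card T - card S" by simp
    have IH: "card (?E d) * card S' = card T \<and> finite (?E d)" if "d \<in> D" for d
      by (rule less.hyps[OF lt r(3) S'T]) (use \<Theta> that in blast)
    \<comment> \<open>The extensions to \<open>T\<close> are sorted by their value at
      \<open>y\<close>; those with value \<open>d\<close> are the extensions of
      \<open>\<Theta> d\<close>.\<close>
    have "{\<theta> \<in> chars G T. \<forall>x\<in>S. \<theta> x = \<kappa> x} = (\<Union>d\<in>D. ?E d)"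
    proof (intro equalityI subsetI)
      fix \<theta> assume h: "\<theta> \<in> {\<theta> \<in> chars G T. \<forall>x\<in>S. \<theta> x = \<kappa> x}"
      then have d: "\<theta> y \<in> D" using chars_pow[OF is_group T, of \<theta> y r] y r(2) by (auto simp: D_def)
      have "\<theta> x = \<Theta> (\<theta> y) x" if "x \<in> S'" for x
      proof -
        obtain n :: nat and s where x: "x = y [^] n \<otimes> s" "s \<in> S" using \<open>x \<in> S'\<close> S'def by auto
        have yn: "y [^] n \<in> T" "y [^] n \<in> S'"
          using subgroup_nat_pow_closed T y(1) r(3,5) by auto
        have s: "s \<in> T" "s \<in> S'" using x(2) r(4) less.prems(2) by auto
        have a: "\<theta> \<in> chars G T" "\<theta> s = \<kappa> s" using h x(2) by blast+
        have b: "\<Theta> (\<theta> y) \<in> chars G S'" "\<Theta> (\<theta> y) s = \<kappa> s" "\<Theta> (\<theta> y) y = \<theta> y" using \<Theta>[OF d] x(2) by blast+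
        have "\<theta> x = \<theta> y ^ n * \<kappa> s"
          unfolding x(1) charsD(3)[OF a(1) yn(1) s(1)] chars_pow[OF is_group T a(1) y(1)] a(2) ..
        moreover have "\<Theta> (\<theta> y) x = \<theta> y ^ n * \<kappa> s"
          unfolding x(1) charsD(3)[OF b(1) yn(2) s(2)] chars_pow[OF is_group r(3) b(1) r(5)] b(2,3) ..
        ultimately show ?thesis by simp
      qed
      then show "\<theta> \<in> (\<Union>d\<in>D. ?E d)" using d h by blast
    next
      fix \<theta> assume "\<theta> \<in> (\<Union>d\<in>D. ?E d)"
      then show "\<theta> \<in> {\<theta> \<in> chars G T. \<forall>x\<in>S. \<theta> x = \<kappa> x}" using \<Theta> r(4) by auto
    qed
    moreover have "card (\<Union>d\<in>D. ?E d) = (\<Sum>d\<in>D. card (?E d))"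
    proof (intro card_UN_disjoint D ballI impI)
      show "?E i \<inter> ?E j = {}" if "i \<in> D" "j \<in> D" "i \<noteq> j" for i j using \<Theta>[OF that(1)] \<Theta>[OF that(2)] that(3) r(5) by force
    qed (use IH in blast)
    moreover have "(\<Sum>d\<in>D. card (?E d)) * card S' = r * card T"
      using IH D by (simp add: sum_distrib_right)
    ultimately have "card {\<theta> \<in> chars G T. \<forall>x\<in>S. \<theta> x = \<kappa> x} * card S * r = card T * r"
      and "finite {\<theta> \<in> chars G T. \<forall>x\<in>S. \<theta> x = \<kappa> x}"
      using r(6) IH D by (auto simp: ac_simps)
    then show ?thesis using r(1) by simp
  qed
qed

lemma (in comm_group) trivial_char: "(\<lambda>x\<in>{\<one>}. 1) \<in> chars G {\<one>}"
  by (auto simp: chars_def)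

lemma (in comm_group) card_chars:
  assumes "finite (carrier G)" "subgroup T G"
  shows "card (chars G T) = card T" "finite (chars G T)"
proof -
  have "{\<theta> \<in> chars G T. \<forall>x\<in>{\<one>}. \<theta> x = (\<lambda>x\<in>{\<one>}. 1) x} = chars G T"
    using charsD(2) by fastforce
  then show "card (chars G T) = card T" "finite (chars G T)"
    using card_chars_extending[OF assms(1) triv_subgroup assms(2) _ trivial_char] subgroup.one_closed[OF assms(2)] by auto
qed

text \<open>The hypotheses on \<open>I\<close> make it the cyclic group generated by
  \<open>x\<close>. A value \<open>z\<close> with \<open>z^|I| = 1\<close> amounts to a character of
  \<open>I\<close>, and the count is the index of \<open>I\<close> in \<open>T\<close>.\<close>

lemma (in comm_group) card_chars_value:
  assumes "finite (carrier G)" "subgroup T G" "x \<in> T" "\<And>U. subgroup U G \<Longrightarrow> x \<in> U \<Longrightarrow> I \<subseteq> U"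
    "subgroup I G" "x \<in> I" "z ^ card I = 1"
  shows "card {\<theta> \<in> chars G T. \<theta> x = z} * card I = card T"
proof -
  have x: "x \<in> carrier G" using assms subgroup.mem_carrier by metis
  obtain r S' where r: "r > 0" "x [^] r \<in> {\<one>}" "subgroup S' G" "{\<one>} \<subseteq> S'" "x \<in> S'" "card S' = r * card {\<one>}"
      and least: "\<And>T. subgroup T G \<Longrightarrow> {\<one>} \<subseteq> T \<Longrightarrow> x \<in> T \<Longrightarrow> S' \<subseteq> T"
      and S'def: "S' = {x [^] (n::nat) \<otimes> s |n s. s \<in> {\<one>}}"
      and ext: "\<And>\<kappa> d. \<kappa> \<in> chars G {\<one>} \<Longrightarrow> d ^ r = \<kappa> (x [^] r) \<Longrightarrow>
       \<exists>\<theta>\<in>chars G S'. (\<forall>x\<in>{\<one>}. \<theta> x = \<kappa> x) \<and> \<theta> x = d"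
    by (rule adjoin_element[OF assms(1) triv_subgroup x]) (rule that; (assumption | blast))
  have I: "S' = I" using least[OF assms(5)] assms(4)[OF r(3,5)] assms(5,6) subgroup.one_closed by fast
  obtain \<kappa> where \<kappa>: "\<kappa> \<in> chars G S'" "\<kappa> x = z" using ext[OF trivial_char, of z] r assms(7) I by auto
  have "{\<theta> \<in> chars G T. \<theta> x = z} = {\<theta> \<in> chars G T. \<forall>y\<in>S'. \<theta> y = \<kappa> y}"
  proof (intro Collect_cong conj_cong refl)
    fix \<theta> assume "\<theta> \<in> chars G T"
    then have "\<theta> (x [^] n) = \<theta> x ^ n" "\<kappa> (x [^] n) = z ^ n" for n :: nat
      using chars_pow[OF is_group assms(2) _ assms(3)] chars_pow[OF is_group r(3) \<kappa>(1) r(5)] \<kappa>(2) by metis+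
    then have "(\<forall>n::nat. \<theta> (x [^] n) = \<kappa> (x [^] n)) \<longleftrightarrow> \<theta> x = z" using \<kappa>(2) by (metis power_one_right nat_pow_eone x)
    moreover have "S' = range (\<lambda>n::nat. x [^] n)" using x by (auto simp: S'def)
    ultimately show "\<theta> x = z \<longleftrightarrow> (\<forall>y\<in>S'. \<theta> y = \<kappa> y)" by auto
  qed
  then show ?thesis using card_chars_extending[OF assms(1) r(3) assms(2) _ \<kappa>(1)] I assms(4)[OF assms(2,3)] by auto
qed

lemma (in group) subgroup_pow_card:
  assumes "subgroup S G" "x \<in> S"
  shows "x [^] card S = \<one>"
proof -
  interpret S: group "G\<lparr>carrier := S\<rparr>" by (rule subgroup.subgroup_is_group[OF assms(1) is_group])
  have "x [^]\<^bsub>G\<lparr>carrier := S\<rparr>\<^esub> order (G\<lparr>carrier := S\<rparr>) = \<one>\<^bsub>G\<lparr>carrier := S\<rparr>\<^esub>"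
    using assms(2) by (intro S.pow_order_eq_1) auto
  then show ?thesis by (simp add: order_def nat_pow_consistent[symmetric])
qed

text \<open>By Sylow, a prime divisor \<open>q\<close> of the order yields a subgroup of
  \<open>q\<close> elements and hence an element of order \<open>q\<close>; the exponent
  \<open>p^n\<close> then forces \<open>q = p\<close>.\<close>

lemma (in group) prime_power_order:
  assumes "finite (carrier G)" "prime p" "\<And>x. x \<in> carrier G \<Longrightarrow> x [^] (p ^ n) = \<one>"
  shows "\<exists>k. order G = p ^ k"
proof -
  have pos: "order G > 0" using assms(1) order_gt_0_iff_finite by simp
  have "q = p" if q: "prime q" "q dvd order G" for q
  proof -
    obtain m where "order G = q ^ 1 * m" using q(2) by (auto elim: dvdE)
    then obtain H where H: "subgroup H G" "card H = q" using sylow_thm[OF q(1) is_group _ assms(1)] by (metis power_one_right)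
    have "\<not> H \<subseteq> {\<one>}" using H(2) prime_gt_1_nat[OF q(1)] card_mono[of "{\<one>}" H] by auto
    then obtain x where x: "x \<in> H" "x \<noteq> \<one>" by auto
    have xG: "x \<in> carrier G" using x H subgroup.mem_carrier by metis
    have "x [^] q = \<one>" using subgroup_pow_card[OF H(1) x(1)] H(2) by simp
    then have "ord x dvd q" using pow_eq_id[OF xG] by simp
    moreover have "ord x dvd p ^ n" using pow_eq_id[OF xG] assms(3)[OF xG] by simp
    moreover have "ord x \<noteq> 1" using ord_eq_1[OF xG] x(2) by simp
    ultimately show "q = p" using q(1) assms(2) by (metis prime_nat_iff prime_dvd_power primes_dvd_imp_eq)
  qed
  then have only: "q = p" if "prime q" "q dvd order G" for q using that by blast
  obtain m where m: "order G = p ^ multiplicity p (order G) * m" "\<not> p dvd m"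
    using multiplicity_decompose'[of "order G" p] pos assms(2) by (metis not_prime_unit not_gr_zero)
  have "m = 1" using only m by (metis dvd_triv_right dvd_trans prime_factor_nat)
  then show ?thesis using m(1) by auto
qed

section \<open>Arithmetic of p-adic integers\<close>

locale padic_prime =
  fixes p :: nat
  assumes prime_p: "prime p"
begin

abbreviation R where "R \<equiv> Zp p"

lemma p_gt_1: "p > 1" using prime_p prime_gt_1_nat by blast

lemma pow_pos: "int p ^ n > 0" "p ^ n > 0" using p_gt_1 by auto

lemma Zp_simps: "mult R = (\<lambda>x y n. (x n * y n) mod int p ^ n)" "add R = (\<lambda>x y n. (x n + y n) mod int p ^ n)"
  "one R = (\<lambda>n. 1 mod int p ^ n)" "zero R = (\<lambda>n. 0)"
  by (simp_all add: Zp_def)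

lemma ZpD:
  assumes "z \<in> carrier R"
  shows "0 \<le> z n" "z n < int p ^ n" "z (Suc n) mod int p ^ n = z n" "z n mod int p ^ n = z n"
  using assms by (auto simp: Zp_def)

lemma Zp_mod: "z \<in> carrier R \<Longrightarrow> n \<le> m \<Longrightarrow> z m mod int p ^ n = z n"
proof (induction m)
  case 0 then show ?case using ZpD(4)[of z 0] by simp
next
  case (Suc m)
  show ?case
  proof (cases "n = Suc m")
    case True then show ?thesis using ZpD(4)[OF Suc.prems(1)] by blast
  next
    case False
    then have "n \<le> m" using Suc by simp
    then have "z (Suc m) mod int p ^ n = (z (Suc m) mod int p ^ m) mod int p ^ n"
      by (metis le_imp_power_dvd mod_mod_cancel)
    then show ?thesis using Suc \<open>n \<le> m\<close> ZpD(3) by simp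
  qed
qed

lemma ZpI:
  assumes "\<And>n. [f (Suc n) = f n] (mod int p ^ n)"
  shows "(\<lambda>n. f n mod int p ^ n) \<in> carrier R"
proof -
  have "f (Suc n) mod int p ^ Suc n mod int p ^ n = f (Suc n) mod int p ^ n" for n
    by (rule mod_mod_cancel) simp
  then show ?thesis using assms pow_pos(1) by (auto simp: Zp_def cong_def)
qed

lemma Zp_cong: "z \<in> carrier R \<Longrightarrow> [z (Suc n) = z n] (mod int p ^ n)"
  using ZpD by (simp add: cong_def)

definition zint :: "int \<Rightarrow> padic" where "zint a = (\<lambda>n. a mod int p ^ n)"

lemma zint_closed [simp, intro]: "zint a \<in> carrier R"
  unfolding zint_def by (rule ZpI) simp

lemma zint_0: "zint 0 = zero R" and zint_1: "zint 1 = one R"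
  by (auto simp: zint_def Zp_simps)

lemma zint_add: "zint (a + b) = zint a \<oplus>\<^bsub>R\<^esub> zint b" and zint_mult: "zint (a * b) = zint a \<otimes>\<^bsub>R\<^esub> zint b"
  by (auto simp: zint_def Zp_simps mod_simps)

lemma cring_Zp: "cring R"
proof (rule cringI)
  show "abelian_group R"
  proof (rule abelian_groupI)
    fix x y assume xy: "x \<in> carrier R" "y \<in> carrier R"
    show "x \<oplus>\<^bsub>R\<^esub> y \<in> carrier R" unfolding Zp_simps
      by (rule ZpI) (use xy in \<open>auto intro: cong_add Zp_cong\<close>)
    show "\<zero>\<^bsub>R\<^esub> \<oplus>\<^bsub>R\<^esub> x = x" using xy ZpD by (auto simp: Zp_simps)
    have "(\<lambda>n. (- x n) mod int p ^ n) \<in> carrier R"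
      by (rule ZpI) (use xy in \<open>auto simp: cong_minus_minus_iff intro: Zp_cong\<close>)
    then show "\<exists>y\<in>carrier R. y \<oplus>\<^bsub>R\<^esub> x = \<zero>\<^bsub>R\<^esub>" by (rule bexI[rotated]) (auto simp: Zp_simps mod_simps)
  qed (auto simp: Zp_simps mod_simps ac_simps intro: zint_closed[of 0, unfolded zint_0 Zp_simps])
  show "comm_monoid R"
  proof (rule comm_monoidI)
    fix x y assume xy: "x \<in> carrier R" "y \<in> carrier R"
    show "x \<otimes>\<^bsub>R\<^esub> y \<in> carrier R" unfolding Zp_simps
      by (rule ZpI) (use xy in \<open>auto intro: cong_mult Zp_cong\<close>)
    show "\<one>\<^bsub>R\<^esub> \<otimes>\<^bsub>R\<^esub> x = x" using xy ZpD by (auto simp: Zp_simps mod_simps)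
  qed (auto simp: Zp_simps mod_simps ac_simps intro: zint_closed[of 1, unfolded zint_1 Zp_simps])
qed (auto simp: Zp_simps mod_simps algebra_simps)

sublocale R: cring R by (rule cring_Zp)

lemma zint_uminus: "zint (- a) = \<ominus>\<^bsub>R\<^esub> zint a"
  by (rule R.minus_equality[symmetric]) (auto simp: zint_add[symmetric] zint_0)

text \<open>Division by \<open>p^n\<close> costs \<open>n\<close> digits: the coordinate
  \<open>w m\<close> comes from \<open>z (m + n)\<close>. The third conclusion records this, so that
  the valuation of the quotient can be read off.\<close>

lemma Zp_divide:
  assumes z: "z \<in> carrier R" "z n = 0"
  obtains w where "w \<in> carrier R" "z = zint (int p ^ n) \<otimes>\<^bsub>R\<^esub> w" "\<And>m. z (m + n) = int p ^ n * w m"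
proof
  define w where "w = (\<lambda>m. z (m + n) div int p ^ n)"
  have dvd: "int p ^ n dvd z (m + n)" for m using Zp_mod[OF z(1), of n "m + n"] z(2) by auto
  then show e: "z (m + n) = int p ^ n * w m" for m by (simp add: w_def)
  have b: "0 \<le> w m \<and> w m < int p ^ m" for m
  proof -
    have "0 \<le> int p ^ n * w m" "int p ^ n * w m < int p ^ n * int p ^ m"
      using ZpD(1,2)[OF z(1), of "m + n"] unfolding e by (simp_all add: power_add mult.commute)
    then show ?thesis using pow_pos(1)[of n] by (simp add: zero_le_mult_iff)
  qed
  have "w (Suc m) mod int p ^ m = w m" for m
  proof -
    have "int p ^ n * (w (Suc m) mod int p ^ m) = z (Suc m + n) mod (int p ^ n * int p ^ m)"
      unfolding e by (rule mult_mod_right)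
    also have "\<dots> = z (Suc (m + n)) mod int p ^ (m + n)" by (simp add: power_add mult.commute)
    also have "\<dots> = int p ^ n * w m" using ZpD(3)[OF z(1)] e by simp
    finally show ?thesis using p_gt_1 by simp
  qed
  then show "w \<in> carrier R" using b by (auto simp: Zp_def)
  then have "(zint (int p ^ n) \<otimes>\<^bsub>R\<^esub> w) m = z m" for m
  proof -
    have "[int p ^ n * w m = z (m + n)] (mod int p ^ m)" by (simp add: e)
    moreover have "z (m + n) mod int p ^ m = z m" using Zp_mod[OF z(1)] by simp
    ultimately show ?thesis by (simp add: Zp_simps zint_def mod_simps cong_def)
  qed
  then show "z = zint (int p ^ n) \<otimes>\<^bsub>R\<^esub> w" by auto
qed

lemma Zp_split:
  assumes "z \<in> carrier R"
  obtains w where "w \<in> carrier R" "z = zint (z n) \<oplus>\<^bsub>R\<^esub> (zint (int p ^ n) \<otimes>\<^bsub>R\<^esub> w)"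
proof -
  let ?y = "z \<oplus>\<^bsub>R\<^esub> zint (- z n)"
  have y: "?y \<in> carrier R" using assms by simp
  have "?y n = 0" using ZpD[OF assms] by (simp add: Zp_simps zint_def mod_simps)
  then obtain w where w: "w \<in> carrier R" "?y = zint (int p ^ n) \<otimes>\<^bsub>R\<^esub> w" using Zp_divide[OF y] by blast
  moreover have "z = zint (z n) \<oplus>\<^bsub>R\<^esub> ?y" using assms by (simp add: zint_uminus R.a_lcomm[of "zint (z n)" z] R.r_neg)
  ultimately show ?thesis using that by metis
qed

text \<open>A residue that is nonzero modulo \<open>p\<close> is invertible modulo every
  \<open>p^n\<close>, and uniqueness of inverses makes these residues compatible.\<close>

lemma Zp_unit:
  assumes z: "z \<in> carrier R" "z 1 \<noteq> 0"
  obtains w where "w \<in> carrier R" "z \<otimes>\<^bsub>R\<^esub> w = \<one>\<^bsub>R\<^esub>"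
proof -
  have cop: "coprime (z n) (int p ^ n)" for n
  proof (cases "n = 0")
    case False
    have "\<not> int p dvd z n"
    proof
      assume "int p dvd z n"
      then have "z n mod int p ^ 1 = 0" by simp
      then show False using Zp_mod[OF z(1), of 1 n] False z(2) by simp
    qed
    then show ?thesis using prime_p by (metis coprime_commute coprime_power_left_iff prime_imp_coprime prime_nat_int_transfer)
  qed simp
  have "\<exists>y. [z n * y = 1] (mod int p ^ n)" for n
    using cong_solve_coprime_int[OF cop] by blast
  then obtain y where y: "\<And>n. [z n * y n = 1] (mod int p ^ n)" by metis
  have "[y (Suc n) = y n] (mod int p ^ n)" for n
  proof -
    have "[z (Suc n) * y (Suc n) = 1] (mod int p ^ n)" using y[of "Suc n"]
      by (metis cong_dvd_modulus dvd_triv_right power_Suc)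
    then have "[z n * y (Suc n) = 1] (mod int p ^ n)"
      using Zp_cong[OF z(1), of n] by (metis cong_scalar_right cong_sym cong_trans)
    then have "[z n * y (Suc n) = z n * y n] (mod int p ^ n)" using y cong_sym cong_trans by metis
    then show ?thesis using cong_mult_lcancel[OF cop] by blast
  qed
  then have w: "(\<lambda>n. y n mod int p ^ n) \<in> carrier R" by (rule ZpI)
  have "z \<otimes>\<^bsub>R\<^esub> (\<lambda>n. y n mod int p ^ n) = \<one>\<^bsub>R\<^esub>" using y by (auto simp: Zp_simps mod_simps cong_def)
  then show ?thesis using that w by blast
qed

lemma Zp_factor:
  assumes z: "z \<in> carrier R" "z \<noteq> \<zero>\<^bsub>R\<^esub>"
  obtains n u v where "u \<in> carrier R" "v \<in> carrier R" "z = zint (int p ^ n) \<otimes>\<^bsub>R\<^esub> u" "u \<otimes>\<^bsub>R\<^esub> v = \<one>\<^bsub>R\<^esub>"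
proof -
  obtain m where "z m \<noteq> 0" using z(2) by (auto simp: Zp_simps)
  \<comment> \<open>\<open>n\<close> is the p-adic valuation of \<open>z\<close>. The coordinate
    \<open>z 0\<close> is always zero, so the first nonzero coordinate has the form
    \<open>z (Suc n)\<close>.\<close>
  define n where "n = (LEAST m. z (Suc m) \<noteq> 0)"
  have "z 0 = 0" using ZpD[OF z(1), of 0] by simp
  then obtain m' where m': "z (Suc m') \<noteq> 0" using \<open>z m \<noteq> 0\<close> by (cases m) auto
  have n1: "z (Suc n) \<noteq> 0" unfolding n_def by (rule LeastI[of _ m']) (rule m')
  have "z n = 0"
  proof (cases n)
    case 0 then show ?thesis using \<open>z 0 = 0\<close> by simp
  next
    case (Suc k)
    then show ?thesis using not_less_Least[of k "\<lambda>m. z (Suc m) \<noteq> 0"] unfolding n_def by auto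
  qed
  then obtain u where u: "u \<in> carrier R" "z = zint (int p ^ n) \<otimes>\<^bsub>R\<^esub> u" "\<And>m. z (m + n) = int p ^ n * u m"
    using Zp_divide[OF z(1)] by metis
  have "u 1 \<noteq> 0" using u(3)[of 1] n1 by auto
  then obtain v where "v \<in> carrier R" "u \<otimes>\<^bsub>R\<^esub> v = \<one>\<^bsub>R\<^esub>" using Zp_unit[OF u(1)] by metis
  then show ?thesis using that u by blast
qed

lemma zint_pow_cancel:
  assumes "z \<in> carrier R" "zint (int p ^ n) \<otimes>\<^bsub>R\<^esub> z = \<zero>\<^bsub>R\<^esub>"
  shows "z = \<zero>\<^bsub>R\<^esub>"
proof -
  have "z m = 0" for m
  proof -
    have "(zint (int p ^ n) \<otimes>\<^bsub>R\<^esub> z) (m + n) = 0" using assms(2) by (simp add: Zp_simps)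
    then have "int p ^ n * int p ^ m dvd int p ^ n * z (m + n)" by (auto simp: Zp_simps zint_def mod_simps power_add mult.commute)
    then have "int p ^ m dvd z (m + n)" using p_gt_1 by simp
    then show ?thesis using Zp_mod[OF assms(1), of m "m + n"] by simp
  qed
  then show ?thesis by (auto simp: Zp_simps)
qed

lemma Zp_integral:
  assumes "z \<in> carrier R" "w \<in> carrier R" "z \<otimes>\<^bsub>R\<^esub> w = \<zero>\<^bsub>R\<^esub>" "z \<noteq> \<zero>\<^bsub>R\<^esub>"
  shows "w = \<zero>\<^bsub>R\<^esub>"
proof -
  obtain n u v where u: "u \<in> carrier R" "v \<in> carrier R" "z = zint (int p ^ n) \<otimes>\<^bsub>R\<^esub> u" "u \<otimes>\<^bsub>R\<^esub> v = \<one>\<^bsub>R\<^esub>"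
    using Zp_factor[OF assms(1,4)] .
  have "zint (int p ^ n) \<otimes>\<^bsub>R\<^esub> (u \<otimes>\<^bsub>R\<^esub> w) = \<zero>\<^bsub>R\<^esub>" using assms u by (simp add: R.m_assoc)
  then have "u \<otimes>\<^bsub>R\<^esub> w = \<zero>\<^bsub>R\<^esub>" using zint_pow_cancel u(1) assms(2) by simp
  then have "v \<otimes>\<^bsub>R\<^esub> (u \<otimes>\<^bsub>R\<^esub> w) = \<zero>\<^bsub>R\<^esub>" using u by simp
  moreover have "v \<otimes>\<^bsub>R\<^esub> (u \<otimes>\<^bsub>R\<^esub> w) = (u \<otimes>\<^bsub>R\<^esub> v) \<otimes>\<^bsub>R\<^esub> w" using u assms by (metis R.m_assoc R.m_comm)
  ultimately show ?thesis using u assms by simp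
qed

lemma zint_eq_0: "zint a = \<zero>\<^bsub>R\<^esub> \<longleftrightarrow> a = 0"
proof
  assume "zint a = \<zero>\<^bsub>R\<^esub>"
  then have d: "int p ^ n dvd a" for n by (auto simp: zint_def Zp_simps fun_eq_iff)
  show "a = 0"
  proof (rule ccontr)
    assume "a \<noteq> 0"
    then have "int p ^ nat \<bar>a\<bar> \<le> \<bar>a\<bar>" using dvd_imp_le_int[OF _ d[of "nat \<bar>a\<bar>"]] by simp
    moreover have "nat \<bar>a\<bar> < p ^ nat \<bar>a\<bar>" using p_gt_1 by (simp add: less_exp power_gt_expt)
    then have "int (nat \<bar>a\<bar>) < int p ^ nat \<bar>a\<bar>" by (metis of_nat_less_iff of_nat_power)
    ultimately show False by simp
  qed
qed (simp add: zint_0)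

text \<open>The character of \<open>\<rat>\<^sub>p/\<int>\<^sub>p\<close> at the class of \<open>z / p\<^sup>k\<close>.\<close>

definition eps :: "nat \<Rightarrow> padic \<Rightarrow> complex" where
  "eps k z = cis (2 * pi * real_of_int (z k) / real p ^ k)"

lemma cis_multiple: "cis (2 * pi * real_of_int a) = 1"
  by (metis Ints_of_int cis_multiple_2pi mult.commute)

lemma cis_mod: "cis (2 * pi * real_of_int (a mod int p ^ k) / real p ^ k) = cis (2 * pi * real_of_int a / real p ^ k)"
proof -
  have "real_of_int a = real_of_int (a mod int p ^ k) + real p ^ k * real_of_int (a div int p ^ k)"
  proof -
    have "a = a mod int p ^ k + int p ^ k * (a div int p ^ k)" by simp
    from arg_cong[OF this, of real_of_int] show ?thesis unfolding of_int_add of_int_mult of_int_power of_int_of_nat_eq .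
  qed
  then have "2 * pi * real_of_int a / real p ^ k = 2 * pi * real_of_int (a mod int p ^ k) / real p ^ k + 2 * pi * real_of_int (a div int p ^ k)"
    using pow_pos(2)[of k] p_gt_1 by (simp add: field_simps)
  then show ?thesis by (simp only: cis_mult[symmetric] cis_multiple mult_1_right)
qed

lemma eps_add: "eps k (z \<oplus>\<^bsub>R\<^esub> w) = eps k z * eps k w"
  by (simp add: eps_def Zp_simps cis_mod cis_mult add_divide_distrib ring_distribs)

lemma eps_zero [simp]: "eps k \<zero>\<^bsub>R\<^esub> = 1" by (simp add: eps_def Zp_simps)

lemma eps_nonzero: "eps k z \<noteq> 0" by (simp add: eps_def)

text \<open>The power multiplies the class of \<open>z / p^(k+j)\<close> by
  \<open>p^j\<close>.\<close>

lemma eps_pow: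
  assumes "z \<in> carrier R"
  shows "eps (k + j) z ^ p ^ j = eps k z"
proof -
  have "eps (k + j) z ^ p ^ j = cis (2 * pi * real_of_int (z (k + j)) / real p ^ k)"
    using p_gt_1 by (simp add: eps_def Complex.DeMoivre power_add field_simps)
  also have "\<dots> = eps k z" using cis_mod[of "z (k + j)" k] Zp_mod[OF assms, of k "k + j"] by (simp add: eps_def)
  finally show ?thesis .
qed

text \<open>The fractions agree: \<open>p^j z / p^(k+j) = z / p^k\<close>.\<close>

lemma eps_shift:
  assumes "z \<in> carrier R"
  shows "eps (k + j) (zint (int p ^ j) \<otimes>\<^bsub>R\<^esub> z) = eps k z"
proof -
  have "eps (k + j) (zint (int p ^ j) \<otimes>\<^bsub>R\<^esub> z) = cis (2 * pi * real_of_int (int p ^ j * z (k + j)) / real p ^ (k + j))"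
    using cis_mod[of "int p ^ j * z (k + j)" "k + j"] by (simp add: eps_def Zp_simps zint_def mod_simps)
  also have "\<dots> = cis (2 * pi * real_of_int (z (k + j)) / real p ^ k)"
    using p_gt_1 by (simp add: power_add field_simps)
  also have "\<dots> = eps k z" using cis_mod[of "z (k + j)" k] Zp_mod[OF assms, of k "k + j"] by (simp add: eps_def)
  finally show ?thesis .
qed

lemma eps_root_ex:
  assumes "c ^ p ^ k = 1"
  obtains a where "c = eps k (zint a)"
proof -
  have "c \<in> {z. z ^ p ^ k = 1}" using assms by simp
  also have "\<dots> = (\<lambda>j. cis (2 * pi * real j / real (p ^ k))) ` {..<p ^ k}"
    using Complex.bij_betw_roots_unity[OF pow_pos(2)] unfolding bij_betw_def by metis
  finally obtain j where j: "c = cis (2 * pi * real j / real (p ^ k))" "j < p ^ k" by auto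
  then have "c = eps k (zint (int j))" using cis_mod[of "int j" k] by (simp add: eps_def zint_def)
  then show ?thesis using that by blast
qed

lemma eps_eq_1:
  assumes "z \<in> carrier R"
  shows "eps k z = 1 \<longleftrightarrow> z k = 0"
proof
  assume h: "eps k z = 1"
  have inj: "inj_on (\<lambda>j. cis (2 * pi * real j / real (p ^ k))) {..<p ^ k}"
    using Complex.bij_betw_roots_unity[OF pow_pos(2)] unfolding bij_betw_def by metis
  have z: "nat (z k) < p ^ k" using ZpD[OF assms, of k] by (metis nat_less_iff of_nat_power)
  have "cis (2 * pi * real (nat (z k)) / real (p ^ k)) = cis (2 * pi * real 0 / real (p ^ k))"
    using h ZpD(1)[OF assms, of k] by (simp add: eps_def)
  then have "nat (z k) = 0" using inj_onD[OF inj, of "nat (z k)" 0] z pow_pos(2)[of k] by simp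
  then show "z k = 0" using ZpD(1)[OF assms, of k] by simp
qed (simp add: eps_def)

end

section \<open>Extensions by the p-adic integers\<close>

lemma (in abelian_group) add_hom_group_hom:
  assumes "\<psi> \<in> hom (add_monoid G) K" "group K"
  shows "group_hom (add_monoid G) K \<psi>"
  using assms a_group by (simp add: group_hom_def group_hom_axioms_def)

locale padic_module = padic_prime p + H: Module.module "Zp p" H for p :: nat and H :: "(padic, 'h, 'n) module_scheme"
begin

lemma zint_smult: "x \<in> carrier H \<Longrightarrow> zint (int n) \<odot>\<^bsub>H\<^esub> x = add_pow H n x"
proof (induction n)
  case 0 then show ?case by (simp add: zint_0)
next
  case (Suc n)
  have "zint (int (Suc n)) \<odot>\<^bsub>H\<^esub> x = (zint (int n) \<oplus>\<^bsub>R\<^esub> zint 1) \<odot>\<^bsub>H\<^esub> x" by (simp add: zint_add[symmetric] add.commute)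
  also have "\<dots> = add_pow H n x \<oplus>\<^bsub>H\<^esub> x" using Suc H.smult_l_distr[OF zint_closed zint_closed Suc.prems, of "int n" 1]
    by (simp add: zint_1)
  finally show ?case using Suc by (simp add: add_pow_def)
qed

lemma add_hom_pow:
  assumes "group K" "\<psi> \<in> hom (add_monoid H) K" "x \<in> carrier H"
  shows "\<psi> (zint (int n) \<odot>\<^bsub>H\<^esub> x) = \<psi> x [^]\<^bsub>K\<^esub> n"
proof -
  interpret group_hom "add_monoid H" K \<psi> by (rule H.M.add_hom_group_hom[OF assms(2,1)])
  show ?thesis using hom_nat_pow[of x n] assms(3) by (simp add: zint_smult add_pow_def)
qed

text \<open>Additive maps into a group of exponent \<open>p^l\<close> respect p-adic scalars
  automatically: \<open>z\<close> is the integer \<open>z l\<close> plus a multiple of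
  \<open>p^l\<close>, and the latter is killed.\<close>

lemma add_hom_smult:
  assumes "group K" "\<psi> \<in> hom (add_monoid H) K" "x \<in> carrier H" "z \<in> carrier R"
    and "\<And>y. y \<in> carrier K \<Longrightarrow> y [^]\<^bsub>K\<^esub> (p ^ l) = \<one>\<^bsub>K\<^esub>"
  shows "\<psi> (z \<odot>\<^bsub>H\<^esub> x) = \<psi> x [^]\<^bsub>K\<^esub> nat (z l)"
proof -
  interpret group_hom "add_monoid H" K \<psi> by (rule H.M.add_hom_group_hom[OF assms(2,1)])
  obtain w where w: "w \<in> carrier R" "z = zint (z l) \<oplus>\<^bsub>R\<^esub> (zint (int p ^ l) \<otimes>\<^bsub>R\<^esub> w)" using Zp_split[OF assms(4)] .
  have nat: "zint (z l) = zint (int (nat (z l)))" using ZpD(1)[OF assms(4)] by simp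
  have wx: "w \<odot>\<^bsub>H\<^esub> x \<in> carrier H" using w assms(3) by simp
  have "z \<odot>\<^bsub>H\<^esub> x = zint (int (nat (z l))) \<odot>\<^bsub>H\<^esub> x \<oplus>\<^bsub>H\<^esub> zint (int (p ^ l)) \<odot>\<^bsub>H\<^esub> (w \<odot>\<^bsub>H\<^esub> x)"
    using w assms(3) by (subst w(2), subst nat) (simp add: H.smult_l_distr H.smult_assoc1)
  then have "\<psi> (z \<odot>\<^bsub>H\<^esub> x) = \<psi> (zint (int (nat (z l))) \<odot>\<^bsub>H\<^esub> x) \<otimes>\<^bsub>K\<^esub> \<psi> (zint (int (p ^ l)) \<odot>\<^bsub>H\<^esub> (w \<odot>\<^bsub>H\<^esub> x))"
    using hom_mult assms(3) wx by (simp del: of_nat_power)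
  also have "\<dots> = \<psi> x [^]\<^bsub>K\<^esub> nat (z l) \<otimes>\<^bsub>K\<^esub> \<psi> (w \<odot>\<^bsub>H\<^esub> x) [^]\<^bsub>K\<^esub> (p ^ l)"
    unfolding add_hom_pow[OF assms(1,2,3)] add_hom_pow[OF assms(1,2) wx] ..
  also have "\<psi> (w \<odot>\<^bsub>H\<^esub> x) [^]\<^bsub>K\<^esub> (p ^ l) = \<one>\<^bsub>K\<^esub>" using assms(5) hom_closed wx by simp
  finally show ?thesis using hom_closed assms(3) by simp
qed

end

locale padic_ext = padic_module p H + G: comm_group G
  for p :: nat and H :: "(padic, 'h, 'n) module_scheme" and G :: "('g, 'm) monoid_scheme" +
  fixes i :: "padic \<Rightarrow> 'h" and q :: "'h \<Rightarrow> 'g" and k :: nat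
  assumes finG: "finite (carrier G)" and ordG: "order G = p ^ k"
    and i_mod_hom: "i \<in> mod_hom (Zp p) (Zp_self p) H" and i_inj: "inj_on i (carrier (Zp p))"
    and q_epi: "q \<in> epi (add_monoid H) G" and ker_q: "kernel (add_monoid H) G q = i ` carrier (Zp p)"
begin

lemma Zp_self_simps: "carrier (Zp_self p) = carrier R" "add (Zp_self p) = add R" "smult (Zp_self p) = mult R"
  by (simp_all add: Zp_self_def ring.defs)

lemma i_closed [simp, intro]: "z \<in> carrier R \<Longrightarrow> i z \<in> carrier H"
  and i_add: "z \<in> carrier R \<Longrightarrow> w \<in> carrier R \<Longrightarrow> i (z \<oplus>\<^bsub>R\<^esub> w) = i z \<oplus>\<^bsub>H\<^esub> i w"
  and i_mult: "z \<in> carrier R \<Longrightarrow> w \<in> carrier R \<Longrightarrow> i (z \<otimes>\<^bsub>R\<^esub> w) = z \<odot>\<^bsub>H\<^esub> i w"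
  using i_mod_hom by (auto simp: mod_hom_def hom_def Zp_self_simps)

lemma i_eq_iff: "z \<in> carrier R \<Longrightarrow> w \<in> carrier R \<Longrightarrow> i z = i w \<longleftrightarrow> z = w"
  using i_inj by (auto simp: inj_on_def)

lemma i_zero: "i \<zero>\<^bsub>R\<^esub> = \<zero>\<^bsub>H\<^esub>"
  using i_mult[of "\<zero>\<^bsub>R\<^esub>" "\<zero>\<^bsub>R\<^esub>"] by simp

lemma i_eq_smult: "z \<in> carrier R \<Longrightarrow> i z = z \<odot>\<^bsub>H\<^esub> i \<one>\<^bsub>R\<^esub>"
  using i_mult[of z "\<one>\<^bsub>R\<^esub>"] by simp

sublocale qh: group_hom "add_monoid H" G q
  using q_epi H.M.add_hom_group_hom G.is_group by (auto simp: epi_def)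

lemma q_closed [simp, intro]: "x \<in> carrier H \<Longrightarrow> q x \<in> carrier G"
  and q_add: "x \<in> carrier H \<Longrightarrow> y \<in> carrier H \<Longrightarrow> q (x \<oplus>\<^bsub>H\<^esub> y) = q x \<otimes>\<^bsub>G\<^esub> q y"
  and q_surj: "q ` carrier H = carrier G"
  using qh.hom_closed qh.hom_mult q_epi by (auto simp: epi_def)

lemma q_ker: "x \<in> carrier H \<Longrightarrow> q x = \<one>\<^bsub>G\<^esub> \<longleftrightarrow> (\<exists>z\<in>carrier R. x = i z)"
  using ker_q by (auto simp: kernel_def)

lemma q_i [simp]: "z \<in> carrier R \<Longrightarrow> q (i z) = \<one>\<^bsub>G\<^esub>"
  using q_ker by auto

lemma q_lift:
  assumes "g \<in> carrier G"
  obtains h where "h \<in> carrier H" "q h = g"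
  using q_surj assms by (metis imageE)

lemma q_eqE:
  assumes "x \<in> carrier H" "y \<in> carrier H" "q x = q y"
  obtains z where "z \<in> carrier R" "x = y \<oplus>\<^bsub>H\<^esub> i z"
proof -
  have "q (\<ominus>\<^bsub>H\<^esub> y \<oplus>\<^bsub>H\<^esub> x) = \<one>\<^bsub>G\<^esub>"
    using assms qh.hom_inv[of y] q_closed[OF assms(2)] by (simp add: q_add a_inv_def[symmetric])
  then obtain z where z: "z \<in> carrier R" "\<ominus>\<^bsub>H\<^esub> y \<oplus>\<^bsub>H\<^esub> x = i z"
    using q_ker[of "\<ominus>\<^bsub>H\<^esub> y \<oplus>\<^bsub>H\<^esub> x"] assms by auto
  have "x = y \<oplus>\<^bsub>H\<^esub> (\<ominus>\<^bsub>H\<^esub> y \<oplus>\<^bsub>H\<^esub> x)" using assms by (simp add: H.M.r_neg2)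
  then show ?thesis using that z by simp
qed

lemma G_pow: "g \<in> carrier G \<Longrightarrow> g [^]\<^bsub>G\<^esub> (p ^ k) = \<one>\<^bsub>G\<^esub>"
  using G.pow_order_eq_1 ordG by simp

abbreviation pk where "pk \<equiv> zint (int p ^ k)"

text \<open>\<open>lam h / p\<^sup>k\<close> is the image of \<open>h\<close> under the extension of the inverse of \<open>i\<close> to a linear map
  from \<open>H\<close> to \<open>\<rat>\<^sub>p\<close>; the kernel of \<open>lam\<close> is the torsion of \<open>H\<close>.\<close>

definition lam :: "'h \<Rightarrow> padic" where
  "lam h = (THE z. z \<in> carrier R \<and> i z = pk \<odot>\<^bsub>H\<^esub> h)"

lemma lam:
  assumes "h \<in> carrier H"
  shows "lam h \<in> carrier R \<and> i (lam h) = pk \<odot>\<^bsub>H\<^esub> h"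
proof -
  have "q (pk \<odot>\<^bsub>H\<^esub> h) = \<one>\<^bsub>G\<^esub>"
    using add_hom_pow[OF G.is_group qh.homh assms, of "p ^ k"] G_pow assms by simp
  then obtain z where z: "z \<in> carrier R" "i z = pk \<odot>\<^bsub>H\<^esub> h" using q_ker[of "pk \<odot>\<^bsub>H\<^esub> h"] assms by auto
  show ?thesis unfolding lam_def
  proof (rule theI[of _ z])
    fix w assume "w \<in> carrier R \<and> i w = pk \<odot>\<^bsub>H\<^esub> h"
    then show "w = z" using z i_eq_iff[of w z] by metis
  qed (use z in simp)
qed

lemmas lam_closed [simp, intro] = lam[THEN conjunct1] and i_lam = lam[THEN conjunct2]

lemma lam_eqI: "h \<in> carrier H \<Longrightarrow> z \<in> carrier R \<Longrightarrow> i z = pk \<odot>\<^bsub>H\<^esub> h \<Longrightarrow> lam h = z"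
  using lam[of h] i_eq_iff by metis

lemma lam_add: "x \<in> carrier H \<Longrightarrow> y \<in> carrier H \<Longrightarrow> lam (x \<oplus>\<^bsub>H\<^esub> y) = lam x \<oplus>\<^bsub>R\<^esub> lam y"
  by (intro lam_eqI) (auto simp: i_add i_lam H.smult_r_distr)

lemma lam_smult: "x \<in> carrier H \<Longrightarrow> z \<in> carrier R \<Longrightarrow> lam (z \<odot>\<^bsub>H\<^esub> x) = z \<otimes>\<^bsub>R\<^esub> lam x"
  by (intro lam_eqI) (auto simp: i_mult i_lam H.smult_assoc1[symmetric] R.m_comm)

lemma lam_i: "z \<in> carrier R \<Longrightarrow> lam (i z) = pk \<otimes>\<^bsub>R\<^esub> z"
  by (intro lam_eqI) (auto simp: i_mult)

lemma lam_zero: "lam \<zero>\<^bsub>H\<^esub> = \<zero>\<^bsub>R\<^esub>"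
  using lam_i[of "\<zero>\<^bsub>R\<^esub>"] by (simp add: i_zero)

lemma lam_minus: "x \<in> carrier H \<Longrightarrow> lam (\<ominus>\<^bsub>H\<^esub> x) = \<ominus>\<^bsub>R\<^esub> lam x"
  by (rule R.minus_equality[symmetric]) (auto simp: lam_add[symmetric] H.M.l_neg lam_zero)

text \<open>Elements with the same image under \<open>q\<close> differ by some \<open>i z\<close>,
  and \<open>lam\<close> detects it because it acts there as multiplication by \<open>p^k\<close>.
  Thus \<open>(lam, q)\<close> embeds \<open>H\<close> in the product of \<open>Z_p\<close> and
  \<open>G\<close>.\<close>

lemma lam_q_inj:
  assumes "x \<in> carrier H" "y \<in> carrier H" "q x = q y" "lam x = lam y"
  shows "x = y"
proof -
  obtain z where z: "z \<in> carrier R" "x = y \<oplus>\<^bsub>H\<^esub> i z" using q_eqE[OF assms(1-3)] .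
  have "lam x = lam y \<oplus>\<^bsub>R\<^esub> (pk \<otimes>\<^bsub>R\<^esub> z)" using z assms(2) by (simp add: lam_add lam_i)
  then have "pk \<otimes>\<^bsub>R\<^esub> z = \<zero>\<^bsub>R\<^esub>" using assms(2,4) z(1) R.add.l_cancel_one' by (metis R.m_closed lam_closed zint_closed)
  then have "z = \<zero>\<^bsub>R\<^esub>" using zint_pow_cancel z by metis
  then show ?thesis using z(2) assms(2) by (simp add: i_zero)
qed

text \<open>The ambiguity \<open>i z\<close> changes \<open>lam / p^k\<close> by the p-adic integer
  \<open>z\<close>.\<close>

lemma eps_lam_cong:
  assumes "x \<in> carrier H" "y \<in> carrier H" "q x = q y"
  shows "eps k (lam x) = eps k (lam y)"
proof -
  obtain z where z: "z \<in> carrier R" "x = y \<oplus>\<^bsub>H\<^esub> i z" using q_eqE[OF assms(1-3)] .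
  have "eps k (pk \<otimes>\<^bsub>R\<^esub> z) = 1" using eps_shift[OF z(1), of 0 k] ZpD[OF z(1), of 0] by (simp add: eps_def)
  then show ?thesis using z assms(2) by (simp add: lam_add lam_i eps_add)
qed

text \<open>The character that classifies the extension: \<open>lam / p^k\<close> carries
  \<open>i z\<close> to \<open>z\<close>, hence induces a map from \<open>G\<close> to
  \<open>Q_p/Z_p\<close>.\<close>

definition chi :: "'g \<Rightarrow> complex" where
  "chi = (\<lambda>g\<in>carrier G. eps k (lam (SOME h. h \<in> carrier H \<and> q h = g)))"

lemma chi_q: "h \<in> carrier H \<Longrightarrow> chi (q h) = eps k (lam h)"
proof -
  assume h: "h \<in> carrier H"
  define s where "s = (SOME x. x \<in> carrier H \<and> q x = q h)"
  have "s \<in> carrier H \<and> q s = q h" unfolding s_def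
    by (rule someI[of _ h]) (use h in simp)
  moreover have "chi (q h) = eps k (lam s)" using q_closed[OF h] by (simp add: chi_def s_def)
  ultimately show ?thesis using eps_lam_cong[of s h] h by metis
qed

lemma chi_char: "chi \<in> chars G (carrier G)"
proof -
  have "chi (x \<otimes>\<^bsub>G\<^esub> y) = chi x * chi y" if xy: "x \<in> carrier G" "y \<in> carrier G" for x y
  proof -
    obtain h h' where "h \<in> carrier H" "q h = x" "h' \<in> carrier H" "q h' = y" using q_lift xy by metis
    then show ?thesis using chi_q[of h] chi_q[of h'] chi_q[of "h \<oplus>\<^bsub>H\<^esub> h'"] q_add[of h h']
      lam_add[of h h'] eps_add[of k "lam h" "lam h'"] H.M.a_closed[of h h'] by metis
  qed
  moreover have "chi \<one>\<^bsub>G\<^esub> = 1" using chi_q[of "\<zero>\<^bsub>H\<^esub>"] q_i[of "\<zero>\<^bsub>R\<^esub>"] by (simp add: i_zero lam_zero)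
  ultimately show ?thesis by (auto simp: chars_def chi_def)
qed

text \<open>Together with \<open>lam_q_inj\<close> this identifies \<open>H\<close> with the fibre
  product of \<open>chi\<close> and \<open>Q_p -> Q_p/Z_p\<close>. A lift of \<open>g\<close> is
  corrected by \<open>i z\<close>, where \<open>p^k z\<close> is the error in
  \<open>lam\<close>.\<close>

lemma lam_q_surj:
  assumes "a \<in> carrier R" "g \<in> carrier G" "eps k a = chi g"
  obtains h where "h \<in> carrier H" "lam h = a" "q h = g"
proof -
  obtain x where x: "x \<in> carrier H" "q x = g" using q_lift assms(2) by metis
  let ?d = "a \<oplus>\<^bsub>R\<^esub> \<ominus>\<^bsub>R\<^esub> lam x"
  have d: "?d \<in> carrier R" using assms x by simp
  have a: "a = lam x \<oplus>\<^bsub>R\<^esub> ?d" using assms x by (simp add: R.a_lcomm[of "lam x"] R.r_neg)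
  have "eps k a = eps k (lam x) * eps k ?d" by (subst a) (rule eps_add)
  then have "eps k ?d = 1" using assms(3) chi_q[OF x(1)] x(2) eps_nonzero[of k "lam x"] by simp
  then have "?d k = 0" using eps_eq_1[OF d] by simp
  then obtain z where z: "z \<in> carrier R" "?d = pk \<otimes>\<^bsub>R\<^esub> z" using Zp_divide[OF d] by blast
  show ?thesis
  proof (rule that)
    show "x \<oplus>\<^bsub>H\<^esub> i z \<in> carrier H" using x z by simp
    show "lam (x \<oplus>\<^bsub>H\<^esub> i z) = a"
      unfolding lam_add[OF x(1) i_closed[OF z(1)]] lam_i[OF z(1)] z(2)[symmetric] by (rule a[symmetric])
    show "q (x \<oplus>\<^bsub>H\<^esub> i z) = g" using x z assms(2) by (simp add: q_add)
  qed
qed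

end

section \<open>Homomorphisms from an extension as subgroups with a character\<close>

definition slice2 :: "('g, 'm) monoid_scheme \<Rightarrow> ('g \<times> 'c) set \<Rightarrow> 'c set" where
  "slice2 G E = {f. (\<one>\<^bsub>G\<^esub>, f) \<in> E}"

definition slice1 :: "('c, 'm) monoid_scheme \<Rightarrow> ('g \<times> 'c) set \<Rightarrow> 'g set" where
  "slice1 K E = {g. (g, \<one>\<^bsub>K\<^esub>) \<in> E}"

text \<open>Compatibility of \<theta> with the character of an extension is left out, so that these
  data depend on \<open>G\<close> and \<open>K\<close> only; it is added separately in
  \<open>chi_pairs\<close> and \<open>pair_char\<close>.\<close>

definition pairs :: "('g, 'm) monoid_scheme \<Rightarrow> ('c, 'n) monoid_scheme \<Rightarrow> (('g \<times> 'c) set \<times> ('g \<times> 'c \<Rightarrow> complex)) set" where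
  "pairs G K = {(E, \<theta>). subgroup E (G \<times>\<times> K) \<and> fst ` E = carrier G \<and> \<theta> \<in> chars (G \<times>\<times> K) E \<and>
     inj_on (\<lambda>f. \<theta> (\<one>\<^bsub>G\<^esub>, f)) (slice2 G E)}"

lemma comm_group_DirProd:
  assumes "comm_group G" "comm_group K"
  shows "comm_group (G \<times>\<times> K)"
proof -
  interpret G: comm_group G by fact
  interpret K: comm_group K by fact
  show ?thesis
    by (rule group.group_comm_groupI[OF DirProd_group[OF G.is_group K.is_group]]) (auto simp: G.m_comm K.m_comm)
qed

lemma finite_pairs:
  assumes "comm_group G" "comm_group K" "finite (carrier G)" "finite (carrier K)"
  shows "finite (pairs G K)"
proof -
  have fin: "finite (carrier (G \<times>\<times> K))" using assms by simp
  have "pairs G K \<subseteq> Sigma {E. subgroup E (G \<times>\<times> K)} (chars (G \<times>\<times> K))" by (auto simp: pairs_def)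
  moreover have "finite {E. subgroup E (G \<times>\<times> K)}"
    by (rule finite_subset[of _ "Pow (carrier (G \<times>\<times> K))"]) (use fin subgroup.subset in \<open>blast+\<close>)
  then have "finite (Sigma {E. subgroup E (G \<times>\<times> K)} (chars (G \<times>\<times> K)))"
    by (rule finite_SigmaI) (use comm_group.card_chars(2)[OF comm_group_DirProd[OF assms(1,2)] fin] in blast)
  ultimately show ?thesis by (rule finite_subset)
qed

lemma subgroup_DirProdD:
  assumes "group G" "group K" "subgroup E (G \<times>\<times> K)"
  shows "(a, b) \<in> E \<Longrightarrow> (c, d) \<in> E \<Longrightarrow> (a \<otimes>\<^bsub>G\<^esub> c, b \<otimes>\<^bsub>K\<^esub> d) \<in> E"
    "(a, b) \<in> E \<Longrightarrow> (inv\<^bsub>G\<^esub> a, inv\<^bsub>K\<^esub> b) \<in> E"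
    "(\<one>\<^bsub>G\<^esub>, \<one>\<^bsub>K\<^esub>) \<in> E" "(a, b) \<in> E \<Longrightarrow> a \<in> carrier G" "(a, b) \<in> E \<Longrightarrow> b \<in> carrier K"
proof -
  interpret E: subgroup E "G \<times>\<times> K" by fact
  show ab: "(a, b) \<in> E \<Longrightarrow> a \<in> carrier G" "(a, b) \<in> E \<Longrightarrow> b \<in> carrier K" using E.subset by auto
  show "(a, b) \<in> E \<Longrightarrow> (c, d) \<in> E \<Longrightarrow> (a \<otimes>\<^bsub>G\<^esub> c, b \<otimes>\<^bsub>K\<^esub> d) \<in> E" using E.m_closed[of "(a, b)" "(c, d)"] by simp
  show "(a, b) \<in> E \<Longrightarrow> (inv\<^bsub>G\<^esub> a, inv\<^bsub>K\<^esub> b) \<in> E"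
    using E.m_inv_closed[of "(a, b)"] ab inv_DirProd[OF assms(1,2)] by metis
  show "(\<one>\<^bsub>G\<^esub>, \<one>\<^bsub>K\<^esub>) \<in> E" using E.one_closed by simp
qed

lemma subgroup_slice2:
  assumes "group G" "group K" "subgroup E (G \<times>\<times> K)"
  shows "subgroup (slice2 G E) K"
proof -
  interpret G: group G by fact
  interpret K: group K by fact
  note D = subgroup_DirProdD[OF assms]
  show ?thesis
  proof (rule K.subgroupI)
    show "slice2 G E \<noteq> {}" "slice2 G E \<subseteq> carrier K" using D(3,5) by (auto simp: slice2_def)
    show "inv\<^bsub>K\<^esub> a \<in> slice2 G E" if "a \<in> slice2 G E" for a
      using D(2)[of "\<one>\<^bsub>G\<^esub>" a] that by (simp add: slice2_def)
    show "a \<otimes>\<^bsub>K\<^esub> b \<in> slice2 G E" if "a \<in> slice2 G E" "b \<in> slice2 G E" for a b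
      using D(1)[of "\<one>\<^bsub>G\<^esub>" a "\<one>\<^bsub>G\<^esub>" b] that by (simp add: slice2_def)
  qed
qed

lemma char_DirProd_mult:
  assumes "\<theta> \<in> chars (G \<times>\<times> K) E" "(a, b) \<in> E" "(c, d) \<in> E"
  shows "\<theta> (a \<otimes>\<^bsub>G\<^esub> c, b \<otimes>\<^bsub>K\<^esub> d) = \<theta> (a, b) * \<theta> (c, d)"
  using charsD(3)[OF assms] by simp

locale padic_ext_target = padic_ext p H G i q k + K: comm_group K
  for p :: nat and H :: "(padic, 'h, 'n) module_scheme" and G :: "('g, 'm) monoid_scheme" and i q k
    and K :: "('c, 'o) monoid_scheme" +
  fixes l :: nat
  assumes finK: "finite (carrier K)" and ordK: "order K = p ^ l"
begin

definition homs where "homs = hom (add_monoid H) K \<inter> extensional (carrier H)"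

definition graph where "graph \<psi> = (\<lambda>h. (q h, \<psi> h)) ` carrier H"

definition expo :: "('g \<times> 'c) set \<Rightarrow> nat" where "expo E = (SOME j. card (slice2 G E) = p ^ j)"

text \<open>The map \<open>\<psi> \<circ> i : \<int>\<^sub>p \<rightarrow> K\<close> has kernel \<open>p\<^sup>j \<int>\<^sub>p\<close> with \<open>j = expo (graph \<psi>)\<close>, so \<open>lam / p\<^sup>k\<^sup>+\<^sup>j\<close> is
  well defined on the graph modulo \<open>\<int>\<^sub>p\<close>.\<close>

definition theta where
  "theta \<psi> = (\<lambda>e\<in>graph \<psi>. eps (k + expo (graph \<psi>)) (lam (SOME h. h \<in> carrier H \<and> (q h, \<psi> h) = e)))"

lemma K_pow: "y \<in> carrier K \<Longrightarrow> y [^]\<^bsub>K\<^esub> (p ^ l) = \<one>\<^bsub>K\<^esub>"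
  using K.pow_order_eq_1 ordK by simp

lemma expo:
  assumes "subgroup E (G \<times>\<times> K)"
  shows "card (slice2 G E) = p ^ expo E"
proof -
  have "card (slice2 G E) dvd p ^ l"
    using K.lagrange[OF subgroup_slice2[OF G.is_group K.is_group assms]] ordK by (metis dvd_triv_right)
  then obtain j where "card (slice2 G E) = p ^ j" using prime_p by (metis divides_primepow_nat)
  then show ?thesis unfolding expo_def by (rule someI)
qed

context
  fixes \<psi> assumes \<psi>: "\<psi> \<in> hom (add_monoid H) K"
begin

interpretation \<psi>h: group_hom "add_monoid H" K \<psi> by (rule H.M.add_hom_group_hom[OF \<psi> K.is_group])

lemma psi_add: "x \<in> carrier H \<Longrightarrow> y \<in> carrier H \<Longrightarrow> \<psi> (x \<oplus>\<^bsub>H\<^esub> y) = \<psi> x \<otimes>\<^bsub>K\<^esub> \<psi> y"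
  and psi_closed: "x \<in> carrier H \<Longrightarrow> \<psi> x \<in> carrier K"
  and psi_zero: "\<psi> \<zero>\<^bsub>H\<^esub> = \<one>\<^bsub>K\<^esub>"
  and psi_minus: "x \<in> carrier H \<Longrightarrow> \<psi> (\<ominus>\<^bsub>H\<^esub> x) = inv\<^bsub>K\<^esub> (\<psi> x)"
  using \<psi>h.hom_mult \<psi>h.hom_closed \<psi>h.hom_one \<psi>h.hom_inv by (auto simp: a_inv_def)

lemma psi_smult: "x \<in> carrier H \<Longrightarrow> z \<in> carrier R \<Longrightarrow> \<psi> (z \<odot>\<^bsub>H\<^esub> x) = \<psi> x [^]\<^bsub>K\<^esub> nat (z l)"
  using add_hom_smult[OF K.is_group \<psi> _ _ K_pow] by blast

lemma subgroup_graph: "subgroup (graph \<psi>) (G \<times>\<times> K)"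
proof (rule group.subgroupI)
  show "group (G \<times>\<times> K)" by (rule DirProd_group) (rule G.is_group K.is_group)+
  show "graph \<psi> \<subseteq> carrier (G \<times>\<times> K)" by (auto simp: graph_def psi_closed)
  show "graph \<psi> \<noteq> {}" by (auto simp: graph_def)
  fix a b assume "a \<in> graph \<psi>" "b \<in> graph \<psi>"
  then obtain h h' where h: "h \<in> carrier H" "a = (q h, \<psi> h)" "h' \<in> carrier H" "b = (q h', \<psi> h')" by (auto simp: graph_def)
  have "a \<otimes>\<^bsub>G \<times>\<times> K\<^esub> b = (q (h \<oplus>\<^bsub>H\<^esub> h'), \<psi> (h \<oplus>\<^bsub>H\<^esub> h'))" using h by (simp add: q_add psi_add)
  then show "a \<otimes>\<^bsub>G \<times>\<times> K\<^esub> b \<in> graph \<psi>" using h by (auto simp: graph_def)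
  have "inv\<^bsub>G \<times>\<times> K\<^esub> a = (q (\<ominus>\<^bsub>H\<^esub> h), \<psi> (\<ominus>\<^bsub>H\<^esub> h))"
    using h psi_minus[OF h(1)] qh.hom_inv[of h] inv_DirProd[OF G.is_group K.is_group q_closed[OF h(1)] psi_closed[OF h(1)]]
    by (simp add: a_inv_def)
  then show "inv\<^bsub>G \<times>\<times> K\<^esub> a \<in> graph \<psi>" using h by (auto simp: graph_def)
qed

lemma fst_graph: "fst ` graph \<psi> = carrier G"
  using q_surj by (auto simp: graph_def image_image)

lemma slice2_graph: "slice2 G (graph \<psi>) = (\<lambda>z. \<psi> (i z)) ` carrier R"
proof -
  have "f \<in> (\<lambda>z. \<psi> (i z)) ` carrier R" if "f \<in> slice2 G (graph \<psi>)" for f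
  proof -
    have "(\<one>\<^bsub>G\<^esub>, f) \<in> graph \<psi>" using that by (simp add: slice2_def)
    then obtain h where h: "h \<in> carrier H" "(\<one>\<^bsub>G\<^esub>, f) = (q h, \<psi> h)" unfolding graph_def by blast
    then have "q h = \<one>\<^bsub>G\<^esub>" "f = \<psi> h" by simp_all
    with h(1) show ?thesis using q_ker by blast
  qed
  moreover have "\<psi> (i z) \<in> slice2 G (graph \<psi>)" if "z \<in> carrier R" for z
    using that q_i[OF that] i_closed[OF that] by (force simp: slice2_def graph_def)
  ultimately show ?thesis by blast
qed

abbreviation (input) j where "j \<equiv> expo (graph \<psi>)"

text \<open>The image of \<psi> on \<open>i Z_p\<close> has order \<open>p^j\<close>, so
  \<open>p^j\<close> kills it and \<open>\<psi> (i z)\<close> depends only on \<open>z\<close>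
  modulo \<open>p^j\<close>. The \<open>p^j\<close> residues thus map onto a set of
  \<open>p^j\<close> elements, hence injectively.\<close>

lemma psi_i_zero:
  assumes z: "z \<in> carrier R"
  shows "\<psi> (i z) = \<one>\<^bsub>K\<^esub> \<longleftrightarrow> z j = 0"
proof -
  let ?S = "slice2 G (graph \<psi>)"
  note S = subgroup_slice2[OF G.is_group K.is_group subgroup_graph]
  have c: "card ?S = p ^ j" by (rule expo[OF subgroup_graph])
  have pj: "\<psi> (i (zint (int p ^ j) \<otimes>\<^bsub>R\<^esub> w)) = \<one>\<^bsub>K\<^esub>" if w: "w \<in> carrier R" for w
  proof -
    have "\<psi> (i w) [^]\<^bsub>K\<^esub> card ?S = \<one>\<^bsub>K\<^esub>"
      using K.subgroup_pow_card[OF S] slice2_graph w by blast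
    then show ?thesis using add_hom_pow[OF K.is_group \<psi> i_closed[OF w], of "p ^ j"] c by (simp add: i_mult w)
  qed
  have red: "\<psi> (i z) = \<psi> (i (zint (z j)))" if z: "z \<in> carrier R" for z
  proof -
    obtain w where w: "w \<in> carrier R" "z = zint (z j) \<oplus>\<^bsub>R\<^esub> (zint (int p ^ j) \<otimes>\<^bsub>R\<^esub> w)" using Zp_split[OF z] .
    have "\<psi> (i z) = \<psi> (i (zint (z j) \<oplus>\<^bsub>R\<^esub> (zint (int p ^ j) \<otimes>\<^bsub>R\<^esub> w)))"
      by (rule arg_cong[OF w(2), of "\<lambda>z. \<psi> (i z)"])
    also have "\<dots> = \<psi> (i (zint (z j))) \<otimes>\<^bsub>K\<^esub> \<psi> (i (zint (int p ^ j) \<otimes>\<^bsub>R\<^esub> w))"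
      using w(1) by (simp add: i_add psi_add)
    finally show ?thesis using pj[OF w(1)] psi_closed[OF i_closed[OF zint_closed]] by simp
  qed
  have surj: "(\<lambda>a. \<psi> (i (zint (int a)))) ` {..<p ^ j} = ?S"
  proof -
    have "\<psi> (i z) \<in> (\<lambda>a. \<psi> (i (zint (int a)))) ` {..<p ^ j}" if z: "z \<in> carrier R" for z
    proof (rule image_eqI[of _ _ "nat (z j)"])
      show "\<psi> (i z) = \<psi> (i (zint (int (nat (z j)))))" using red[OF z] ZpD(1)[OF z] by simp
      show "nat (z j) \<in> {..<p ^ j}" using ZpD(1,2)[OF z, of j] by (simp add: nat_less_iff)
    qed
    then show ?thesis unfolding slice2_graph by auto
  qed
  have "inj_on (\<lambda>a. \<psi> (i (zint (int a)))) {..<p ^ j}"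
    by (rule eq_card_imp_inj_on) (use surj c in auto)
  then have "nat (z j) = 0" if "\<psi> (i z) = \<one>\<^bsub>K\<^esub>"
  proof (rule inj_onD)
    show "\<psi> (i (zint (int (nat (z j))))) = \<psi> (i (zint (int 0)))"
      using that red[OF z] ZpD(1)[OF z] by (simp add: zint_0 i_zero psi_zero)
    show "nat (z j) \<in> {..<p ^ j}" using ZpD(1,2)[OF z, of j] by (simp add: nat_less_iff)
  qed (use pow_pos in simp)
  then show ?thesis using ZpD(1)[OF z, of j] red[OF z] by (auto simp: zint_0 i_zero psi_zero)
qed

lemma theta:
  assumes h: "h \<in> carrier H"
  shows "theta \<psi> (q h, \<psi> h) = eps (k + j) (lam h)"
proof -
  define s where "s = (SOME x. x \<in> carrier H \<and> (q x, \<psi> x) = (q h, \<psi> h))"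
  have s: "s \<in> carrier H \<and> (q s, \<psi> s) = (q h, \<psi> h)" unfolding s_def
    by (rule someI[of _ h]) (use h in simp)
  then obtain z where z: "z \<in> carrier R" "s = h \<oplus>\<^bsub>H\<^esub> i z" using q_eqE[of s h] h by auto
  have "\<psi> h = \<psi> h \<otimes>\<^bsub>K\<^esub> \<psi> (i z)" using s z h psi_add[of h "i z"] by auto
  then have "\<psi> (i z) = \<one>\<^bsub>K\<^esub>" using psi_closed h z K.r_cancel_one' by (metis i_closed K.l_cancel_one')
  \<comment> \<open>Here \<open>z\<close> is divisible by \<open>p^j\<close>, so the ambiguity
    \<open>p^k z\<close> in \<open>lam\<close> vanishes modulo \<open>p^(k+j)\<close>.\<close>
  then have "eps (j + k) (pk \<otimes>\<^bsub>R\<^esub> z) = 1" using psi_i_zero z eps_shift[of z j k] eps_eq_1 by simp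
  then have "eps (k + j) (lam s) = eps (k + j) (lam h)" using z h by (simp add: lam_add lam_i eps_add add.commute)
  then show ?thesis using h unfolding theta_def by (auto simp: graph_def s_def)
qed

lemma theta_char: "theta \<psi> \<in> chars (G \<times>\<times> K) (graph \<psi>)"
proof -
  have "theta \<psi> (x \<otimes>\<^bsub>G \<times>\<times> K\<^esub> y) = theta \<psi> x * theta \<psi> y" if "x \<in> graph \<psi>" "y \<in> graph \<psi>" for x y
  proof -
    obtain h h' where h: "h \<in> carrier H" "x = (q h, \<psi> h)" "h' \<in> carrier H" "y = (q h', \<psi> h')" using \<open>x \<in> graph \<psi>\<close> \<open>y \<in> graph \<psi>\<close> by (auto simp: graph_def)
    have "x \<otimes>\<^bsub>G \<times>\<times> K\<^esub> y = (q (h \<oplus>\<^bsub>H\<^esub> h'), \<psi> (h \<oplus>\<^bsub>H\<^esub> h'))" using h by (simp add: q_add psi_add)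
    then show ?thesis using theta[of h] theta[of h'] theta[of "h \<oplus>\<^bsub>H\<^esub> h'"] h by (simp add: lam_add eps_add)
  qed
  moreover have "theta \<psi> (q \<zero>\<^bsub>H\<^esub>, \<psi> \<zero>\<^bsub>H\<^esub>) = 1" by (simp add: theta lam_zero)
  then have "theta \<psi> \<one>\<^bsub>G \<times>\<times> K\<^esub> = 1" using qh.hom_one by (simp add: psi_zero)
  ultimately show ?thesis by (simp add: chars_def theta_def)
qed

text \<open>At \<open>(1, \<psi> (i z))\<close> the value is the class of \<open>z / p^j\<close>,
  which is trivial exactly when \<open>\<psi> (i z)\<close> is.\<close>

lemma theta_inj: "inj_on (\<lambda>f. theta \<psi> (\<one>\<^bsub>G\<^esub>, f)) (slice2 G (graph \<psi>))"
proof (rule inj_onI)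
  fix f f' assume "f \<in> slice2 G (graph \<psi>)" "f' \<in> slice2 G (graph \<psi>)" and eq: "theta \<psi> (\<one>\<^bsub>G\<^esub>, f) = theta \<psi> (\<one>\<^bsub>G\<^esub>, f')"
  then obtain z z' where z: "z \<in> carrier R" "f = \<psi> (i z)" "z' \<in> carrier R" "f' = \<psi> (i z')" unfolding slice2_graph by auto
  have th: "theta \<psi> (\<one>\<^bsub>G\<^esub>, \<psi> (i z)) = eps j z" if "z \<in> carrier R" for z
    using theta[of "i z"] eps_shift[OF that, of j k] that by (simp add: lam_i add.commute)
  let ?d = "z \<oplus>\<^bsub>R\<^esub> \<ominus>\<^bsub>R\<^esub> z'"
  have d: "?d \<in> carrier R" using z by simp
  have zd: "z = z' \<oplus>\<^bsub>R\<^esub> ?d" using z by (simp add: R.a_lcomm[of z'] R.r_neg)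
  have "eps j z = eps j z' * eps j ?d" by (subst zd) (rule eps_add)
  moreover have "eps j z = eps j z'" using th z eq by simp
  ultimately have "eps j ?d = 1" using eps_nonzero[of j z'] by simp
  then have "\<psi> (i ?d) = \<one>\<^bsub>K\<^esub>" using eps_eq_1[OF d] psi_i_zero[OF d] by simp
  then have "\<psi> (i (z' \<oplus>\<^bsub>R\<^esub> ?d)) = \<psi> (i z')" using d z psi_closed i_closed by (simp add: i_add psi_add del: R.minus_closed)
  then show "f = f'" using zd z by simp
qed

lemma graph_theta_pairs: "(graph \<psi>, theta \<psi>) \<in> pairs G K"
  using subgroup_graph fst_graph theta_char theta_inj by (auto simp: pairs_def)

lemma theta_chi: "(g, f) \<in> graph \<psi> \<Longrightarrow> theta \<psi> (g, f) ^ card (slice2 G (graph \<psi>)) = chi g"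
  using theta chi_q eps_pow expo[OF subgroup_graph] by (auto simp: graph_def)

text \<open>An element \<open>h\<close> of the kernel of \<psi> at which \<theta> is trivial has
  \<open>lam h = p^(k+j) w\<close>, so up to torsion in the kernel it is \<open>i (p^j w)\<close>,
  which \<open>q\<close> kills. Injectivity on the slice in \<open>G\<close> therefore says that the
  kernel of \<psi> has no torsion.\<close>

lemma theta_torsion:
  "inj_on (\<lambda>g. theta \<psi> (g, \<one>\<^bsub>K\<^esub>)) (slice1 K (graph \<psi>)) \<longleftrightarrow>
    (\<forall>h\<in>carrier H. \<psi> h = \<one>\<^bsub>K\<^esub> \<and> lam h = \<zero>\<^bsub>R\<^esub> \<longrightarrow> h = \<zero>\<^bsub>H\<^esub>)"
proof (intro iffI ballI impI inj_onI)
  fix h assume inj: "inj_on (\<lambda>g. theta \<psi> (g, \<one>\<^bsub>K\<^esub>)) (slice1 K (graph \<psi>))"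
    and h: "h \<in> carrier H" "\<psi> h = \<one>\<^bsub>K\<^esub> \<and> lam h = \<zero>\<^bsub>R\<^esub>"
  have q0: "q \<zero>\<^bsub>H\<^esub> = \<one>\<^bsub>G\<^esub>" using qh.hom_one by simp
  have "q h = \<one>\<^bsub>G\<^esub>"
  proof (rule inj_onD[OF inj])
    show "theta \<psi> (q h, \<one>\<^bsub>K\<^esub>) = theta \<psi> (\<one>\<^bsub>G\<^esub>, \<one>\<^bsub>K\<^esub>)"
      using theta[OF h(1)] theta[of "\<zero>\<^bsub>H\<^esub>"] h(2) by (simp add: lam_zero psi_zero q0)
    show "q h \<in> slice1 K (graph \<psi>)" using h by (force simp: slice1_def graph_def)
    show "\<one>\<^bsub>G\<^esub> \<in> slice1 K (graph \<psi>)" using q0 psi_zero by (force simp: slice1_def graph_def)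
  qed
  then show "h = \<zero>\<^bsub>H\<^esub>" using lam_q_inj[of h "\<zero>\<^bsub>H\<^esub>"] h by (simp add: lam_zero q0)
next
  fix g g' assume tf: "\<forall>h\<in>carrier H. \<psi> h = \<one>\<^bsub>K\<^esub> \<and> lam h = \<zero>\<^bsub>R\<^esub> \<longrightarrow> h = \<zero>\<^bsub>H\<^esub>"
    and "g \<in> slice1 K (graph \<psi>)" "g' \<in> slice1 K (graph \<psi>)" and eq: "theta \<psi> (g, \<one>\<^bsub>K\<^esub>) = theta \<psi> (g', \<one>\<^bsub>K\<^esub>)"
  then obtain h h' where h: "h \<in> carrier H" "q h = g" "\<psi> h = \<one>\<^bsub>K\<^esub>" and h': "h' \<in> carrier H" "q h' = g'" "\<psi> h' = \<one>\<^bsub>K\<^esub>"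
    by (auto simp: slice1_def graph_def)
  let ?d = "h \<oplus>\<^bsub>H\<^esub> \<ominus>\<^bsub>H\<^esub> h'"
  have d: "?d \<in> carrier H" using h h' by simp
  have hd: "h = h' \<oplus>\<^bsub>H\<^esub> ?d" using h h' by (simp add: H.M.a_lcomm[of h'] H.M.r_neg)
  have pd: "\<psi> ?d = \<one>\<^bsub>K\<^esub>" using h h' by (simp add: psi_add psi_minus)
  have "lam h = lam h' \<oplus>\<^bsub>R\<^esub> lam ?d" using lam_add[OF h'(1) d] hd by simp
  then have "eps (k + j) (lam h) = eps (k + j) (lam h') * eps (k + j) (lam ?d)" by (metis eps_add)
  moreover have "eps (k + j) (lam h) = eps (k + j) (lam h')" using theta[OF h(1)] theta[OF h'(1)] h h' eq by simp
  ultimately have "eps (k + j) (lam ?d) = 1" using eps_nonzero[of "k + j" "lam h'"] by simp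
  then have "lam ?d (j + k) = 0" using eps_eq_1 d by (simp add: add.commute)
  then obtain w where w: "w \<in> carrier R" "lam ?d = zint (int p ^ (j + k)) \<otimes>\<^bsub>R\<^esub> w" using Zp_divide[OF lam_closed[OF d]] by blast
  \<comment> \<open>With \<open>z = p^j w\<close> the element \<open>i z\<close> lies in the kernel
    of \<psi> and has the same \<open>lam\<close> as \<open>?d\<close>, so the difference is torsion
    in the kernel.\<close>
  define z where "z = zint (int p ^ j) \<otimes>\<^bsub>R\<^esub> w"
  have z: "z \<in> carrier R" "lam ?d = pk \<otimes>\<^bsub>R\<^esub> z"
    using w R.m_lcomm[of "zint (int p ^ j)" pk w] by (simp_all add: z_def power_add zint_mult R.m_assoc)
  have "z j = 0" by (simp add: z_def Zp_simps zint_def)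
  then have pz: "\<psi> (i z) = \<one>\<^bsub>K\<^esub>" using psi_i_zero z by simp
  have "?d \<oplus>\<^bsub>H\<^esub> \<ominus>\<^bsub>H\<^esub> i z = \<zero>\<^bsub>H\<^esub>"
  proof (rule tf[rule_format])
    show "?d \<oplus>\<^bsub>H\<^esub> \<ominus>\<^bsub>H\<^esub> i z \<in> carrier H" using d z by simp
    show "\<psi> (?d \<oplus>\<^bsub>H\<^esub> \<ominus>\<^bsub>H\<^esub> i z) = \<one>\<^bsub>K\<^esub> \<and> lam (?d \<oplus>\<^bsub>H\<^esub> \<ominus>\<^bsub>H\<^esub> i z) = \<zero>\<^bsub>R\<^esub>"
      using psi_add[OF d, of "\<ominus>\<^bsub>H\<^esub> i z"] psi_minus[of "i z"] lam_add[OF d, of "\<ominus>\<^bsub>H\<^esub> i z"] lam_minus[of "i z"] pd pz z lam_i[OF z(1)]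
      by (simp add: R.r_neg)
  qed
  then have "?d = i z" using d z H.M.r_neg1 H.M.minus_equality[of ?d "\<ominus>\<^bsub>H\<^esub> i z"] by simp
  then have "q ?d = \<one>\<^bsub>G\<^esub>" using z by simp
  then have "q h = q h'" using q_add[OF h'(1) d] h'(1) hd by simp
  then show "g = g'" using h h' by simp
qed

end

end

section \<open>Cyclic kernels and torsion\<close>

definition (in padic_module) cyc where "cyc v = {a \<odot>\<^bsub>H\<^esub> v |a. a \<in> carrier R}"

context padic_ext_target
begin

text \<open>The witness is \<open>i (p^l)\<close>, because \<open>p^l\<close> annihilates
  \<open>K\<close>.\<close>

lemma kernel_nontorsion:
  assumes \<psi>: "\<psi> \<in> hom (add_monoid H) K"
  obtains u where "u \<in> carrier H" "u \<in> kernel (add_monoid H) K \<psi>" "lam u \<noteq> \<zero>\<^bsub>R\<^esub>"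
proof
  define u where "u = i (zint (int (p ^ l)))"
  show uH: "u \<in> carrier H" by (simp add: u_def)
  have "u = zint (int (p ^ l)) \<odot>\<^bsub>H\<^esub> i \<one>\<^bsub>R\<^esub>" by (simp add: u_def i_eq_smult[symmetric])
  then have "\<psi> u = \<one>\<^bsub>K\<^esub>"
    using add_hom_pow[OF K.is_group \<psi>, of "i \<one>\<^bsub>R\<^esub>" "p ^ l"] K_pow psi_closed[OF \<psi>, of "i \<one>\<^bsub>R\<^esub>"] by simp
  then show "u \<in> kernel (add_monoid H) K \<psi>" using uH by (simp add: kernel_def)
  have "lam u = zint (int p ^ (k + l))" by (simp add: u_def lam_i power_add zint_mult)
  then show "lam u \<noteq> \<zero>\<^bsub>R\<^esub>" using p_gt_1 by (simp add: zint_eq_0)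
qed

text \<open>A torsion generator would make the whole kernel torsion.\<close>

lemma lam_kernel_generator:
  assumes "\<psi> \<in> hom (add_monoid H) K" "v \<in> carrier H" "kernel (add_monoid H) K \<psi> = cyc v"
  shows "lam v \<noteq> \<zero>\<^bsub>R\<^esub>"
proof
  assume l0: "lam v = \<zero>\<^bsub>R\<^esub>"
  obtain u where u: "u \<in> carrier H" "u \<in> kernel (add_monoid H) K \<psi>" "lam u \<noteq> \<zero>\<^bsub>R\<^esub>"
    by (rule kernel_nontorsion[OF assms(1)])
  obtain a where "a \<in> carrier R" "u = a \<odot>\<^bsub>H\<^esub> v" using u(2) unfolding assms(3) by (auto simp: cyc_def)
  then show False using u(3) assms(2) l0 by (simp add: lam_smult)
qed

text \<open>The kernel has rank one over the discrete valuation ring \<open>Z_p\<close>, so it is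
  cyclic exactly when it has no torsion. A generator is an element whose \<open>lam\<close> has
  least valuation: every other value of \<open>lam\<close> is a multiple of it, and the remainder is
  torsion.\<close>

lemma ker_cyclic_iff:
  assumes \<psi>: "\<psi> \<in> hom (add_monoid H) K"
  shows "(\<exists>v\<in>carrier H. kernel (add_monoid H) K \<psi> = cyc v) \<longleftrightarrow>
    (\<forall>h\<in>carrier H. \<psi> h = \<one>\<^bsub>K\<^esub> \<and> lam h = \<zero>\<^bsub>R\<^esub> \<longrightarrow> h = \<zero>\<^bsub>H\<^esub>)"
proof -
  note ps = psi_add[OF \<psi>] psi_closed[OF \<psi>] psi_zero[OF \<psi>] psi_minus[OF \<psi>]
  let ?N = "kernel (add_monoid H) K \<psi>"
  have N: "h \<in> ?N \<longleftrightarrow> h \<in> carrier H \<and> \<psi> h = \<one>\<^bsub>K\<^esub>" for h by (auto simp: kernel_def)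
  show ?thesis
  proof
    assume "\<exists>v\<in>carrier H. ?N = cyc v"
    then obtain v where v: "v \<in> carrier H" "?N = cyc v" by blast
    have lv: "lam v \<noteq> \<zero>\<^bsub>R\<^esub>" by (rule lam_kernel_generator[OF \<psi> v])
    show "\<forall>h\<in>carrier H. \<psi> h = \<one>\<^bsub>K\<^esub> \<and> lam h = \<zero>\<^bsub>R\<^esub> \<longrightarrow> h = \<zero>\<^bsub>H\<^esub>"
    proof (intro ballI impI)
      fix h assume h: "h \<in> carrier H" "\<psi> h = \<one>\<^bsub>K\<^esub> \<and> lam h = \<zero>\<^bsub>R\<^esub>"
      then have "h \<in> cyc v" using N v(2) by blast
      then obtain a where a: "a \<in> carrier R" "h = a \<odot>\<^bsub>H\<^esub> v" by (auto simp: cyc_def)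
      have "lam v \<otimes>\<^bsub>R\<^esub> a = \<zero>\<^bsub>R\<^esub>" using a h(2) v(1) lam_smult[of v a] by (simp add: R.m_comm)
      then have "a = \<zero>\<^bsub>R\<^esub>" using Zp_integral[of "lam v" a] lv a(1) v(1) by simp
      then show "h = \<zero>\<^bsub>H\<^esub>" using a v(1) by simp
    qed
  next
    assume tf: "\<forall>h\<in>carrier H. \<psi> h = \<one>\<^bsub>K\<^esub> \<and> lam h = \<zero>\<^bsub>R\<^esub> \<longrightarrow> h = \<zero>\<^bsub>H\<^esub>"
    \<comment> \<open>\<open>P n\<close> says that \<open>n\<close> occurs as a valuation of
      \<open>lam\<close> on the kernel.\<close>
    define P where "P n \<longleftrightarrow> (\<exists>v\<in>?N. \<exists>x\<in>carrier R. \<exists>y\<in>carrier R. lam v = zint (int p ^ n) \<otimes>\<^bsub>R\<^esub> x \<and> x \<otimes>\<^bsub>R\<^esub> y = \<one>\<^bsub>R\<^esub>)" for n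
    have ex: "\<exists>n. \<exists>x\<in>carrier R. \<exists>y\<in>carrier R. lam h = zint (int p ^ n) \<otimes>\<^bsub>R\<^esub> x \<and> x \<otimes>\<^bsub>R\<^esub> y = \<one>\<^bsub>R\<^esub>"
      if "h \<in> carrier H" "lam h \<noteq> \<zero>\<^bsub>R\<^esub>" for h
      by (rule Zp_factor[OF lam_closed[OF that(1)] that(2)]) blast
    obtain u where u: "u \<in> carrier H" "u \<in> ?N" "lam u \<noteq> \<zero>\<^bsub>R\<^esub>" by (rule kernel_nontorsion[OF \<psi>])
    have "\<exists>n. P n" using ex[OF u(1,3)] u(2) unfolding P_def by blast
    define n where "n = (LEAST n. P n)"
    have "P n" unfolding n_def using \<open>\<exists>n. P n\<close> by (rule LeastI_ex)
    then obtain v x y where v: "v \<in> ?N" "x \<in> carrier R" "y \<in> carrier R" "lam v = zint (int p ^ n) \<otimes>\<^bsub>R\<^esub> x" "x \<otimes>\<^bsub>R\<^esub> y = \<one>\<^bsub>R\<^esub>"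
      unfolding P_def by blast
    have vH: "v \<in> carrier H" "\<psi> v = \<one>\<^bsub>K\<^esub>" using v(1) N by auto
    have mv: "\<psi> (a \<odot>\<^bsub>H\<^esub> v) = \<one>\<^bsub>K\<^esub>" if "a \<in> carrier R" for a
      using psi_smult[OF \<psi> vH(1) that] vH(2) by simp
    have "\<exists>a\<in>carrier R. lam h = a \<otimes>\<^bsub>R\<^esub> lam v" if h: "h \<in> ?N" for h
    proof (cases "lam h = \<zero>\<^bsub>R\<^esub>")
      case True then show ?thesis using vH by (intro bexI[of _ "\<zero>\<^bsub>R\<^esub>"]) auto
    next
      case False
      have hH: "h \<in> carrier H" using h N by simp
      obtain m x' y' where m: "x' \<in> carrier R" "y' \<in> carrier R" "lam h = zint (int p ^ m) \<otimes>\<^bsub>R\<^esub> x'" "x' \<otimes>\<^bsub>R\<^esub> y' = \<one>\<^bsub>R\<^esub>"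
        using ex[OF hH False] by blast
      then have "P m" unfolding P_def using h by blast
      then have "n \<le> m" unfolding n_def by (rule Least_le)
      then have pm: "zint (int p ^ m) = zint (int p ^ (m - n)) \<otimes>\<^bsub>R\<^esub> zint (int p ^ n)"
        by (simp add: zint_mult[symmetric] power_add[symmetric])
      \<comment> \<open>The quotient of \<open>lam h\<close> by \<open>lam v\<close>;
        \<open>y\<close> is the inverse of the unit part of \<open>lam v\<close>.\<close>
      let ?a = "zint (int p ^ (m - n)) \<otimes>\<^bsub>R\<^esub> (x' \<otimes>\<^bsub>R\<^esub> y)"
      have "?a \<otimes>\<^bsub>R\<^esub> lam v = zint (int p ^ m) \<otimes>\<^bsub>R\<^esub> x' \<otimes>\<^bsub>R\<^esub> (x \<otimes>\<^bsub>R\<^esub> y)"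
        unfolding v(4) pm using m(1) v(2,3) by (simp add: R.m_ac)
      also have "\<dots> = lam h" using m(1) by (simp add: m(3) v(5))
      finally show ?thesis using m(1) v(3) by (intro bexI[of _ ?a]) auto
    qed
    then have "h \<in> cyc v" if h: "h \<in> ?N" for h
    proof -
      have hH: "h \<in> carrier H" "\<psi> h = \<one>\<^bsub>K\<^esub>" using h N by auto
      obtain a where a: "a \<in> carrier R" "lam h = a \<otimes>\<^bsub>R\<^esub> lam v"
        using \<open>\<And>h. h \<in> ?N \<Longrightarrow> \<exists>a\<in>carrier R. lam h = a \<otimes>\<^bsub>R\<^esub> lam v\<close>[OF h] by blast
      let ?d = "h \<oplus>\<^bsub>H\<^esub> \<ominus>\<^bsub>H\<^esub> (a \<odot>\<^bsub>H\<^esub> v)"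
      have av: "a \<odot>\<^bsub>H\<^esub> v \<in> carrier H" using a vH by simp
      have "\<psi> ?d = \<one>\<^bsub>K\<^esub>" using hH av mv[OF a(1)] ps(1)[of h "\<ominus>\<^bsub>H\<^esub> (a \<odot>\<^bsub>H\<^esub> v)"] ps(4)[OF av] by simp
      moreover have "lam ?d = \<zero>\<^bsub>R\<^esub>"
        using hH av a vH lam_add[of h "\<ominus>\<^bsub>H\<^esub> (a \<odot>\<^bsub>H\<^esub> v)"] lam_minus[OF av] lam_smult[OF vH(1) a(1)] by (simp add: R.r_neg)
      ultimately have "?d = \<zero>\<^bsub>H\<^esub>" using tf hH av by simp
      then have "h = a \<odot>\<^bsub>H\<^esub> v" using hH av H.M.minus_equality[of h "\<ominus>\<^bsub>H\<^esub> (a \<odot>\<^bsub>H\<^esub> v)"] by simp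
      then show ?thesis using a by (auto simp: cyc_def)
    qed
    moreover have "cyc v \<subseteq> ?N" using mv vH N by (auto simp: cyc_def)
    ultimately show "\<exists>v\<in>carrier H. ?N = cyc v" using vH by blast
  qed
qed

section \<open>Recovering a homomorphism from its pair\<close>

definition chi_pairs where
  "chi_pairs = {(E, \<theta>) \<in> pairs G K. \<forall>g f. (g, f) \<in> E \<longrightarrow> \<theta> (g, f) ^ card (slice2 G E) = chi g}"

text \<open>Two candidates differ by an element of the slice at which \<theta> is \<open>1\<close>.
  So \<open>g\<close> and the value of \<theta> pin down \<open>f\<close>, which is what turns a
  pair back into a function on \<open>H\<close>.\<close>

lemma pairs_unique:
  assumes E: "(E, \<theta>) \<in> pairs G K" "(g, f) \<in> E" "(g, f') \<in> E" "\<theta> (g, f) = \<theta> (g, f')"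
  shows "f = f'"
proof -
  have sub: "subgroup E (G \<times>\<times> K)" and ch: "\<theta> \<in> chars (G \<times>\<times> K) E" and inj: "inj_on (\<lambda>f. \<theta> (\<one>\<^bsub>G\<^esub>, f)) (slice2 G E)"
    using E(1) by (auto simp: pairs_def)
  note D = subgroup_DirProdD[OF G.is_group K.is_group sub]
  have g: "g \<in> carrier G" "f \<in> carrier K" "f' \<in> carrier K" using D(4,5) E by auto
  let ?t = "inv\<^bsub>K\<^esub> f' \<otimes>\<^bsub>K\<^esub> f"
  have "(inv\<^bsub>G\<^esub> g \<otimes>\<^bsub>G\<^esub> g, ?t) \<in> E" by (rule D(1)[OF D(2)[OF E(3)] E(2)])
  then have tE: "(\<one>\<^bsub>G\<^esub>, ?t) \<in> E" using g by simp
  have "\<theta> (g \<otimes>\<^bsub>G\<^esub> \<one>\<^bsub>G\<^esub>, f' \<otimes>\<^bsub>K\<^esub> ?t) = \<theta> (g, f') * \<theta> (\<one>\<^bsub>G\<^esub>, ?t)" by (rule char_DirProd_mult[OF ch E(3) tE])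
  moreover have "f' \<otimes>\<^bsub>K\<^esub> ?t = f" using g by (simp add: K.m_assoc[symmetric])
  moreover have "\<theta> (g, f') \<noteq> 0" using chars_inv(2)[OF DirProd_group[OF G.is_group K.is_group] sub ch E(3)] .
  ultimately have "\<theta> (\<one>\<^bsub>G\<^esub>, ?t) = 1" using E(4) g by simp
  also have "1 = \<theta> (\<one>\<^bsub>G\<^esub>, \<one>\<^bsub>K\<^esub>)" using charsD(2)[OF ch] by simp
  finally have "?t = \<one>\<^bsub>K\<^esub>" using inj_onD[OF inj, of ?t "\<one>\<^bsub>K\<^esub>"] tE D(3) by (simp add: slice2_def)
  then show "f = f'" using g K.inv_equality[of "inv\<^bsub>K\<^esub> f'" f] by (metis K.inv_closed K.inv_equality K.inv_inv K.m_comm)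
qed

lemma homs_chi_pairs: "\<psi> \<in> homs \<Longrightarrow> (graph \<psi>, theta \<psi>) \<in> chi_pairs"
  using graph_theta_pairs theta_chi by (auto simp: chi_pairs_def homs_def)

lemma graph_theta_inj: "inj_on (\<lambda>\<psi>. (graph \<psi>, theta \<psi>)) homs"
proof (rule inj_onI)
  fix \<psi> \<psi>' assume h: "\<psi> \<in> homs" "\<psi>' \<in> homs" "(graph \<psi>, theta \<psi>) = (graph \<psi>', theta \<psi>')"
  then have hom: "\<psi> \<in> hom (add_monoid H) K" "\<psi>' \<in> hom (add_monoid H) K" by (auto simp: homs_def)
  show "\<psi> = \<psi>'"
  proof (rule extensionalityI)
    show "\<psi> \<in> extensional (carrier H)" "\<psi>' \<in> extensional (carrier H)" using h by (auto simp: homs_def)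
    fix x assume x: "x \<in> carrier H"
    show "\<psi> x = \<psi>' x"
    proof (rule pairs_unique[OF graph_theta_pairs[OF hom(1)]])
      show "(q x, \<psi> x) \<in> graph \<psi>" "(q x, \<psi>' x) \<in> graph \<psi>" using x h(3) by (auto simp: graph_def)
      have "theta \<psi> (q x, \<psi> x) = eps (k + expo (graph \<psi>)) (lam x)" by (rule theta[OF hom(1) x])
      also have "\<dots> = theta \<psi>' (q x, \<psi>' x)" using theta[OF hom(2) x] h(3) by simp
      also have "\<dots> = theta \<psi> (q x, \<psi>' x)" using h(3) by simp
      finally show "theta \<psi> (q x, \<psi> x) = theta \<psi> (q x, \<psi>' x)" .
    qed
  qed
qed

text \<open>Start from any \<open>f0\<close> over \<open>q h\<close>. By compatibility with
  \<open>chi\<close> the actual and the wanted value of \<theta> have the same \<open>p^j\<close>-th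
  power, so the correction is a \<open>p^j\<close>-th root of unity; on the slice \<theta> takes all
  of these, being injective on \<open>p^j\<close> elements.\<close>

lemma chi_pairs_lift:
  assumes "(E, \<theta>) \<in> chi_pairs" "h \<in> carrier H"
  shows "\<exists>f. (q h, f) \<in> E \<and> \<theta> (q h, f) = eps (k + expo E) (lam h)"
proof -
  have sub: "subgroup E (G \<times>\<times> K)" and ch: "\<theta> \<in> chars (G \<times>\<times> K) E" and inj: "inj_on (\<lambda>f. \<theta> (\<one>\<^bsub>G\<^esub>, f)) (slice2 G E)"
    and fst: "fst ` E = carrier G" and pow: "\<And>g f. (g, f) \<in> E \<Longrightarrow> \<theta> (g, f) ^ card (slice2 G E) = chi g"
    using assms(1) by (auto simp: pairs_def chi_pairs_def)
  note D = subgroup_DirProdD[OF G.is_group K.is_group sub]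
  note GK = DirProd_group[OF G.is_group K.is_group]
  let ?j = "expo E"
  have c: "card (slice2 G E) = p ^ ?j" by (rule expo[OF sub])
  have "q h \<in> fst ` E" using fst assms(2) by simp
  then obtain f0 where f0: "(q h, f0) \<in> E" by auto
  have nz: "\<theta> (q h, f0) \<noteq> 0" by (rule chars_inv(2)[OF GK sub ch f0])
  define d where "d = eps (k + ?j) (lam h) / \<theta> (q h, f0)"
  have "d ^ p ^ ?j = 1"
    using pow[OF f0] chi_q[OF assms(2)] eps_pow[OF lam_closed[OF assms(2)], of k ?j] c eps_nonzero[of k "lam h"]
    by (simp add: d_def power_divide)
  moreover have "(\<lambda>f. \<theta> (\<one>\<^bsub>G\<^esub>, f)) ` slice2 G E = {z. z ^ p ^ ?j = 1}"
  proof (rule card_subset_eq)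
    show "finite {z::complex. z ^ p ^ ?j = 1}" using pow_pos(2) by (rule finite_nth_roots)
    show "(\<lambda>f. \<theta> (\<one>\<^bsub>G\<^esub>, f)) ` slice2 G E \<subseteq> {z. z ^ p ^ ?j = 1}"
      using pow[of "\<one>\<^bsub>G\<^esub>"] charsD(2)[OF chi_char] c by (auto simp: slice2_def)
    show "card ((\<lambda>f. \<theta> (\<one>\<^bsub>G\<^esub>, f)) ` slice2 G E) = card {z::complex. z ^ p ^ ?j = 1}"
      using card_image[OF inj] c card_nth_roots[of 1 "p ^ ?j"] pow_pos(2) by simp
  qed
  ultimately obtain t where t: "t \<in> slice2 G E" "\<theta> (\<one>\<^bsub>G\<^esub>, t) = d" by (metis (mono_tags, lifting) imageE mem_Collect_eq)
  then have tE: "(\<one>\<^bsub>G\<^esub>, t) \<in> E" by (simp add: slice2_def)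
  have "(q h \<otimes>\<^bsub>G\<^esub> \<one>\<^bsub>G\<^esub>, f0 \<otimes>\<^bsub>K\<^esub> t) \<in> E" by (rule D(1)[OF f0 tE])
  moreover have "\<theta> (q h \<otimes>\<^bsub>G\<^esub> \<one>\<^bsub>G\<^esub>, f0 \<otimes>\<^bsub>K\<^esub> t) = \<theta> (q h, f0) * d" using char_DirProd_mult[OF ch f0 tE] t by simp
  ultimately show ?thesis using nz assms(2) by (intro exI[of _ "f0 \<otimes>\<^bsub>K\<^esub> t"]) (simp add: d_def)
qed

lemma graph_theta_surj: "chi_pairs \<subseteq> (\<lambda>\<psi>. (graph \<psi>, theta \<psi>)) ` homs"
proof safe
  fix E \<theta> assume A: "(E, \<theta>) \<in> chi_pairs"
  then have sub: "subgroup E (G \<times>\<times> K)" and ch: "\<theta> \<in> chars (G \<times>\<times> K) E" and pairs: "(E, \<theta>) \<in> pairs G K"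
    and fst: "fst ` E = carrier G" and pow: "\<And>g f. (g, f) \<in> E \<Longrightarrow> \<theta> (g, f) ^ card (slice2 G E) = chi g"
    by (auto simp: pairs_def chi_pairs_def)
  note D = subgroup_DirProdD[OF G.is_group K.is_group sub]
  note GK = DirProd_group[OF G.is_group K.is_group]
  let ?j = "expo E"
  have c: "card (slice2 G E) = p ^ ?j" by (rule expo[OF sub])
  define \<psi> where "\<psi> = (\<lambda>h\<in>carrier H. SOME f. (q h, f) \<in> E \<and> \<theta> (q h, f) = eps (k + ?j) (lam h))"
  have \<psi>: "(q h, \<psi> h) \<in> E" "\<theta> (q h, \<psi> h) = eps (k + ?j) (lam h)" if "h \<in> carrier H" for h
    using someI_ex[OF chi_pairs_lift[OF A that]] that by (auto simp: \<psi>_def)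
  have uniq: "\<psi> h = f" if "h \<in> carrier H" "(q h, f) \<in> E" "\<theta> (q h, f) = eps (k + ?j) (lam h)" for h f
    using pairs_unique[OF pairs \<psi>(1)[OF that(1)] that(2)] \<psi>(2)[OF that(1)] that(3) by simp
  have hom: "\<psi> \<in> hom (add_monoid H) K"
  proof (rule homI)
    show "\<psi> x \<in> carrier K" if "x \<in> carrier (add_monoid H)" for x using D(5)[OF \<psi>(1)] that by simp
    fix x y assume "x \<in> carrier (add_monoid H)" "y \<in> carrier (add_monoid H)"
    then have xy: "x \<in> carrier H" "y \<in> carrier H" by simp_all
    have "\<psi> (x \<oplus>\<^bsub>H\<^esub> y) = \<psi> x \<otimes>\<^bsub>K\<^esub> \<psi> y"
    proof (rule uniq)
      show "(q (x \<oplus>\<^bsub>H\<^esub> y), \<psi> x \<otimes>\<^bsub>K\<^esub> \<psi> y) \<in> E"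
        unfolding q_add[OF xy] by (rule D(1)[OF \<psi>(1)[OF xy(1)] \<psi>(1)[OF xy(2)]])
      show "\<theta> (q (x \<oplus>\<^bsub>H\<^esub> y), \<psi> x \<otimes>\<^bsub>K\<^esub> \<psi> y) = eps (k + ?j) (lam (x \<oplus>\<^bsub>H\<^esub> y))"
        unfolding q_add[OF xy] char_DirProd_mult[OF ch \<psi>(1)[OF xy(1)] \<psi>(1)[OF xy(2)]] \<psi>(2)[OF xy(1)] \<psi>(2)[OF xy(2)]
          lam_add[OF xy] eps_add ..
    qed (use xy in simp)
    then show "\<psi> (x \<otimes>\<^bsub>add_monoid H\<^esub> y) = \<psi> x \<otimes>\<^bsub>K\<^esub> \<psi> y" by simp
  qed
  then have \<psi>h: "\<psi> \<in> homs" by (auto simp: homs_def \<psi>_def)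
  have "graph \<psi> \<subseteq> E" using \<psi>(1) by (auto simp: graph_def)
  \<comment> \<open>The value \<open>\<theta> (g, f)\<close> is a root of unity of order dividing
    \<open>p^(k+j)\<close>, so it comes from an integer \<open>n\<close>, and the element of
    \<open>H\<close> over \<open>g\<close> with \<open>lam\<close> equal to \<open>n\<close> is sent
    to \<open>f\<close>.\<close>
  moreover have "E \<subseteq> graph \<psi>"
  proof safe
    fix g f assume gf: "(g, f) \<in> E"
    have g: "g \<in> carrier G" using D(4) gf by blast
    have "\<theta> (g, f) ^ p ^ (k + ?j) = (\<theta> (g, f) ^ p ^ ?j) ^ p ^ k" by (simp add: power_add power_mult[symmetric] mult.commute)
    also have "\<dots> = chi g ^ p ^ k" using pow[OF gf] c by simp
    also have "\<dots> = chi (g [^]\<^bsub>G\<^esub> (p ^ k))" using chars_pow[OF G.is_group G.subgroup_self chi_char g] by simp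
    also have "\<dots> = 1" using G_pow[OF g] charsD(2)[OF chi_char] by simp
    finally obtain n where n: "\<theta> (g, f) = eps (k + ?j) (zint n)" using eps_root_ex by blast
    then have "eps k (zint n) = chi g" using eps_pow[OF zint_closed, of k ?j n] pow[OF gf] c by simp
    then obtain h where h: "h \<in> carrier H" "lam h = zint n" "q h = g" using lam_q_surj[OF zint_closed g] by metis
    then have "\<psi> h = f" using uniq[of h f] gf n by simp
    then show "(g, f) \<in> graph \<psi>" using h by (auto simp: graph_def)
  qed
  ultimately have gE: "graph \<psi> = E" by blast
  have "theta \<psi> = \<theta>"
  proof (rule chars_eqI[OF theta_char[OF hom]])
    show "\<theta> \<in> chars (G \<times>\<times> K) (graph \<psi>)" using ch gE by simp
    fix x assume "x \<in> graph \<psi>"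
    then obtain h where h: "h \<in> carrier H" "x = (q h, \<psi> h)" by (auto simp: graph_def)
    then show "theta \<psi> x = \<theta> x" using theta[OF hom h(1)] \<psi>(2)[OF h(1)] gE by simp
  qed
  then show "(E, \<theta>) \<in> (\<lambda>\<psi>. (graph \<psi>, theta \<psi>)) ` homs" using gE \<psi>h by blast
qed

lemma bij_homs: "bij_betw (\<lambda>\<psi>. (graph \<psi>, theta \<psi>)) homs chi_pairs"
  unfolding bij_betw_def using graph_theta_inj graph_theta_surj homs_chi_pairs by blast

lemma finite_homs: "finite homs"
proof -
  have "finite chi_pairs" using finite_pairs[OF G.comm_group_axioms K.comm_group_axioms finG finK] by (rule rev_finite_subset) (auto simp: chi_pairs_def)
  then show ?thesis using bij_betw_finite[OF bij_homs] by simp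
qed

lemma card_surj_homs:
  "card {\<psi> \<in> homs. \<psi> ` carrier H = carrier K} = card {e \<in> chi_pairs. snd ` fst e = carrier K}"
proof (rule bij_betw_same_card[OF bij_betw_Collect[OF bij_homs]])
  show "snd ` fst (graph \<psi>, theta \<psi>) = carrier K \<longleftrightarrow> \<psi> ` carrier H = carrier K" for \<psi>
    by (simp add: graph_def image_image)
qed

lemma card_surj_cyclic_homs:
  "card {\<psi> \<in> homs. \<psi> ` carrier H = carrier K \<and> (\<exists>v\<in>carrier H. kernel (add_monoid H) K \<psi> = cyc v)} =
   card {e \<in> chi_pairs. snd ` fst e = carrier K \<and> inj_on (\<lambda>g. snd e (g, \<one>\<^bsub>K\<^esub>)) (slice1 K (fst e))}"
proof (rule bij_betw_same_card[OF bij_betw_Collect[OF bij_homs]])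
  fix \<psi> assume "\<psi> \<in> homs"
  then have "\<psi> \<in> hom (add_monoid H) K" by (simp add: homs_def)
  from ker_cyclic_iff[OF this] theta_torsion[OF this]
  show "snd ` fst (graph \<psi>, theta \<psi>) = carrier K \<and>
     inj_on (\<lambda>g. snd (graph \<psi>, theta \<psi>) (g, \<one>\<^bsub>K\<^esub>)) (slice1 K (fst (graph \<psi>, theta \<psi>))) \<longleftrightarrow>
     \<psi> ` carrier H = carrier K \<and> (\<exists>v\<in>carrier H. kernel (add_monoid H) K \<psi> = cyc v)"
    by (simp add: graph_def image_image)
qed

end

section \<open>Haar measure on an extension\<close>

context padic_ext
begin

text \<open>A cell is a coset of \<open>i (p\<^sup>n \<int>\<^sub>p)\<close> (or empty).\<close>

definition cell :: "nat \<Rightarrow> 'g \<Rightarrow> int \<Rightarrow> 'h set" where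
  "cell n g a = {x \<in> carrier H. q x = g \<and> lam x (n + k) = a}"

definition cells :: "'h set set" where
  "cells = (\<lambda>(n, g, a). cell n g a) ` (UNIV \<times> carrier G \<times> UNIV)"

lemma cell_subset: "cell n g a \<subseteq> carrier H" by (auto simp: cell_def)

lemma cell_refl: "x \<in> carrier H \<Longrightarrow> x \<in> cell n (q x) (lam x (n + k))" by (simp add: cell_def)

lemma cellI: "g \<in> carrier G \<Longrightarrow> cell n g a \<in> cells" by (force simp: cells_def)

lemma cells_subset: "cells \<subseteq> Pow (carrier H)" by (auto simp: cells_def cell_def)

lemma countable_cells: "countable cells"
  unfolding cells_def using finG by (intro countable_image countable_SIGMA) (auto intro: countable_finite)

lemma shift_coord: "z \<in> carrier R \<Longrightarrow> (pk \<otimes>\<^bsub>R\<^esub> z) (n + k) = int p ^ k * z n"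
proof -
  assume z: "z \<in> carrier R"
  have "(pk \<otimes>\<^bsub>R\<^esub> z) (n + k) = (int p ^ k * z (n + k)) mod (int p ^ k * int p ^ n)"
    by (simp add: Zp_simps zint_def mod_simps power_add mult.commute)
  also have "\<dots> = int p ^ k * (z (n + k) mod int p ^ n)" by (rule mult_mod_right[symmetric])
  finally show ?thesis using Zp_mod[OF z, of n "n + k"] by simp
qed

text \<open>Adding \<open>i z\<close> moves \<open>lam\<close> by \<open>p^k z\<close>, so the
  coordinate of \<open>lam\<close> at \<open>n + k\<close> sees exactly \<open>z\<close> modulo
  \<open>p^n\<close>. This is the reason for the offset \<open>k\<close> in
  \<open>cell\<close>.\<close>

lemma lam_shift_coord:
  assumes "x \<in> carrier H" "z \<in> carrier R" "w \<in> carrier R"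
  shows "lam (x \<oplus>\<^bsub>H\<^esub> i z) (n + k) = lam (x \<oplus>\<^bsub>H\<^esub> i w) (n + k) \<longleftrightarrow> z n = w n"
proof -
  have e: "lam (x \<oplus>\<^bsub>H\<^esub> i z) (n + k) = (lam x (n + k) + int p ^ k * z n) mod (int p ^ k * int p ^ n)" if "z \<in> carrier R" for z
    unfolding lam_add[OF assms(1) i_closed[OF that]] lam_i[OF that] shift_coord[OF that, symmetric]
    by (simp add: Zp_simps power_add mult.commute)
  have "[lam x (n + k) + int p ^ k * z n = lam x (n + k) + int p ^ k * w n] (mod (int p ^ k * int p ^ n)) \<longleftrightarrow>
     [int p ^ k * z n = int p ^ k * w n] (mod (int p ^ k * int p ^ n))" by (rule cong_add_lcancel)
  also have "\<dots> \<longleftrightarrow> int p ^ k * (z n mod int p ^ n) = int p ^ k * (w n mod int p ^ n)"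
    unfolding cong_def mult_mod_right by (rule refl)
  also have "\<dots> \<longleftrightarrow> z n = w n" using ZpD(4)[OF assms(2), of n] ZpD(4)[OF assms(3), of n] p_gt_1 by simp
  finally show ?thesis unfolding e[OF assms(2)] e[OF assms(3)] cong_def .
qed

lemma mem_cell_iff:
  assumes "x \<in> carrier H"
  shows "y \<in> cell n (q x) (lam x (n + k)) \<longleftrightarrow> (\<exists>z\<in>carrier R. z n = 0 \<and> y = x \<oplus>\<^bsub>H\<^esub> i z)"
proof
  assume y: "y \<in> cell n (q x) (lam x (n + k))"
  then have yH: "y \<in> carrier H" "q y = q x" by (auto simp: cell_def)
  obtain z where z: "z \<in> carrier R" "y = x \<oplus>\<^bsub>H\<^esub> i z" using q_eqE[OF yH(1) assms yH(2)] .
  then have "z n = \<zero>\<^bsub>R\<^esub> n" using lam_shift_coord[OF assms z(1) R.zero_closed, of n] y assms by (simp add: i_zero cell_def)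
  then show "\<exists>z\<in>carrier R. z n = 0 \<and> y = x \<oplus>\<^bsub>H\<^esub> i z" using z by (auto simp: Zp_simps)
next
  assume "\<exists>z\<in>carrier R. z n = 0 \<and> y = x \<oplus>\<^bsub>H\<^esub> i z"
  then obtain z where z: "z \<in> carrier R" "z n = 0" "y = x \<oplus>\<^bsub>H\<^esub> i z" by blast
  have "z n = \<zero>\<^bsub>R\<^esub> n" using z(2) by (simp add: Zp_simps)
  then have "lam (x \<oplus>\<^bsub>H\<^esub> i z) (n + k) = lam (x \<oplus>\<^bsub>H\<^esub> i \<zero>\<^bsub>R\<^esub>) (n + k)"
    using lam_shift_coord[OF assms z(1) R.zero_closed] by blast
  then show "y \<in> cell n (q x) (lam x (n + k))"
    using z assms by (simp add: i_zero cell_def q_add)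
qed

lemma mem_cellE:
  assumes "y \<in> cell n (q x) (lam x (n + k))" "x \<in> carrier H"
  obtains z where "z \<in> carrier R" "z n = 0" "y = x \<oplus>\<^bsub>H\<^esub> i z"
  using iffD1[OF mem_cell_iff[OF assms(2)] assms(1)] by auto

lemma mem_cellI:
  assumes "x \<in> carrier H" "z \<in> carrier R" "z n = 0"
  shows "x \<oplus>\<^bsub>H\<^esub> i z \<in> cell n (q x) (lam x (n + k))"
  by (rule iffD2[OF mem_cell_iff[OF assms(1)]]) (use assms in auto)

lemma cell_nested:
  assumes "n \<le> m"
  shows "cell m g b \<subseteq> cell n g (b mod int p ^ (n + k))"
  using Zp_mod[OF lam_closed, of _ "n + k" "m + k"] assms by (auto simp: cell_def)

text \<open>Any two cells are nested or disjoint. The coordinate \<open>-1\<close> never occurs, so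
  \<open>cell n g (-1)\<close> names the empty set as a cell, and the cells become stable under
  intersection.\<close>

lemma cell_Int:
  assumes "n \<le> m"
  shows "cell n g a \<inter> cell m g' b = (if g = g' \<and> a = b mod int p ^ (n + k) then cell m g' b else cell n g (-1))"
proof -
  have e: "cell n g (-1) = {}"
  proof -
    have False if "x \<in> cell n g (-1)" for x
      using that ZpD(1)[OF lam_closed, of x "n + k"] by (simp add: cell_def)
    then show ?thesis by blast
  qed
  show ?thesis using cell_nested[OF assms, of g' b] unfolding e by (auto simp: cell_def)
qed

lemma Int_stable_cells: "Int_stable cells"
proof (rule Int_stableI)
  fix A B assume "A \<in> cells" "B \<in> cells"
  then obtain n g a m g' b where AB: "A = cell n g a" "g \<in> carrier G" "B = cell m g' b" "g' \<in> carrier G" by (auto simp: cells_def)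
  show "A \<inter> B \<in> cells"
  proof (cases "n \<le> m")
    case True then show ?thesis unfolding AB cell_Int[OF True] using AB cellI by auto
  next
    case False
    then have "m \<le> n" by simp
    then show ?thesis unfolding AB Int_commute[of "cell n g a"] cell_Int[OF \<open>m \<le> n\<close>] using AB cellI by auto
  qed
qed

lemma mem_coset_iff: "x \<in> (add_pow H (p ^ n) ` carrier H) +>\<^bsub>H\<^esub> a \<longleftrightarrow> (\<exists>y\<in>carrier H. x = zint (int p ^ n) \<odot>\<^bsub>H\<^esub> y \<oplus>\<^bsub>H\<^esub> a)"
  using zint_smult[of _ "p ^ n"] by (auto simp: a_r_coset_def r_coset_def)

text \<open>One half of the comparison between the defining basis and the cells: a cell of level
  \<open>n\<close> is a coset of \<open>i (p^n Z_p)\<close>, which lies in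
  \<open>p^n H\<close>.\<close>

lemma topology_basis:
  assumes "C \<in> a_rcosets\<^bsub>H\<^esub> (add_pow H (p ^ n) ` carrier H)" "x \<in> C"
  shows "x \<in> carrier H \<and> cell n (q x) (lam x (n + k)) \<subseteq> C"
proof -
  obtain a where a: "a \<in> carrier H" "C = (add_pow H (p ^ n) ` carrier H) +>\<^bsub>H\<^esub> a"
    using assms(1) by (auto simp: A_RCOSETS_def RCOSETS_def a_r_coset_def)
  obtain y where y: "y \<in> carrier H" "x = zint (int p ^ n) \<odot>\<^bsub>H\<^esub> y \<oplus>\<^bsub>H\<^esub> a" using assms(2) mem_coset_iff a(2) by metis
  have x: "x \<in> carrier H" using y a by simp
  have "x' \<in> C" if x': "x' \<in> cell n (q x) (lam x (n + k))" for x'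
  proof -
    obtain z where z: "z \<in> carrier R" "z n = 0" "x' = x \<oplus>\<^bsub>H\<^esub> i z" using mem_cellE[OF x' x] .
    obtain w where w: "w \<in> carrier R" "z = zint (int p ^ n) \<otimes>\<^bsub>R\<^esub> w" using Zp_divide[OF z(1,2)] by blast
    have "x' = zint (int p ^ n) \<odot>\<^bsub>H\<^esub> (y \<oplus>\<^bsub>H\<^esub> i w) \<oplus>\<^bsub>H\<^esub> a"
    proof -
      have iz: "i z = zint (int p ^ n) \<odot>\<^bsub>H\<^esub> i w" using w by (simp add: i_mult)
      have "x' = (zint (int p ^ n) \<odot>\<^bsub>H\<^esub> y \<oplus>\<^bsub>H\<^esub> a) \<oplus>\<^bsub>H\<^esub> zint (int p ^ n) \<odot>\<^bsub>H\<^esub> i w"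
        unfolding z(3) y(2) iz ..
      also have "\<dots> = (zint (int p ^ n) \<odot>\<^bsub>H\<^esub> y \<oplus>\<^bsub>H\<^esub> zint (int p ^ n) \<odot>\<^bsub>H\<^esub> i w) \<oplus>\<^bsub>H\<^esub> a"
        using y(1) w(1) a(1) by (simp add: H.M.a_ac)
      finally show ?thesis using y(1) w(1) by (simp add: H.smult_r_distr)
    qed
    then show ?thesis using y(1) w(1) a(2) mem_coset_iff by blast
  qed
  then show ?thesis using x by blast
qed

text \<open>The other half loses \<open>k\<close> levels, because it is \<open>p^k H\<close> that
  lies in the image of \<open>i\<close>.\<close>

lemma coset_in_cell:
  assumes "x \<in> carrier H"
  shows "x \<in> (add_pow H (p ^ (n + k)) ` carrier H) +>\<^bsub>H\<^esub> x"
    "(add_pow H (p ^ (n + k)) ` carrier H) +>\<^bsub>H\<^esub> x \<subseteq> cell n (q x) (lam x (n + k))"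
proof -
  show "x \<in> (add_pow H (p ^ (n + k)) ` carrier H) +>\<^bsub>H\<^esub> x"
    unfolding mem_coset_iff using assms by (intro bexI[of _ "\<zero>\<^bsub>H\<^esub>"]) auto
  show "(add_pow H (p ^ (n + k)) ` carrier H) +>\<^bsub>H\<^esub> x \<subseteq> cell n (q x) (lam x (n + k))"
  proof
    fix x' assume "x' \<in> (add_pow H (p ^ (n + k)) ` carrier H) +>\<^bsub>H\<^esub> x"
    then obtain y where y: "y \<in> carrier H" "x' = zint (int p ^ (n + k)) \<odot>\<^bsub>H\<^esub> y \<oplus>\<^bsub>H\<^esub> x" unfolding mem_coset_iff by blast
    have "zint (int p ^ (n + k)) \<odot>\<^bsub>H\<^esub> y = zint (int p ^ n) \<odot>\<^bsub>H\<^esub> i (lam y)"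
      using y(1) by (simp add: i_lam power_add zint_mult H.smult_assoc1)
    also have "\<dots> = i (zint (int p ^ n) \<otimes>\<^bsub>R\<^esub> lam y)" using y(1) by (simp add: i_mult)
    finally have "x' = x \<oplus>\<^bsub>H\<^esub> i (zint (int p ^ n) \<otimes>\<^bsub>R\<^esub> lam y)" using y assms by (simp add: H.M.a_comm)
    moreover have "(zint (int p ^ n) \<otimes>\<^bsub>R\<^esub> lam y) n = 0" by (simp add: Zp_simps zint_def)
    ultimately show "x' \<in> cell n (q x) (lam x (n + k))" unfolding mem_cell_iff[OF assms] using y(1) by blast
  qed
qed

lemma openin_iff: "openin (padic_topology p H) U \<longleftrightarrow> U \<subseteq> carrier H \<and> (\<forall>x\<in>U. \<exists>n. cell n (q x) (lam x (n + k)) \<subseteq> U)"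
proof
  assume "openin (padic_topology p H) U"
  then have "generate_topology_on (\<Union>n. a_rcosets\<^bsub>H\<^esub> (add_pow H (p ^ n) ` carrier H)) U"
    by (simp add: padic_topology_def openin_topology_generated_by_iff)
  then have "\<forall>x\<in>U. x \<in> carrier H \<and> (\<exists>n. cell n (q x) (lam x (n + k)) \<subseteq> U)"
  proof induction
    case (Int a b)
    show ?case
    proof
      fix x assume x: "x \<in> a \<inter> b"
      then obtain n m where nm: "cell n (q x) (lam x (n + k)) \<subseteq> a" "cell m (q x) (lam x (m + k)) \<subseteq> b" "x \<in> carrier H" using Int by blast
      have "cell (max n m) (q x) (lam x (max n m + k)) \<subseteq> cell n (q x) (lam x (n + k))"
        "cell (max n m) (q x) (lam x (max n m + k)) \<subseteq> cell m (q x) (lam x (m + k))"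
        using cell_nested[of n "max n m" "q x" "lam x (max n m + k)"] cell_nested[of m "max n m" "q x" "lam x (max n m + k)"]
          Zp_mod[OF lam_closed[OF nm(3)], of "n + k" "max n m + k"] Zp_mod[OF lam_closed[OF nm(3)], of "m + k" "max n m + k"] by auto
      then show "x \<in> carrier H \<and> (\<exists>n. cell n (q x) (lam x (n + k)) \<subseteq> a \<inter> b)" using nm by blast
    qed
  next
    case (Basis s)
    then show ?case using topology_basis by blast
  qed blast+
  then show "U \<subseteq> carrier H \<and> (\<forall>x\<in>U. \<exists>n. cell n (q x) (lam x (n + k)) \<subseteq> U)" by blast
next
  assume U: "U \<subseteq> carrier H \<and> (\<forall>x\<in>U. \<exists>n. cell n (q x) (lam x (n + k)) \<subseteq> U)"
  let ?T = "\<Union>n. a_rcosets\<^bsub>H\<^esub> (add_pow H (p ^ n) ` carrier H)"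
  have "\<exists>C\<in>?T. x \<in> C \<and> C \<subseteq> U" if x: "x \<in> U" for x
  proof -
    obtain n where n: "cell n (q x) (lam x (n + k)) \<subseteq> U" using U x by blast
    have xH: "x \<in> carrier H" using U x by blast
    have "(add_pow H (p ^ (n + k)) ` carrier H) +>\<^bsub>H\<^esub> x \<in> ?T"
      using xH by (auto simp: A_RCOSETS_def RCOSETS_def a_r_coset_def)
    then show ?thesis using coset_in_cell[OF xH, of n] n by blast
  qed
  then have "U = \<Union>{C \<in> ?T. C \<subseteq> U}" by blast
  moreover have "openin (padic_topology p H) (\<Union>{C \<in> ?T. C \<subseteq> U})"
    by (rule openin_Union) (auto simp: padic_topology_def topology_generated_by_Basis)
  ultimately show "openin (padic_topology p H) U" by metis
qed

lemma openin_cell: "openin (padic_topology p H) (cell n g a)"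
  unfolding openin_iff by (auto simp: cell_def)

abbreviation Borel where "Borel \<equiv> sigma_sets (carrier H) {U. openin (padic_topology p H) U}"

text \<open>The cells form a countable basis, so every open set is a countable union of
  them.\<close>

lemma Borel_eq: "Borel = sigma_sets (carrier H) cells"
proof
  show "sigma_sets (carrier H) cells \<subseteq> Borel"
    by (rule sigma_sets_mono') (auto simp: cells_def openin_cell)
  have "U \<in> sigma_sets (carrier H) cells" if U: "openin (padic_topology p H) U" for U
  proof -
    have "U = \<Union>{C \<in> cells. C \<subseteq> U}"
    proof
      show "U \<subseteq> \<Union>{C \<in> cells. C \<subseteq> U}"
      proof
        fix x assume "x \<in> U"
        then obtain n where "cell n (q x) (lam x (n + k)) \<subseteq> U" "x \<in> carrier H" using U unfolding openin_iff by blast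
        then show "x \<in> \<Union>{C \<in> cells. C \<subseteq> U}" using cell_refl cellI[OF q_closed] by blast
      qed
    qed blast
    moreover have "\<Union>{C \<in> cells. C \<subseteq> U} \<in> sigma_sets (carrier H) cells"
      by (rule sigma_sets_UNION) (use countable_cells in \<open>auto intro: sigma_sets.Basic countable_subset\<close>)
    ultimately show ?thesis by simp
  qed
  then show "Borel \<subseteq> sigma_sets (carrier H) cells"
    by (intro sigma_sets_mono) auto
qed

section \<open>Translations and uniqueness of Haar measure\<close>

definition translate where "translate h A = (\<lambda>x. h \<oplus>\<^bsub>H\<^esub> x) ` A"

lemma l_coset_eq: "h <+\<^bsub>H\<^esub> A = translate h A"
  by (auto simp: translate_def a_l_coset_def l_coset_def)

lemma translate_eq:
  assumes "h \<in> carrier H" "A \<subseteq> carrier H"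
  shows "translate h A = {x \<in> carrier H. \<ominus>\<^bsub>H\<^esub> h \<oplus>\<^bsub>H\<^esub> x \<in> A}"
proof -
  have "x \<in> translate h A" if "x \<in> carrier H" "\<ominus>\<^bsub>H\<^esub> h \<oplus>\<^bsub>H\<^esub> x \<in> A" for x
    unfolding translate_def by (rule image_eqI[OF _ that(2)]) (use that assms in \<open>simp add: H.M.r_neg2\<close>)
  moreover have "x \<in> carrier H \<and> \<ominus>\<^bsub>H\<^esub> h \<oplus>\<^bsub>H\<^esub> x \<in> A" if "x \<in> translate h A" for x
    using that assms by (auto simp: translate_def H.M.r_neg1 subset_iff)
  ultimately show ?thesis by blast
qed

lemma translate_cell:
  assumes "h \<in> carrier H" "x \<in> carrier H"
  shows "translate h (cell n (q x) (lam x (n + k))) = cell n (q (h \<oplus>\<^bsub>H\<^esub> x)) (lam (h \<oplus>\<^bsub>H\<^esub> x) (n + k))"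
proof (intro equalityI subsetI)
  fix y assume "y \<in> translate h (cell n (q x) (lam x (n + k)))"
  then obtain u where u: "u \<in> cell n (q x) (lam x (n + k))" "y = h \<oplus>\<^bsub>H\<^esub> u" by (auto simp: translate_def)
  obtain z where z: "z \<in> carrier R" "z n = 0" "u = x \<oplus>\<^bsub>H\<^esub> i z" using mem_cellE[OF u(1) assms(2)] .
  have "y = (h \<oplus>\<^bsub>H\<^esub> x) \<oplus>\<^bsub>H\<^esub> i z" using assms z u(2) by (simp add: H.M.a_assoc)
  then show "y \<in> cell n (q (h \<oplus>\<^bsub>H\<^esub> x)) (lam (h \<oplus>\<^bsub>H\<^esub> x) (n + k))"
    using mem_cellI[OF H.M.a_closed[OF assms] z(1,2)] by simp
next
  fix y assume y: "y \<in> cell n (q (h \<oplus>\<^bsub>H\<^esub> x)) (lam (h \<oplus>\<^bsub>H\<^esub> x) (n + k))"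
  obtain z where z: "z \<in> carrier R" "z n = 0" "y = (h \<oplus>\<^bsub>H\<^esub> x) \<oplus>\<^bsub>H\<^esub> i z"
    using mem_cellE[OF y H.M.a_closed[OF assms]] .
  have "y = h \<oplus>\<^bsub>H\<^esub> (x \<oplus>\<^bsub>H\<^esub> i z)" using assms z by (simp add: H.M.a_assoc)
  then show "y \<in> translate h (cell n (q x) (lam x (n + k)))"
    unfolding translate_def using mem_cellI[OF assms(2) z(1,2)] by (rule image_eqI)
qed

lemma translate_Borel:
  assumes "h \<in> carrier H" "A \<in> Borel"
  shows "translate h A \<in> Borel"
  using assms(2)
proof induction
  case (Basic U)
  have U: "U \<subseteq> carrier H" using Basic openin_iff by blast
  have "openin (padic_topology p H) (translate h U)" unfolding openin_iff
  proof (intro conjI ballI)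
    show "translate h U \<subseteq> carrier H" using U assms(1) by (auto simp: translate_def)
    fix y assume "y \<in> translate h U"
    then obtain x where x: "x \<in> U" "y = h \<oplus>\<^bsub>H\<^esub> x" by (auto simp: translate_def)
    then obtain n where "cell n (q x) (lam x (n + k)) \<subseteq> U" using Basic openin_iff by blast
    then have "translate h (cell n (q x) (lam x (n + k))) \<subseteq> translate h U" by (auto simp: translate_def)
    then show "\<exists>n. cell n (q y) (lam y (n + k)) \<subseteq> translate h U" using translate_cell[OF assms(1)] x U by blast
  qed
  then show ?case by (simp add: sigma_sets.Basic)
next
  case Empty then show ?case by (simp add: translate_def sigma_sets.Empty)
next
  case (Compl A)
  have AH: "A \<subseteq> carrier H" using Compl(1) sigma_sets_into_sp[of "{U. openin (padic_topology p H) U}" "carrier H"] openin_iff by blast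
  have "translate h (carrier H - A) = carrier H - translate h A"
    using AH assms(1) translate_eq[OF assms(1) AH] translate_eq[OF assms(1), of "carrier H - A"] by auto
  then show ?case using Compl(2) by (simp add: sigma_sets.Compl)
next
  case (Union A)
  have "translate h (\<Union>n. A n) = (\<Union>n. translate h (A n))" by (auto simp: translate_def)
  then show ?case using Union(2) by (simp add: sigma_sets.Union)
qed

lemma coords_finite: "finite ((\<lambda>x. cell n (q x) (lam x (n + k))) ` carrier H)"
proof (rule finite_subset)
  show "(\<lambda>x. cell n (q x) (lam x (n + k))) ` carrier H \<subseteq> (\<lambda>(g, a). cell n g a) ` (carrier G \<times> {0..<int p ^ (n + k)})"
    using ZpD(1,2)[OF lam_closed] by force
qed (use finG in simp)

text \<open>The cells of one level are finite in number, disjoint, cover \<open>H\<close> and are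
  translates of each other, so an invariant probability measure gives them equal mass.\<close>

lemma cells_partition:
  assumes "is_haar p H M" "x \<in> carrier H"
  shows "emeasure M (cell n (q x) (lam x (n + k))) = 1 / of_nat (card ((\<lambda>x. cell n (q x) (lam x (n + k))) ` carrier H))"
proof -
  let ?C = "(\<lambda>x. cell n (q x) (lam x (n + k))) ` carrier H"
  have sets: "sets M = Borel" and inv: "\<And>A h. A \<in> sets M \<Longrightarrow> h \<in> carrier H \<Longrightarrow> emeasure M (translate h A) = emeasure M A"
    and one: "emeasure M (carrier H) = 1" using assms(1) by (auto simp: is_haar_def l_coset_eq)
  have meas: "cell n g a \<in> sets M" for g a unfolding sets by (rule sigma_sets.Basic) (simp add: openin_cell)
  have eq: "emeasure M (cell n (q y) (lam y (n + k))) = emeasure M (cell n (q x) (lam x (n + k)))" if y: "y \<in> carrier H" for y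
  proof -
    have "(y \<oplus>\<^bsub>H\<^esub> \<ominus>\<^bsub>H\<^esub> x) \<oplus>\<^bsub>H\<^esub> x = y" using y assms(2) by (simp add: H.M.a_assoc H.M.l_neg)
    then have "cell n (q y) (lam y (n + k)) = translate (y \<oplus>\<^bsub>H\<^esub> \<ominus>\<^bsub>H\<^esub> x) (cell n (q x) (lam x (n + k)))"
      using translate_cell[of "y \<oplus>\<^bsub>H\<^esub> \<ominus>\<^bsub>H\<^esub> x" x n] y assms(2) by simp
    then show ?thesis using inv[OF meas] y assms(2) by simp
  qed
  have "1 = emeasure M (\<Union>C\<in>?C. C)"
  proof -
    have "(\<Union>C\<in>?C. C) = carrier H" using cell_refl cell_subset by blast
    then show ?thesis using one by simp
  qed
  also have "\<dots> = (\<Sum>C\<in>?C. emeasure M C)"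
  proof (rule sum_emeasure[symmetric])
    show "disjoint_family_on (\<lambda>C. C) ?C" by (auto simp: disjoint_family_on_def cell_def)
  qed (use meas coords_finite in auto)
  also have "\<dots> = of_nat (card ?C) * emeasure M (cell n (q x) (lam x (n + k)))"
    using eq by (subst sum.cong[OF refl, of _ _ "\<lambda>_. emeasure M (cell n (q x) (lam x (n + k)))"]) auto
  finally have "1 = emeasure M (cell n (q x) (lam x (n + k))) * of_nat (card ?C)" by (simp add: mult.commute)
  moreover have "card ?C \<noteq> 0" using coords_finite assms(2) by auto
  ultimately show ?thesis by (metis ennreal_mult_divide_eq ennreal_of_nat_eq_real_of_nat ennreal_neq_top of_nat_eq_0_iff)
qed

lemma cell_cases:
  obtains "cell n g a = {}" | x where "x \<in> carrier H" "cell n g a = cell n (q x) (lam x (n + k))"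
  by (cases "cell n g a = {}") (auto simp: cell_def)

text \<open>The cells generate the sigma-algebra and are stable under intersection, and
  \<open>cells_partition\<close> fixes the measure of each.\<close>

lemma haar_unique:
  assumes "is_haar p H M" "is_haar p H N"
  shows "M = N"
proof (rule measure_eqI_generator_eq_countable[OF Int_stable_cells cells_subset])
  show "emeasure M X = emeasure N X" if X: "X \<in> cells" for X
  proof -
    obtain n g a where X: "X = cell n g a" using X by (auto simp: cells_def)
    show ?thesis unfolding X
      by (rule cell_cases[of n g a]) (auto simp: cells_partition[OF assms(1)] cells_partition[OF assms(2)])
  qed
  show "sets M = sigma_sets (carrier H) cells" "sets N = sigma_sets (carrier H) cells"
    using assms Borel_eq by (auto simp: is_haar_def)
  let ?C = "(\<lambda>x. cell 0 (q x) (lam x (0 + k))) ` carrier H"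
  show "?C \<subseteq> cells" using cellI q_closed by blast
  show "\<Union>?C = carrier H" using cell_refl[of _ 0] cell_subset by blast
  show "countable ?C" using coords_finite by (rule countable_finite)
  show "emeasure M A \<noteq> \<infinity>" for A
  proof -
    have "emeasure M A \<le> emeasure M (space M)" by (rule emeasure_space)
    then show ?thesis using assms(1) by (auto simp: is_haar_def top_unique)
  qed
qed

end

section \<open>Digit expansions of p-adic integers\<close>

context padic_prime
begin

text \<open>Reduction of \<open>d j\<close> modulo \<open>p\<close> makes every sequence of naturals
  an expansion, so that the sample space can be a full product.\<close>

definition digits :: "(nat \<Rightarrow> nat) \<Rightarrow> padic" where
  "digits d = (\<lambda>n. \<Sum>j<n. int (d j mod p) * int p ^ j)"

lemma digits_bound: "0 \<le> digits d n" "digits d n < int p ^ n"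
proof -
  show "0 \<le> digits d n" by (simp add: digits_def sum_nonneg)
  show "digits d n < int p ^ n"
  proof (induction n)
    case (Suc n)
    have "d n mod p < p" using p_gt_1 by simp
    then have "int (d n mod p) + 1 \<le> int p" by linarith
    then have "(int (d n mod p) + 1) * int p ^ n \<le> int p * int p ^ n" by (intro mult_right_mono) auto
    then show ?case using Suc by (simp add: digits_def algebra_simps)
  qed (simp add: digits_def)
qed

lemma digits_Suc: "digits d (Suc n) = digits d n + int (d n mod p) * int p ^ n"
  by (simp add: digits_def)

lemma digits_mod: "digits d (Suc n) mod int p ^ n = digits d n"
  using digits_bound[of d n] by (simp add: digits_Suc)

lemma digits_closed: "digits d \<in> carrier R"
  using digits_bound digits_mod by (auto simp: Zp_def)

text \<open>\<open>w (Suc j) div p^j\<close> is the digit of \<open>w\<close> at place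
  \<open>j\<close>.\<close>

lemma digits_eq_iff:
  assumes w: "w \<in> carrier R"
  shows "digits d n = w n \<longleftrightarrow> (\<forall>j<n. int (d j mod p) = w (Suc j) div int p ^ j)"
proof (induction n)
  case 0 then show ?case using ZpD[OF w, of 0] by (simp add: digits_def)
next
  case (Suc n)
  have wS: "w (Suc n) = w n + (w (Suc n) div int p ^ n) * int p ^ n"
    using ZpD(3)[OF w, of n] by (metis mult.commute mod_mult_div_eq add.commute mult_div_mod_eq)
  have "digits d (Suc n) = w (Suc n) \<longleftrightarrow> digits d n = w n \<and> int (d n mod p) = w (Suc n) div int p ^ n"
  proof
    assume eq: "digits d (Suc n) = w (Suc n)"
    then have e: "digits d n = w n" using digits_mod[of d n] ZpD(3)[OF w, of n] by simp
    then have "int (d n mod p) * int p ^ n = (w (Suc n) div int p ^ n) * int p ^ n" using eq wS digits_Suc[of d n] by linarith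
    then show "digits d n = w n \<and> int (d n mod p) = w (Suc n) div int p ^ n" using e p_gt_1 by simp
  next
    assume "digits d n = w n \<and> int (d n mod p) = w (Suc n) div int p ^ n"
    then show "digits d (Suc n) = w (Suc n)" using wS digits_Suc[of d n] by simp
  qed
  then show ?case using Suc less_Suc_eq by auto
qed

abbreviation digit_pmf :: "nat pmf" where "digit_pmf \<equiv> pmf_of_set {..<p}"

text \<open>Haar measure on \<open>\<int>\<^sub>p\<close> is the distribution of a series with independent uniform digits.\<close>

definition digit_space :: "(nat \<Rightarrow> nat) measure" where
  "digit_space = PiM UNIV (\<lambda>_. measure_pmf digit_pmf)"

lemma digit_prob: "c < p \<Longrightarrow> emeasure (measure_pmf digit_pmf) {d. d mod p = c} = 1 / ennreal (real p)"
proof -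
  assume c: "c < p"
  have ne: "{..<p} \<noteq> {}" using p_gt_1 by (auto simp: lessThan_empty_iff)
  have "{..<p} \<inter> {d. d mod p = c} = {c}" using c by auto
  then have "measure (measure_pmf digit_pmf) {d. d mod p = c} = 1 / real p"
    using measure_pmf_of_set[OF ne, of "{d. d mod p = c}"] by simp
  then have "emeasure (measure_pmf digit_pmf) {d. d mod p = c} = ennreal (1 / real p)"
    by (simp add: measure_pmf.emeasure_eq_measure)
  then show ?thesis using p_gt_1 by (simp add: divide_ennreal[symmetric])
qed

sublocale digit: product_prob_space "\<lambda>_. measure_pmf digit_pmf" "UNIV :: nat set" ..

text \<open>Agreement with \<open>w\<close> modulo \<open>p^n\<close> prescribes \<open>n\<close>
  independent digits.\<close>

lemma digit_cylinder:
  assumes w: "w \<in> carrier R"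
  shows "{d. digits d n = w n} \<in> sets digit_space" "emeasure digit_space {d. digits d n = w n} = (1 / ennreal (real p)) ^ n"
proof -
  define c where "c j = nat (w (Suc j) div int p ^ j)" for j
  have c: "c j < p" "w (Suc j) div int p ^ j = int (c j)" for j
  proof -
    have "w (Suc j) < int p ^ j * int p" using ZpD(2)[OF w, of "Suc j"] by (simp add: mult.commute)
    moreover have "w (Suc j) div int p ^ j * int p ^ j \<le> w (Suc j)"
      using minus_mod_eq_div_mult[of "w (Suc j)" "int p ^ j"] pos_mod_sign[OF pow_pos(1)[of j], of "w (Suc j)"] by linarith
    ultimately have "w (Suc j) div int p ^ j * int p ^ j < int p * int p ^ j" by (simp only: mult.commute)
    then have "w (Suc j) div int p ^ j < int p" using pow_pos(1)[of j] by simp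
    moreover have "0 \<le> w (Suc j) div int p ^ j" using ZpD(1)[OF w, of "Suc j"] pow_pos(1)[of j] by (simp add: pos_imp_zdiv_nonneg_iff)
    ultimately show "c j < p" "w (Suc j) div int p ^ j = int (c j)" by (auto simp: c_def nat_less_iff)
  qed
  have eq: "{d. digits d n = w n} = {d \<in> space digit_space. \<forall>j\<in>{..<n}. d j \<in> {a. a mod p = c j}}"
    unfolding digits_eq_iff[OF w] c(2) by (auto simp: digit_space_def space_PiM)
  show "{d. digits d n = w n} \<in> sets digit_space" unfolding eq digit_space_def
    by (intro sets.sets_Collect_finite_All sets_Collect_single') auto
  have "emeasure digit_space {d. digits d n = w n} = (\<Prod>j<n. emeasure (measure_pmf digit_pmf) {a. a mod p = c j})"
    unfolding eq unfolding digit_space_def by (rule digit.emeasure_PiM_Collect) auto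
  also have "\<dots> = (1 / ennreal (real p)) ^ n" by (simp add: digit_prob c)
  finally show "emeasure digit_space {d. digits d n = w n} = (1 / ennreal (real p)) ^ n" .
qed

lemma prob_digit_space: "prob_space digit_space"
  unfolding digit_space_def by (rule digit.P.prob_space_axioms)

end

section \<open>Existence of Haar measure on an extension\<close>

context padic_ext
begin

text \<open>Translation permutes the cells of each level, so a measure whose value on a cell depends
  only on the level agrees with its translates on a generator stable under intersection.\<close>

lemma haar_from_uniform:
  assumes M: "space M = carrier H" "sets M = Borel" "emeasure M (carrier H) = 1"
    and u: "\<And>x n. x \<in> carrier H \<Longrightarrow> emeasure M (cell n (q x) (lam x (n + k))) = c n"
  shows "is_haar p H M"
proof -
  have inv: "emeasure M (translate h A) = emeasure M A" if h: "h \<in> carrier H" and A: "A \<in> sets M" for h A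
  proof -
    have sub: "A \<subseteq> carrier H" if "A \<in> sets M" for A using sets.sets_into_space[OF that] M by simp
    have vim: "(\<lambda>x. \<ominus>\<^bsub>H\<^esub> h \<oplus>\<^bsub>H\<^esub> x) -` A \<inter> space M = translate h A" if "A \<in> sets M" for A
      using translate_eq[OF h sub[OF that]] M(1) by auto
    have meas: "(\<lambda>x. \<ominus>\<^bsub>H\<^esub> h \<oplus>\<^bsub>H\<^esub> x) \<in> measurable M M"
    proof (rule measurableI)
      show "\<ominus>\<^bsub>H\<^esub> h \<oplus>\<^bsub>H\<^esub> x \<in> space M" if "x \<in> space M" for x using that h M(1) by simp
      show "(\<lambda>x. \<ominus>\<^bsub>H\<^esub> h \<oplus>\<^bsub>H\<^esub> x) -` A \<inter> space M \<in> sets M" if "A \<in> sets M" for A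
        unfolding vim[OF that] using translate_Borel[OF h] that M(2) by simp
    qed
    let ?N = "distr M M (\<lambda>x. \<ominus>\<^bsub>H\<^esub> h \<oplus>\<^bsub>H\<^esub> x)"
    have N: "emeasure ?N A = emeasure M (translate h A)" if "A \<in> sets M" for A
      using emeasure_distr[OF meas that] vim[OF that] by simp
    have cellM: "cell n g a \<in> sets M" for n g a unfolding M(2) by (rule sigma_sets.Basic) (simp add: openin_cell)
    have "?N = M"
    proof (rule measure_eqI_generator_eq_countable[OF Int_stable_cells cells_subset])
      show "emeasure ?N X = emeasure M X" if X: "X \<in> cells" for X
      proof -
        obtain n g a where X: "X = cell n g a" using X by (auto simp: cells_def)
        show ?thesis unfolding X
        proof (rule cell_cases[of n g a])
          fix x assume x: "x \<in> carrier H" "cell n g a = cell n (q x) (lam x (n + k))"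
          show "emeasure ?N (cell n g a) = emeasure M (cell n g a)"
            unfolding x(2) N[OF cellM] translate_cell[OF h x(1)] using u x(1) h by simp
        qed simp
      qed
      show "sets ?N = sigma_sets (carrier H) cells" "sets M = sigma_sets (carrier H) cells" using M Borel_eq by auto
      let ?C = "(\<lambda>x. cell 0 (q x) (lam x (0 + k))) ` carrier H"
      show "?C \<subseteq> cells" using cellI q_closed by blast
      show "\<Union>?C = carrier H" using cell_refl[of _ 0] cell_subset by blast
      show "countable ?C" using coords_finite by (rule countable_finite)
      show "emeasure ?N B \<noteq> \<infinity>" for B
      proof -
        have "emeasure ?N B \<le> emeasure ?N (space ?N)" by (rule emeasure_space)
        also have "\<dots> = emeasure M {x \<in> carrier H. \<ominus>\<^bsub>H\<^esub> h \<oplus>\<^bsub>H\<^esub> x \<in> carrier H}"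
          using emeasure_distr[OF meas sets.top] M(1) by (simp add: vimage_def Int_def conj_commute)
        also have "{x \<in> carrier H. \<ominus>\<^bsub>H\<^esub> h \<oplus>\<^bsub>H\<^esub> x \<in> carrier H} = carrier H" using h by auto
        also have "emeasure M (carrier H) = 1" by (rule M(3))
        finally show ?thesis by (auto simp: top_unique)
      qed
    qed
    then show ?thesis using N[OF A] by simp
  qed
  then show ?thesis using M by (auto simp: is_haar_def l_coset_eq)
qed

definition lift :: "'g \<Rightarrow> 'h" where "lift g = (SOME h. h \<in> carrier H \<and> q h = g)"

lemma lift: "g \<in> carrier G \<Longrightarrow> lift g \<in> carrier H" "g \<in> carrier G \<Longrightarrow> q (lift g) = g"
proof -
  assume "g \<in> carrier G"
  then have "\<exists>h. h \<in> carrier H \<and> q h = g" using q_surj by (metis imageE)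
  from someI_ex[OF this] show "lift g \<in> carrier H" "q (lift g) = g" by (auto simp: lift_def)
qed

lemma haar_exists: "\<exists>M. is_haar p H M"
proof -
  \<comment> \<open>A point of \<open>H\<close> is a chosen lift of some \<open>g\<close> plus an
    element of \<open>i Z_p\<close>. A uniform \<open>g\<close> and independent digits give every
    cell of level \<open>n\<close> the mass \<open>1 / (|G| p^n)\<close>.\<close>
  define P where "P = uniform_count_measure (carrier G) \<Otimes>\<^sub>M digit_space"
  define \<Phi> where "\<Phi> = (\<lambda>(g, d). lift g \<oplus>\<^bsub>H\<^esub> i (digits d))"
  interpret D: prob_space digit_space by (rule prob_digit_space)
  have Gne: "carrier G \<noteq> {}" by auto
  interpret U: prob_space "uniform_count_measure (carrier G)" by (rule prob_space_uniform_count_measure[OF finG Gne])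
  interpret UD: pair_prob_space "uniform_count_measure (carrier G)" digit_space ..
  have spD: "space digit_space = UNIV" by (simp add: digit_space_def space_PiM)
  have spP: "space P = carrier G \<times> UNIV" by (simp add: P_def space_pair_measure space_uniform_count_measure spD)
  have pre: "\<exists>w\<in>carrier R. \<Phi> -` cell n (q x) (lam x (n + k)) \<inter> space P = {q x} \<times> {d. digits d n = w n}"
    if x: "x \<in> carrier H" for n x
  proof -
    have g: "q x \<in> carrier G" using x by simp
    obtain w where w: "w \<in> carrier R" "x = lift (q x) \<oplus>\<^bsub>H\<^esub> i w" using q_eqE[OF x lift(1)[OF g]] lift(2)[OF g] by metis
    have lx: "lam x = lam (lift (q x) \<oplus>\<^bsub>H\<^esub> i w)" using w(2) by simp
    have "\<Phi> (g', d) \<in> cell n (q x) (lam x (n + k)) \<longleftrightarrow> g' = q x \<and> digits d n = w n" if g': "g' \<in> carrier G" for g' d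
    proof -
      have "q (\<Phi> (g', d)) = g'" "\<Phi> (g', d) \<in> carrier H" using lift[OF g'] digits_closed g' by (auto simp: \<Phi>_def q_add)
      then show ?thesis using lam_shift_coord[OF lift(1)[OF g] digits_closed w(1), of d n] lx by (auto simp: cell_def \<Phi>_def)
    qed
    then have "\<Phi> -` cell n (q x) (lam x (n + k)) \<inter> space P = {q x} \<times> {d. digits d n = w n}" using g unfolding spP by auto
    then show ?thesis using w(1) by blast
  qed
  have meas: "\<Phi> \<in> measurable P (sigma (carrier H) cells)"
  proof (rule measurable_measure_of)
    show "cells \<subseteq> Pow (carrier H)" by (rule cells_subset)
    show "\<Phi> \<in> space P \<rightarrow> carrier H" using lift(1) digits_closed by (auto simp: spP \<Phi>_def)
    fix X assume "X \<in> cells"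
    then obtain n g a where X: "X = cell n g a" by (auto simp: cells_def)
    show "\<Phi> -` X \<inter> space P \<in> sets P" unfolding X
    proof (rule cell_cases[of n g a])
      fix x assume x: "x \<in> carrier H" "cell n g a = cell n (q x) (lam x (n + k))"
      obtain w where w: "w \<in> carrier R" "\<Phi> -` cell n (q x) (lam x (n + k)) \<inter> space P = {q x} \<times> {d. digits d n = w n}"
        using pre[OF x(1)] by blast
      show "\<Phi> -` cell n g a \<inter> space P \<in> sets P" unfolding x(2) w(2) unfolding P_def
        by (rule pair_measureI) (use x digit_cylinder[OF w(1)] in \<open>auto simp: sets_uniform_count_measure\<close>)
    qed simp
  qed
  let ?M = "distr P (sigma (carrier H) cells) \<Phi>"
  have sets: "sets ?M = Borel" using Borel_eq cells_subset by simp
  have sp: "space ?M = carrier H" by (simp add: space_measure_of_conv)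
  have "is_haar p H ?M"
  proof (rule haar_from_uniform[OF sp sets])
    have "emeasure ?M (space ?M) = 1" using UD.prob_space_distr[of \<Phi> "sigma (carrier H) cells"] meas
      unfolding P_def using prob_space.emeasure_space_1 by blast
    then show "emeasure ?M (carrier H) = 1" using sp by simp
    fix x n assume x: "x \<in> carrier H"
    obtain w where w: "w \<in> carrier R" "\<Phi> -` cell n (q x) (lam x (n + k)) \<inter> space P = {q x} \<times> {d. digits d n = w n}"
      using pre[OF x] by blast
    have "cell n (q x) (lam x (n + k)) \<in> sets (sigma (carrier H) cells)"
      using cells_subset x by (simp add: sigma_sets.Basic cellI)
    then have "emeasure ?M (cell n (q x) (lam x (n + k))) = emeasure P ({q x} \<times> {d. digits d n = w n})"
      using emeasure_distr[OF meas] w(2) by simp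
    also have "\<dots> = emeasure (uniform_count_measure (carrier G)) {q x} * emeasure digit_space {d. digits d n = w n}"
      unfolding P_def by (rule D.emeasure_pair_measure_Times) (use x digit_cylinder[OF w(1)] in \<open>auto simp: sets_uniform_count_measure\<close>)
    also have "\<dots> = ennreal (1 / real (card (carrier G))) * (1 / ennreal (real p)) ^ n"
      using x finG digit_cylinder[OF w(1)] by (subst emeasure_uniform_count_measure) auto
    finally show "emeasure ?M (cell n (q x) (lam x (n + k))) = ennreal (1 / real (card (carrier G))) * (1 / ennreal (real p)) ^ n" .
  qed
  then show ?thesis by blast
qed

lemma is_haar_haar: "is_haar p H (haar p H)"
  unfolding haar_def using haar_exists haar_unique by (metis theI')

end

section \<open>Surjections and isomorphism classes\<close>

text \<open>The universal property of the quotient. It serves twice: to count surjections from the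
  quotient by \<open>h\<close>, and, with \<open>F\<close> equal to \<open>B\<close>, to count the
  surjections that share one kernel.\<close>

lemma Sur_factor:
  assumes G: "group G" and B: "group B" and F: "group F" and \<pi>: "\<pi> \<in> epi G B"
  shows "bij_betw (\<lambda>\<sigma>. restrict (\<sigma> \<circ> \<pi>) (carrier G)) (Sur B F) {\<psi> \<in> Sur G F. kernel G B \<pi> \<subseteq> kernel G F \<psi>}"
proof -
  interpret G: group G by fact
  interpret B: group B by fact
  interpret F: group F by fact
  have \<pi>h: "\<pi> \<in> hom G B" and \<pi>s: "\<pi> ` carrier G = carrier B" using \<pi> by (auto simp: epi_def)
  interpret \<pi>: group_hom G B \<pi> using \<pi>h by unfold_locales
  let ?f = "\<lambda>\<sigma>. restrict (\<sigma> \<circ> \<pi>) (carrier G)"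
  have inj: "inj_on ?f (Sur B F)"
  proof (rule inj_onI)
    fix \<sigma> \<sigma>' assume s: "\<sigma> \<in> Sur B F" "\<sigma>' \<in> Sur B F" and eq: "?f \<sigma> = ?f \<sigma>'"
    show "\<sigma> = \<sigma>'"
    proof (rule extensionalityI)
      show "\<sigma> \<in> extensional (carrier B)" "\<sigma>' \<in> extensional (carrier B)" using s by (auto simp: Sur_def)
      fix b assume "b \<in> carrier B"
      then obtain x where x: "x \<in> carrier G" "b = \<pi> x" using \<pi>s by (metis imageE)
      then show "\<sigma> b = \<sigma>' b" using fun_cong[OF eq, of x] by simp
    qed
  qed
  have to: "?f \<sigma> \<in> {\<psi> \<in> Sur G F. kernel G B \<pi> \<subseteq> kernel G F \<psi>}" if s: "\<sigma> \<in> Sur B F" for \<sigma>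
  proof -
    have sh: "\<sigma> \<in> hom B F" and ss: "\<sigma> ` carrier B = carrier F" using s by (auto simp: Sur_def epi_def)
    interpret \<sigma>: group_hom B F \<sigma> using sh by unfold_locales
    have "?f \<sigma> \<in> hom G F" by (rule homI) auto
    moreover have "?f \<sigma> ` carrier G = carrier F"
    proof -
      have "(\<lambda>x. \<sigma> (\<pi> x)) ` carrier G = carrier F" using ss \<pi>s by (simp add: image_image[symmetric])
      then show ?thesis by simp
    qed
    moreover have "kernel G B \<pi> \<subseteq> kernel G F (?f \<sigma>)" by (auto simp: kernel_def)
    ultimately show ?thesis by (auto simp: Sur_def epi_def)
  qed
  have "\<psi> \<in> ?f ` Sur B F" if p: "\<psi> \<in> {\<psi> \<in> Sur G F. kernel G B \<pi> \<subseteq> kernel G F \<psi>}" for \<psi>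
  proof -
    have ph: "\<psi> \<in> hom G F" and ps: "\<psi> ` carrier G = carrier F" and pe: "\<psi> \<in> extensional (carrier G)"
      and ker: "kernel G B \<pi> \<subseteq> kernel G F \<psi>" using p by (auto simp: Sur_def epi_def)
    interpret \<psi>: group_hom G F \<psi> using ph by unfold_locales
    define \<sigma> where "\<sigma> = (\<lambda>b\<in>carrier B. \<psi> (SOME x. x \<in> carrier G \<and> \<pi> x = b))"
    have wd: "\<psi> x = \<psi> y" if xy: "x \<in> carrier G" "y \<in> carrier G" "\<pi> x = \<pi> y" for x y
    proof -
      have "\<pi> (x \<otimes>\<^bsub>G\<^esub> inv\<^bsub>G\<^esub> y) = \<one>\<^bsub>B\<^esub>" using xy by simp
      then have "x \<otimes>\<^bsub>G\<^esub> inv\<^bsub>G\<^esub> y \<in> kernel G B \<pi>" using xy by (simp add: kernel_def)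
      then have "x \<otimes>\<^bsub>G\<^esub> inv\<^bsub>G\<^esub> y \<in> kernel G F \<psi>" using ker by blast
      then have "\<psi> (x \<otimes>\<^bsub>G\<^esub> inv\<^bsub>G\<^esub> y) = \<one>\<^bsub>F\<^esub>" by (simp add: kernel_def)
      moreover have "\<psi> (x \<otimes>\<^bsub>G\<^esub> inv\<^bsub>G\<^esub> y) = \<psi> x \<otimes>\<^bsub>F\<^esub> inv\<^bsub>F\<^esub> \<psi> y" using xy by simp
      ultimately have e: "\<psi> x \<otimes>\<^bsub>F\<^esub> inv\<^bsub>F\<^esub> \<psi> y = \<one>\<^bsub>F\<^esub>" by simp
      show ?thesis using F.inv_equality[OF e] xy by simp
    qed
    have \<sigma>: "\<sigma> (\<pi> x) = \<psi> x" if x: "x \<in> carrier G" for x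
    proof -
      define s where "s = (SOME y. y \<in> carrier G \<and> \<pi> y = \<pi> x)"
      have "s \<in> carrier G \<and> \<pi> s = \<pi> x" unfolding s_def by (rule someI[of _ x]) (use x in simp)
      then have "\<psi> s = \<psi> x" using wd x by blast
      then show ?thesis using x by (simp add: \<sigma>_def s_def)
    qed
    have "\<sigma> \<in> hom B F"
    proof (rule homI)
      fix b assume "b \<in> carrier B"
      then obtain x where "x \<in> carrier G" "b = \<pi> x" using \<pi>s by (metis imageE)
      then show "\<sigma> b \<in> carrier F" using \<sigma> by simp
    next
      fix b c assume "b \<in> carrier B" "c \<in> carrier B"
      then obtain x y where xy: "x \<in> carrier G" "b = \<pi> x" "y \<in> carrier G" "c = \<pi> y" using \<pi>s by (metis imageE)
      have "\<sigma> (b \<otimes>\<^bsub>B\<^esub> c) = \<sigma> (\<pi> (x \<otimes>\<^bsub>G\<^esub> y))" using xy by simp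
      also have "\<dots> = \<psi> x \<otimes>\<^bsub>F\<^esub> \<psi> y" using xy \<sigma>[of "x \<otimes>\<^bsub>G\<^esub> y"] by simp
      finally show "\<sigma> (b \<otimes>\<^bsub>B\<^esub> c) = \<sigma> b \<otimes>\<^bsub>F\<^esub> \<sigma> c" using xy \<sigma> by simp
    qed
    moreover have "\<sigma> ` carrier B = carrier F"
    proof -
      have "\<sigma> ` carrier B = (\<lambda>x. \<sigma> (\<pi> x)) ` carrier G" unfolding \<pi>s[symmetric] image_image ..
      also have "\<dots> = \<psi> ` carrier G" using \<sigma> by (rule image_cong[OF refl])
      finally show ?thesis using ps by simp
    qed
    ultimately have "\<sigma> \<in> Sur B F" by (auto simp: Sur_def epi_def \<sigma>_def)
    moreover have "?f \<sigma> = \<psi>"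
      by (rule extensionalityI[of _ "carrier G"]) (use pe \<sigma> in auto)
    ultimately show ?thesis by blast
  qed
  then show ?thesis unfolding bij_betw_def using inj to by blast
qed

text \<open>A surjective self-map of a finite set is injective.\<close>

lemma auto_eq_Sur: "finite (carrier K) \<Longrightarrow> auto K = Sur K K"
  unfolding auto_def Sur_def epi_def Bij_def bij_betw_def
  by (auto simp: finite_surj_inj)

lemma FactGroup_epi:
  assumes "comm_group G" "subgroup N G"
  shows "(\<lambda>x. N #>\<^bsub>G\<^esub> x) \<in> epi G (G Mod N)" "kernel G (G Mod N) (\<lambda>x. N #>\<^bsub>G\<^esub> x) = N" "comm_group (G Mod N)"
proof -
  interpret comm_group G by fact
  interpret N: normal N G by (rule subgroup_imp_normal[OF assms(2)])
  show "(\<lambda>x. N #>\<^bsub>G\<^esub> x) \<in> epi G (G Mod N)" using N.r_coset_hom_Mod by (auto simp: epi_def FactGroup_def RCOSETS_def)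
  show "kernel G (G Mod N) (\<lambda>x. N #>\<^bsub>G\<^esub> x) = N"
    using coset_join1[OF _ _ assms(2)] coset_join2[OF _ assms(2)] N.subset by (auto simp: kernel_def FactGroup_def)
  show "comm_group (G Mod N)" by (rule abelian_FactGroup[OF assms(2)])
qed

lemma fin_ab_p_groupD:
  assumes "fin_ab_p_group p G"
  shows "comm_group G" "group G" "finite (carrier G)" "\<exists>k. order G = p ^ k"
  using assms by (auto simp: fin_ab_p_group_def comm_group.axioms)

lemma fin_ab_p_group_iso:
  assumes "fin_ab_p_group p A" "group B" "A \<cong> B"
  shows "fin_ab_p_group p B"
proof -
  interpret comm_group A by (rule fin_ab_p_groupD(1)[OF assms(1)])
  have "comm_group B" using iso_imp_comm_group[OF assms(3)] assms(2) group.is_monoid by blast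
  moreover obtain f where f: "bij_betw f (carrier A) (carrier B)" using assms(3) by (auto simp: is_iso_def iso_def)
  then have "finite (carrier B)" "order B = order A"
    using fin_ab_p_groupD(3)[OF assms(1)] bij_betw_finite[OF f] bij_betw_same_card[OF f] by (auto simp: order_def)
  ultimately show ?thesis using assms(1) by (simp add: fin_ab_p_group_def)
qed

lemma class0_eqI:
  assumes "group A" "A \<cong> B"
  shows "class0 p A = class0 p B"
proof -
  have "B \<cong> A" by (rule group.iso_sym[OF assms])
  then show ?thesis using iso_trans[OF _ assms(2)] iso_trans[of _ B A] by (auto simp: class0_def)
qed

lemma class0_eq_iff:
  fixes K :: "nat monoid"
  assumes "fin_ab_p_group p K" "group A"
  shows "class0 p A = class0 p K \<longleftrightarrow> A \<cong> K"
proof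
  assume eq: "class0 p A = class0 p K"
  have "K \<in> class0 p K" unfolding class0_def using assms(1) iso_refl by blast
  then have "K \<in> class0 p A" by (simp only: eq)
  then have "K \<cong> A" unfolding class0_def by blast
  then show "A \<cong> K" by (rule group.iso_sym[OF fin_ab_p_groupD(2)[OF assms(1)]])
qed (rule class0_eqI[OF assms(2)])

lemma rep_in: "c \<noteq> {} \<Longrightarrow> rep c \<in> c"
  unfolding rep_def by (rule someI_ex) blast

lemma X0_rep:
  assumes "c \<in> X0 p"
  shows "fin_ab_p_group p (rep c)" "class0 p (rep c) = c"
proof -
  obtain K :: "nat monoid" where K: "fin_ab_p_group p K" "c = class0 p K" using assms by (auto simp: X0_def)
  have "K \<in> c" unfolding K(2) class0_def using K(1) iso_refl by blast
  then have "c \<noteq> {}" by blast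
  then have "rep c \<in> c" by (rule rep_in)
  then have r: "fin_ab_p_group p (rep c)" "rep c \<cong> K" unfolding K(2) class0_def by blast+
  then show f: "fin_ab_p_group p (rep c)" by blast
  have "class0 p (rep c) = class0 p K" by (rule class0_eqI[OF fin_ab_p_groupD(2)[OF f] r(2)])
  then show "class0 p (rep c) = c" using K(2) by metis
qed

text \<open>Quotient groups have cosets as elements, whereas the classes in \<open>X0\<close>
  consist of groups on the naturals.\<close>

lemma nat_copy:
  fixes A :: "'a set monoid"
  assumes "fin_ab_p_group p A"
  obtains B :: "nat monoid" where "fin_ab_p_group p B" "A \<cong> B"
proof -
  note A = fin_ab_p_groupD[OF assms]
  obtain f :: "'a set \<Rightarrow> nat" where f: "inj_on f (carrier A)" using finite_imp_inj_to_nat_seg[OF A(3)] by blast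
  have "f \<in> iso A (flatten A f)" using flatten_set_group_hom[OF A(2) f] f by (simp add: iso_def bij_betw_def flatten_def)
  then have "A \<cong> flatten A f" by (rule is_isoI)
  moreover have "fin_ab_p_group p (flatten A f)"
    by (rule fin_ab_p_group_iso[OF assms flatten_set_group[OF A(2) f] \<open>A \<cong> flatten A f\<close>])
  ultimately show ?thesis using that by blast
qed

lemma class0_in_X0:
  fixes A :: "'a set monoid"
  assumes "fin_ab_p_group p A"
  shows "class0 p A \<in> X0 p" "A \<cong> rep (class0 p A)"
proof -
  obtain B :: "nat monoid" where B: "fin_ab_p_group p B" "A \<cong> B" by (rule nat_copy[OF assms])
  have e: "class0 p A = class0 p B" by (rule class0_eqI[OF fin_ab_p_groupD(2)[OF assms] B(2)])
  then show X: "class0 p A \<in> X0 p" using B(1) by (auto simp: X0_def)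
  show "A \<cong> rep (class0 p A)"
    using class0_eq_iff[OF X0_rep(1)[OF X] fin_ab_p_groupD(2)[OF assms]] X0_rep(2)[OF X] by simp
qed

section \<open>The random quotient of an extension\<close>

context padic_ext
begin

lemma haar_facts: "space (haar p H) = carrier H" "sets (haar p H) = Borel" "emeasure (haar p H) (carrier H) = 1"
  using is_haar_haar by (auto simp: is_haar_def)

sublocale haar: prob_space "haar p H"
  by (rule prob_spaceI) (simp add: haar_facts)

lemma haar_translate:
  assumes "A \<in> sets (haar p H)" "h \<in> carrier H"
  shows "translate h A \<in> sets (haar p H)" "measure (haar p H) (translate h A) = measure (haar p H) A"
  using is_haar_haar translate_Borel[OF assms(2)] assms haar_facts(2) by (auto simp: is_haar_def l_coset_eq measure_def)

lemma open_measurable: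
  assumes "U \<subseteq> carrier H" "\<And>x. x \<in> U \<Longrightarrow> \<exists>n. \<forall>z\<in>carrier R. z n = 0 \<longrightarrow> x \<oplus>\<^bsub>H\<^esub> i z \<in> U"
  shows "U \<in> sets (haar p H)"
proof -
  have "openin (padic_topology p H) U" unfolding openin_iff
  proof (intro conjI ballI)
    fix x assume x: "x \<in> U"
    then have xH: "x \<in> carrier H" using assms(1) by blast
    obtain n where n: "\<forall>z\<in>carrier R. z n = 0 \<longrightarrow> x \<oplus>\<^bsub>H\<^esub> i z \<in> U" using assms(2)[OF x] by blast
    have "y \<in> U" if y: "y \<in> cell n (q x) (lam x (n + k))" for y
      by (rule mem_cellE[OF y xH]) (use n in blast)
    then show "\<exists>n. cell n (q x) (lam x (n + k)) \<subseteq> U" by blast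
  qed (rule assms(1))
  then show ?thesis unfolding haar_facts(2) by (intro sigma_sets.Basic) simp
qed

section \<open>The torsion is a null set\<close>

definition torsion where "torsion = {x \<in> carrier H. lam x = \<zero>\<^bsub>R\<^esub>}"

text \<open>The complement is open. The translates of the torsion by \<open>i a\<close> for integers
  \<open>a\<close> are disjoint, since \<open>lam\<close> equals \<open>p^k a\<close> there, and
  have equal measure; any number of them fits into total mass \<open>1\<close>.\<close>

lemma torsion_null: "torsion \<in> sets (haar p H)" "measure (haar p H) torsion = 0"
proof -
  have "carrier H - torsion \<in> sets (haar p H)"
  proof (rule open_measurable)
    fix x assume x: "x \<in> carrier H - torsion"
    then obtain m where m: "lam x m \<noteq> 0" by (auto simp: torsion_def Zp_simps)
    have xH: "x \<in> carrier H" using x by simp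
    have m': "lam x (m + k) \<noteq> 0" using m Zp_mod[OF lam_closed[OF xH], of m "m + k"] by auto
    have "x \<oplus>\<^bsub>H\<^esub> i z \<in> carrier H - torsion" if z: "z \<in> carrier R" "z m = 0" for z
      using mem_cellI[OF xH z] m' by (auto simp: cell_def torsion_def Zp_simps)
    then show "\<exists>n. \<forall>z\<in>carrier R. z n = 0 \<longrightarrow> x \<oplus>\<^bsub>H\<^esub> i z \<in> carrier H - torsion" by blast
  qed simp
  then have "space (haar p H) - (carrier H - torsion) \<in> sets (haar p H)" by (rule sets.compl_sets)
  moreover have "space (haar p H) - (carrier H - torsion) = torsion" unfolding haar_facts(1) torsion_def by blast
  ultimately show t: "torsion \<in> sets (haar p H)" by simp
  have le: "real N * measure (haar p H) torsion \<le> 1" for N :: nat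
  proof -
    let ?T = "\<lambda>a. translate (i (zint (int a))) torsion"
    have lt: "lam y = zint (int p ^ k * int a)" if y: "y \<in> ?T a" for a y
      using y by (auto simp: translate_def torsion_def lam_add lam_i zint_mult)
    have disj: "disjoint_family_on ?T {..<N}"
      unfolding disjoint_family_on_def
    proof (intro ballI impI)
      fix a b assume ab: "a \<noteq> (b::nat)"
      have False if "y \<in> ?T a" "y \<in> ?T b" for y
      proof -
        have "zint (int p ^ k * int a) = zint (int p ^ k * int b)" using lt that by metis
        then have "zint (int p ^ k * int a + - (int p ^ k * int b)) = \<zero>\<^bsub>R\<^esub>"
          unfolding zint_add zint_uminus using R.r_neg[OF zint_closed] by simp
        then have "int p ^ k * int a = int p ^ k * int b" unfolding zint_eq_0 by linarith
        then show False using ab p_gt_1 by simp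
      qed
      then show "?T a \<inter> ?T b = {}" by blast
    qed
    have "(\<Sum>a<N. measure (haar p H) (?T a)) = measure (haar p H) (\<Union>a\<in>{..<N}. ?T a)"
      by (rule haar.finite_measure_finite_Union[symmetric]) (use haar_translate(1)[OF t] disj in auto)
    also have "\<dots> \<le> 1" by simp
    finally show ?thesis using haar_translate(2)[OF t] by simp
  qed
  show "measure (haar p H) torsion = 0"
  proof (rule ccontr)
    assume "measure (haar p H) torsion \<noteq> 0"
    then have pos: "measure (haar p H) torsion > 0" by (simp add: zero_less_measure_iff)
    then obtain N :: nat where "1 < real N * measure (haar p H) torsion" using reals_Archimedean3 by blast
    then show False using le[of N] by simp
  qed
qed

section \<open>Quotients by one element\<close>

lemma subgroup_cyc:
  assumes "h \<in> carrier H"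
  shows "subgroup (cyc h) (add_monoid H)"
proof (rule group.subgroupI[OF H.M.a_group])
  show "cyc h \<subseteq> carrier (add_monoid H)" "cyc h \<noteq> {}" using assms by (auto simp: cyc_def)
  fix a b assume "a \<in> cyc h" "b \<in> cyc h"
  then obtain x y where xy: "x \<in> carrier R" "a = x \<odot>\<^bsub>H\<^esub> h" "y \<in> carrier R" "b = y \<odot>\<^bsub>H\<^esub> h" by (auto simp: cyc_def)
  have "a \<oplus>\<^bsub>H\<^esub> b = (x \<oplus>\<^bsub>R\<^esub> y) \<odot>\<^bsub>H\<^esub> h" using xy assms by (simp add: H.smult_l_distr)
  then show "a \<otimes>\<^bsub>add_monoid H\<^esub> b \<in> cyc h" using xy by (auto simp: cyc_def)
  have "\<ominus>\<^bsub>H\<^esub> a = (\<ominus>\<^bsub>R\<^esub> x) \<odot>\<^bsub>H\<^esub> h" using xy assms by (simp add: H.smult_l_minus)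
  then have "\<ominus>\<^bsub>H\<^esub> a \<in> cyc h" using xy(1) R.a_inv_closed unfolding cyc_def by blast
  then show "inv\<^bsub>add_monoid H\<^esub> a \<in> cyc h" by (simp add: a_inv_def)
qed

lemma quot_elem_eq: "quot_elem p H h = add_monoid H Mod cyc h"
  by (simp add: quot_elem_def A_FactGroup_def cyc_def)

lemma cyc_refl: "h \<in> carrier H \<Longrightarrow> h \<in> cyc h"
  unfolding cyc_def using H.smult_one[of h] R.one_closed by force

lemma cyc_smult: "h \<in> carrier H \<Longrightarrow> x \<in> cyc h \<Longrightarrow> a \<in> carrier R \<Longrightarrow> a \<odot>\<^bsub>H\<^esub> x \<in> cyc h"
  unfolding cyc_def using H.smult_assoc1 by (auto simp: H.smult_assoc1[symmetric])

text \<open>If \<open>lam h = p^c u\<close> and \<open>v\<close> is the inverse of \<open>u\<close>,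
  then \<open>p^c z = (z v) lam h\<close>, and \<open>i (lam h)\<close> is \<open>p^k h\<close>. So
  the submodule generated by a non-torsion element contains \<open>i (p^c Z_p)\<close>, which makes
  it open.\<close>

lemma cyc_open:
  assumes "h \<in> carrier H" "lam h \<noteq> \<zero>\<^bsub>R\<^esub>"
  shows "\<exists>c. \<forall>z\<in>carrier R. i (zint (int p ^ c) \<otimes>\<^bsub>R\<^esub> z) \<in> cyc h"
proof -
  obtain c u v where u: "u \<in> carrier R" "v \<in> carrier R" "lam h = zint (int p ^ c) \<otimes>\<^bsub>R\<^esub> u" "u \<otimes>\<^bsub>R\<^esub> v = \<one>\<^bsub>R\<^esub>"
    using Zp_factor[OF lam_closed[OF assms(1)] assms(2)] .
  have "i (zint (int p ^ c) \<otimes>\<^bsub>R\<^esub> z) \<in> cyc h" if z: "z \<in> carrier R" for z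
  proof -
    have "zint (int p ^ c) \<otimes>\<^bsub>R\<^esub> z = (z \<otimes>\<^bsub>R\<^esub> v) \<otimes>\<^bsub>R\<^esub> lam h"
    proof -
      have "(z \<otimes>\<^bsub>R\<^esub> v) \<otimes>\<^bsub>R\<^esub> (zint (int p ^ c) \<otimes>\<^bsub>R\<^esub> u) = zint (int p ^ c) \<otimes>\<^bsub>R\<^esub> z \<otimes>\<^bsub>R\<^esub> (u \<otimes>\<^bsub>R\<^esub> v)"
        using u(1,2) z by (simp add: R.m_ac)
      then show ?thesis using u z by simp
    qed
    then have "i (zint (int p ^ c) \<otimes>\<^bsub>R\<^esub> z) = i ((z \<otimes>\<^bsub>R\<^esub> v) \<otimes>\<^bsub>R\<^esub> lam h)" by simp
    also have "\<dots> = (z \<otimes>\<^bsub>R\<^esub> v) \<odot>\<^bsub>H\<^esub> (pk \<odot>\<^bsub>H\<^esub> h)"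
      using u(2) z assms(1) i_mult[of "z \<otimes>\<^bsub>R\<^esub> v" "lam h"] by (simp add: i_lam)
    also have "\<dots> = ((z \<otimes>\<^bsub>R\<^esub> v) \<otimes>\<^bsub>R\<^esub> pk) \<odot>\<^bsub>H\<^esub> h"
      using u(2) z assms(1) by (simp add: H.smult_assoc1)
    finally show ?thesis using u z unfolding cyc_def by blast
  qed
  then show ?thesis by blast
qed

text \<open>The submodule contains \<open>i (p^c Z_p)\<close>, so the projection is constant on each
  of the finitely many cells of level \<open>c\<close>; and \<open>p^(c+k)\<close> kills the
  quotient, because \<open>p^k\<close> maps \<open>H\<close> into the image of
  \<open>i\<close>.\<close>

lemma quot_finite:
  assumes "h \<in> carrier H" "lam h \<noteq> \<zero>\<^bsub>R\<^esub>"
  shows "fin_ab_p_group p (quot_elem p H h)"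
proof -
  let ?A = "add_monoid H Mod cyc h" and ?\<pi> = "\<lambda>x. cyc h #>\<^bsub>add_monoid H\<^esub> x"
  note F = FactGroup_epi[OF H.M.a_comm_group subgroup_cyc[OF assms(1)]]
  have hom: "?\<pi> \<in> hom (add_monoid H) ?A" and surj: "?\<pi> ` carrier H = carrier ?A" using F(1) by (auto simp: epi_def)
  have gA: "group ?A" using F(3) by (rule comm_group.axioms(2))
  interpret \<pi>: group_hom "add_monoid H" ?A ?\<pi> by (rule H.M.add_hom_group_hom[OF hom gA])
  obtain c where "\<forall>z\<in>carrier R. i (zint (int p ^ c) \<otimes>\<^bsub>R\<^esub> z) \<in> cyc h" using cyc_open[OF assms] by blast
  then have c: "i (zint (int p ^ c) \<otimes>\<^bsub>R\<^esub> z) \<in> cyc h" if "z \<in> carrier R" for z using that by blast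
  have one: "?\<pi> x = \<one>\<^bsub>?A\<^esub>" if "x \<in> cyc h" for x using F(2) that by (auto simp: kernel_def)
  have const: "?\<pi> y = ?\<pi> x" if x: "x \<in> carrier H" and y: "y \<in> cell c (q x) (lam x (c + k))" for x y
  proof -
    obtain z where z: "z \<in> carrier R" "z c = 0" "y = x \<oplus>\<^bsub>H\<^esub> i z" using mem_cellE[OF y x] .
    obtain w where w: "w \<in> carrier R" "z = zint (int p ^ c) \<otimes>\<^bsub>R\<^esub> w" using Zp_divide[OF z(1,2)] by blast
    have "?\<pi> (x \<oplus>\<^bsub>H\<^esub> i z) = ?\<pi> x \<otimes>\<^bsub>?A\<^esub> ?\<pi> (i z)" using \<pi>.hom_mult[of x "i z"] x z(1) by simp
    also have "?\<pi> (i z) = \<one>\<^bsub>?A\<^esub>" using one c[OF w(1)] w(2) by simp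
    also have "?\<pi> x \<otimes>\<^bsub>?A\<^esub> \<one>\<^bsub>?A\<^esub> = ?\<pi> x"
      by (rule monoid.r_one[OF group.is_monoid[OF gA]]) (use surj x in blast)
    finally show ?thesis using z(3) by simp
  qed
  have "carrier ?A \<subseteq> (\<lambda>C. ?\<pi> (SOME y. y \<in> C)) ` (\<lambda>x. cell c (q x) (lam x (c + k))) ` carrier H"
  proof
    fix b assume "b \<in> carrier ?A"
    then obtain x where x: "x \<in> carrier H" "b = ?\<pi> x" using surj by blast
    have "(SOME y. y \<in> cell c (q x) (lam x (c + k))) \<in> cell c (q x) (lam x (c + k))"
      by (rule someI[of _ x]) (rule cell_refl[OF x(1)])
    then have "b = ?\<pi> (SOME y. y \<in> cell c (q x) (lam x (c + k)))" using const[OF x(1)] x(2) by simp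
    then show "b \<in> (\<lambda>C. ?\<pi> (SOME y. y \<in> C)) ` (\<lambda>x. cell c (q x) (lam x (c + k))) ` carrier H" using x(1) by blast
  qed
  then have fin: "finite (carrier ?A)" by (rule finite_subset) (intro finite_imageI coords_finite)
  have "\<exists>m. order ?A = p ^ m"
  proof (rule group.prime_power_order[OF gA fin prime_p])
    fix b assume "b \<in> carrier ?A"
    then obtain x where x: "x \<in> carrier H" "b = ?\<pi> x" using surj by blast
    have "zint (int (p ^ (c + k))) \<odot>\<^bsub>H\<^esub> x = zint (int p ^ c) \<odot>\<^bsub>H\<^esub> i (lam x)"
      using x(1) by (simp add: i_lam power_add zint_mult H.smult_assoc1)
    also have "\<dots> = i (zint (int p ^ c) \<otimes>\<^bsub>R\<^esub> lam x)" using x(1) by (simp add: i_mult)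
    finally have "zint (int (p ^ (c + k))) \<odot>\<^bsub>H\<^esub> x \<in> cyc h" using c x(1) by simp
    then have "?\<pi> (zint (int (p ^ (c + k))) \<odot>\<^bsub>H\<^esub> x) = \<one>\<^bsub>?A\<^esub>" by (rule one)
    then show "b [^]\<^bsub>?A\<^esub> (p ^ (c + k)) = \<one>\<^bsub>?A\<^esub>" using add_hom_pow[OF gA hom x(1)] x(2) by metis
  qed
  then show ?thesis using F(3) fin by (simp add: quot_elem_eq fin_ab_p_group_def)
qed

lemma group_quot: "h \<in> carrier H \<Longrightarrow> group (quot_elem p H h)"
  unfolding quot_elem_eq using FactGroup_epi(3)[OF H.M.a_comm_group subgroup_cyc] comm_group.axioms(2) by blast

lemma quot_epi_iff:
  assumes h: "h \<in> carrier H" and B: "group B"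
  shows "quot_elem p H h \<cong> B \<longleftrightarrow> (\<exists>\<pi>\<in>Sur (add_monoid H) B. kernel (add_monoid H) B \<pi> = cyc h)"
proof
  note F = FactGroup_epi[OF H.M.a_comm_group subgroup_cyc[OF h]]
  let ?\<pi> = "\<lambda>x. cyc h #>\<^bsub>add_monoid H\<^esub> x"
  have gA: "group (add_monoid H Mod cyc h)" using group_quot[OF h] by (simp add: quot_elem_eq)
  assume "quot_elem p H h \<cong> B"
  then obtain f where f: "f \<in> hom (add_monoid H Mod cyc h) B" "bij_betw f (carrier (add_monoid H Mod cyc h)) (carrier B)"
    by (auto simp: is_iso_def iso_def quot_elem_eq)
  have hom: "?\<pi> \<in> hom (add_monoid H) (add_monoid H Mod cyc h)" and surj: "?\<pi> ` carrier H = carrier (add_monoid H Mod cyc h)"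
    using F(1) by (auto simp: epi_def)
  interpret f: group_hom "add_monoid H Mod cyc h" B f using f(1) gA B by (simp add: group_hom_def group_hom_axioms_def)
  let ?g = "\<lambda>x\<in>carrier H. f (?\<pi> x)"
  have comp: "(\<lambda>x. f (?\<pi> x)) \<in> hom (add_monoid H) B" using hom_compose[OF hom f(1)] by (simp add: comp_def)
  have "?g \<in> hom (add_monoid H) B" using comp by (auto simp: hom_def)
  moreover have "?g ` carrier H = carrier B"
  proof -
    have "?g ` carrier H = f ` ?\<pi> ` carrier H" unfolding image_image by (rule image_cong) auto
    then show ?thesis using surj f(2) by (simp add: bij_betw_def)
  qed
  ultimately have "?g \<in> Sur (add_monoid H) B" by (auto simp: Sur_def epi_def)
  moreover have "kernel (add_monoid H) B ?g = cyc h"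
  proof -
    have "f (?\<pi> x) = \<one>\<^bsub>B\<^esub> \<longleftrightarrow> ?\<pi> x = \<one>\<^bsub>add_monoid H Mod cyc h\<^esub>" if x: "x \<in> carrier H" for x
    proof -
      have "?\<pi> x \<in> carrier (add_monoid H Mod cyc h)" using surj x by blast
      moreover have "\<one>\<^bsub>add_monoid H Mod cyc h\<^esub> \<in> carrier (add_monoid H Mod cyc h)" by (rule group.is_monoid[OF gA, THEN monoid.one_closed])
      ultimately show ?thesis using f.hom_one f(2) by (metis bij_betw_imp_inj_on inj_on_eq_iff)
    qed
    then have "kernel (add_monoid H) B ?g = kernel (add_monoid H) (add_monoid H Mod cyc h) ?\<pi>" by (auto simp: kernel_def)
    then show ?thesis using F(2) by simp
  qed
  ultimately show "\<exists>\<pi>\<in>Sur (add_monoid H) B. kernel (add_monoid H) B \<pi> = cyc h" by blast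
next
  assume "\<exists>\<pi>\<in>Sur (add_monoid H) B. kernel (add_monoid H) B \<pi> = cyc h"
  then obtain \<pi> where \<pi>: "\<pi> \<in> hom (add_monoid H) B" "\<pi> ` carrier H = carrier B" "kernel (add_monoid H) B \<pi> = cyc h"
    by (auto simp: Sur_def epi_def)
  interpret \<pi>: group_hom "add_monoid H" B \<pi> by (rule H.M.add_hom_group_hom[OF \<pi>(1) B])
  show "quot_elem p H h \<cong> B" using \<pi>.FactGroup_iso \<pi>(2,3) by (simp add: quot_elem_eq)
qed

text \<open>A quotient that is a finite p-group can itself serve as the target \<open>K\<close>;
  then \<open>h\<close> generates the kernel of a homomorphism to \<open>K\<close>, and
  \<open>lam_kernel_generator\<close> applies.\<close>

lemma quot_infinite:
  assumes h: "h \<in> carrier H" "fin_ab_p_group p (quot_elem p H h)"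
  shows "lam h \<noteq> \<zero>\<^bsub>R\<^esub>"
proof -
  let ?A = "quot_elem p H h"
  interpret A: comm_group ?A by (rule fin_ab_p_groupD(1)[OF h(2)])
  obtain l where l: "order ?A = p ^ l" using fin_ab_p_groupD(4)[OF h(2)] by blast
  interpret T: padic_ext_target p H G i q k ?A l
    by unfold_locales (use fin_ab_p_groupD(3)[OF h(2)] l in auto)
  obtain \<pi> where "\<pi> \<in> Sur (add_monoid H) ?A" "kernel (add_monoid H) ?A \<pi> = cyc h"
    using quot_epi_iff[OF h(1) A.is_group] iso_refl by blast
  then show ?thesis using T.lam_kernel_generator[of \<pi> h] h(1) by (auto simp: Sur_def epi_def)
qed

end

section \<open>The class of the quotient as a function of the element\<close>

context padic_ext
begin

lemma cyc_subset: "h \<in> carrier H \<Longrightarrow> cyc h \<subseteq> carrier H"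
  unfolding cyc_def by auto

lemma cyc_mono: "h \<in> carrier H \<Longrightarrow> x \<in> cyc h \<Longrightarrow> cyc x \<subseteq> cyc h"
  using cyc_smult by (auto simp: cyc_def[of x])

lemma cyc_smult_unit:
  assumes "v \<in> carrier H" "a \<in> carrier R" "b \<in> carrier R" "a \<otimes>\<^bsub>R\<^esub> b = \<one>\<^bsub>R\<^esub>"
  shows "cyc (a \<odot>\<^bsub>H\<^esub> v) = cyc v"
proof
  have av: "a \<odot>\<^bsub>H\<^esub> v \<in> carrier H" using assms by simp
  show "cyc (a \<odot>\<^bsub>H\<^esub> v) \<subseteq> cyc v" by (rule cyc_mono[OF assms(1) cyc_smult[OF assms(1) cyc_refl[OF assms(1)] assms(2)]])
  have "b \<odot>\<^bsub>H\<^esub> (a \<odot>\<^bsub>H\<^esub> v) = (b \<otimes>\<^bsub>R\<^esub> a) \<odot>\<^bsub>H\<^esub> v" using assms by (simp add: H.smult_assoc1)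
  also have "\<dots> = v" using assms by (simp add: R.m_comm)
  finally have "v \<in> cyc (a \<odot>\<^bsub>H\<^esub> v)" using cyc_smult[OF av cyc_refl[OF av] assms(3)] by simp
  then show "cyc v \<subseteq> cyc (a \<odot>\<^bsub>H\<^esub> v)" by (rule cyc_mono[OF av])
qed

lemma cyc_lam_zero: "h \<in> carrier H \<Longrightarrow> x \<in> cyc h \<Longrightarrow> lam h = \<zero>\<^bsub>R\<^esub> \<Longrightarrow> lam x = \<zero>\<^bsub>R\<^esub>"
  by (auto simp: cyc_def lam_smult)

text \<open>For \<open>z\<close> divisible by \<open>p^(c+1)\<close> the element \<open>i z\<close>
  has the form \<open>p b h\<close>, so \<open>h\<close> is multiplied by the unit
  \<open>1 + p b\<close>. The one level more than in \<open>cyc_open\<close> supplies the factor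
  \<open>p\<close> that makes this a unit.\<close>

lemma cyc_neighbourhood:
  assumes h: "h \<in> carrier H" "lam h \<noteq> \<zero>\<^bsub>R\<^esub>"
  shows "\<exists>n. \<forall>z\<in>carrier R. z n = 0 \<longrightarrow> cyc (h \<oplus>\<^bsub>H\<^esub> i z) = cyc h"
proof -
  obtain c where c: "\<forall>z\<in>carrier R. i (zint (int p ^ c) \<otimes>\<^bsub>R\<^esub> z) \<in> cyc h" using cyc_open[OF h] by blast
  have "cyc (h \<oplus>\<^bsub>H\<^esub> i z) = cyc h" if z: "z \<in> carrier R" "z (Suc c) = 0" for z
  proof -
    obtain w where w: "w \<in> carrier R" "z = zint (int p ^ Suc c) \<otimes>\<^bsub>R\<^esub> w" using Zp_divide[OF z] by blast
    have zz: "z = zint (int p) \<otimes>\<^bsub>R\<^esub> (zint (int p ^ c) \<otimes>\<^bsub>R\<^esub> w)" using w by (simp add: zint_mult R.m_assoc)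
    have "i (zint (int p ^ c) \<otimes>\<^bsub>R\<^esub> w) \<in> cyc h" using c w(1) by blast
    then obtain b where b: "b \<in> carrier R" "i (zint (int p ^ c) \<otimes>\<^bsub>R\<^esub> w) = b \<odot>\<^bsub>H\<^esub> h" unfolding cyc_def by blast
    have "i z = zint (int p) \<odot>\<^bsub>H\<^esub> i (zint (int p ^ c) \<otimes>\<^bsub>R\<^esub> w)"
      unfolding zz by (rule i_mult) (use w in auto)
    then have iz: "i z = (zint (int p) \<otimes>\<^bsub>R\<^esub> b) \<odot>\<^bsub>H\<^esub> h" using b h(1) by (simp add: H.smult_assoc1)
    let ?u = "\<one>\<^bsub>R\<^esub> \<oplus>\<^bsub>R\<^esub> (zint (int p) \<otimes>\<^bsub>R\<^esub> b)"
    have u: "?u \<in> carrier R" using b by simp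
    have "?u 1 = 1" using p_gt_1 by (simp add: Zp_simps zint_def)
    then obtain y where y: "y \<in> carrier R" "?u \<otimes>\<^bsub>R\<^esub> y = \<one>\<^bsub>R\<^esub>" using Zp_unit[OF u] by auto
    have "h \<oplus>\<^bsub>H\<^esub> i z = ?u \<odot>\<^bsub>H\<^esub> h" unfolding iz using b h(1) by (simp add: H.smult_l_distr)
    then show ?thesis using cyc_smult_unit[OF h(1) u y] by simp
  qed
  then show ?thesis by blast
qed

text \<open>Off the torsion \<open>cyc\<close> is locally constant, so an arbitrary property
  \<open>Q\<close> of it cuts out an open set.\<close>

lemma nontorsion_cyc_measurable: "{h \<in> carrier H. lam h \<noteq> \<zero>\<^bsub>R\<^esub> \<and> Q (cyc h)} \<in> sets (haar p H)"
proof (rule open_measurable)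
  fix x assume x: "x \<in> {h \<in> carrier H. lam h \<noteq> \<zero>\<^bsub>R\<^esub> \<and> Q (cyc h)}"
  then obtain n where n: "\<forall>z\<in>carrier R. z n = 0 \<longrightarrow> cyc (x \<oplus>\<^bsub>H\<^esub> i z) = cyc x" using cyc_neighbourhood by blast
  have "x \<oplus>\<^bsub>H\<^esub> i z \<in> {h \<in> carrier H. lam h \<noteq> \<zero>\<^bsub>R\<^esub> \<and> Q (cyc h)}" if z: "z \<in> carrier R" "z n = 0" for z
  proof -
    have e: "cyc (x \<oplus>\<^bsub>H\<^esub> i z) = cyc x" using n z by blast
    have c: "x \<oplus>\<^bsub>H\<^esub> i z \<in> carrier H" using x z by simp
    have "x \<in> cyc (x \<oplus>\<^bsub>H\<^esub> i z)" using x cyc_refl e by simp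
    then have "lam (x \<oplus>\<^bsub>H\<^esub> i z) \<noteq> \<zero>\<^bsub>R\<^esub>" using cyc_lam_zero[OF c] x by blast
    then show ?thesis using c e x by simp
  qed
  then show "\<exists>n. \<forall>z\<in>carrier R. z n = 0 \<longrightarrow> x \<oplus>\<^bsub>H\<^esub> i z \<in> {h \<in> carrier H. lam h \<noteq> \<zero>\<^bsub>R\<^esub> \<and> Q (cyc h)}" by blast
qed auto

definition cls where "cls h = class0 p (quot_elem p H h)"

lemma cls_nontorsion:
  assumes "h \<in> carrier H" "lam h \<noteq> \<zero>\<^bsub>R\<^esub>"
  shows "cls h \<in> X0 p" "quot_elem p H h \<cong> rep (cls h)"
  using class0_in_X0[OF quot_finite[OF assms]] by (auto simp: cls_def)

lemma cls_torsion:
  assumes "h \<in> carrier H" "lam h = \<zero>\<^bsub>R\<^esub>"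
  shows "cls h = {}"
proof (rule ccontr)
  assume "cls h \<noteq> {}"
  then obtain K :: "nat monoid" where K: "fin_ab_p_group p K" "K \<cong> quot_elem p H h" by (auto simp: cls_def class0_def)
  have "fin_ab_p_group p (quot_elem p H h)" by (rule fin_ab_p_group_iso[OF K(1) group_quot[OF assms(1)] K(2)])
  then show False using quot_infinite assms by blast
qed

lemma X0_nonempty: "c \<in> X0 p \<Longrightarrow> c \<noteq> {}"
  using X0_rep[of c p] iso_refl by (auto simp: class0_def)

lemma cls_eq_iff:
  assumes "h \<in> carrier H" "c \<in> X0 p"
  shows "cls h = c \<longleftrightarrow> quot_elem p H h \<cong> rep c"
  using class0_eq_iff[OF X0_rep(1)[OF assms(2)] group_quot[OF assms(1)]] X0_rep(2)[OF assms(2)] by (simp add: cls_def)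

text \<open>All of the torsion goes to the single value \<open>{}\<close>; elsewhere the class
  depends only on the locally constant \<open>cyc\<close>.\<close>

lemma cls_measurable: "cls \<in> measurable (haar p H) (count_space UNIV)"
proof (rule measurableI)
  fix A :: "nat monoid set set"
  let ?Q = "\<lambda>N. class0 p (add_monoid H Mod N) \<in> A"
  have cls: "cls h = class0 p (add_monoid H Mod cyc h)" for h by (simp add: cls_def quot_elem_eq)
  have "cls -` A \<inter> space (haar p H) = {h \<in> carrier H. lam h \<noteq> \<zero>\<^bsub>R\<^esub> \<and> ?Q (cyc h)} \<union> (if {} \<in> A then torsion else {})"
    using cls_torsion cls by (auto simp: haar_facts(1) torsion_def)
  then show "cls -` A \<inter> space (haar p H) \<in> sets (haar p H)"
    using nontorsion_cyc_measurable[of ?Q] torsion_null(1) by (cases "{} \<in> A") (simp_all add: sets.Un)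
qed simp

lemma cyc_measurable:
  assumes "v \<in> carrier H" "lam v \<noteq> \<zero>\<^bsub>R\<^esub>"
  shows "cyc v \<in> sets (haar p H)"
proof (rule open_measurable)
  obtain c where c: "\<forall>z\<in>carrier R. i (zint (int p ^ c) \<otimes>\<^bsub>R\<^esub> z) \<in> cyc v" using cyc_open[OF assms] by blast
  fix x assume x: "x \<in> cyc v"
  have "x \<oplus>\<^bsub>H\<^esub> i z \<in> cyc v" if z: "z \<in> carrier R" "z c = 0" for z
  proof -
    obtain w where "w \<in> carrier R" "z = zint (int p ^ c) \<otimes>\<^bsub>R\<^esub> w" using Zp_divide[OF z] by blast
    then have "i z \<in> cyc v" using c by blast
    then show ?thesis using subgroup.m_closed[OF subgroup_cyc[OF assms(1)] x] by simp
  qed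
  then show "\<exists>n. \<forall>z\<in>carrier R. z n = 0 \<longrightarrow> x \<oplus>\<^bsub>H\<^esub> i z \<in> cyc v" by blast
qed (rule cyc_subset[OF assms(1)])

text \<open>\<open>cyc v\<close> is a copy of \<open>Z_p\<close> in which the generators correspond
  to the units, that is, to the complement of \<open>p Z_p\<close>; the latter is one of
  \<open>p\<close> disjoint translates that make up the whole.\<close>

lemma generators_measure:
  assumes v: "v \<in> carrier H" "lam v \<noteq> \<zero>\<^bsub>R\<^esub>"
  shows "measure (haar p H) {x \<in> carrier H. cyc x = cyc v} = (1 - 1 / real p) * measure (haar p H) (cyc v)"
proof -
  let ?v = "zint (int p) \<odot>\<^bsub>H\<^esub> v"
  have pv: "?v \<in> carrier H" using v by simp
  have "zint (int p) \<noteq> \<zero>\<^bsub>R\<^esub>" using p_gt_1 by (simp add: zint_eq_0)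
  then have lpv: "lam ?v \<noteq> \<zero>\<^bsub>R\<^esub>" using v Zp_integral[of "zint (int p)" "lam v"] by (auto simp: lam_smult)
  have mem_pv: "a 1 = 0" if a: "a \<in> carrier R" "a \<odot>\<^bsub>H\<^esub> v \<in> cyc ?v" for a
  proof -
    obtain b where b: "b \<in> carrier R" "a \<odot>\<^bsub>H\<^esub> v = b \<odot>\<^bsub>H\<^esub> ?v" using a(2) unfolding cyc_def by blast
    have "a \<otimes>\<^bsub>R\<^esub> lam v = (b \<otimes>\<^bsub>R\<^esub> zint (int p)) \<otimes>\<^bsub>R\<^esub> lam v"
      using arg_cong[OF b(2), of lam] a(1) b(1) v(1) by (simp add: lam_smult R.m_assoc)
    then have "lam v \<otimes>\<^bsub>R\<^esub> (a \<oplus>\<^bsub>R\<^esub> \<ominus>\<^bsub>R\<^esub> (b \<otimes>\<^bsub>R\<^esub> zint (int p))) = \<zero>\<^bsub>R\<^esub>"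
      using a(1) b(1) v(1) by (simp add: R.r_distr R.r_minus R.m_comm[of "lam v"] R.r_neg)
    then have "a \<oplus>\<^bsub>R\<^esub> \<ominus>\<^bsub>R\<^esub> (b \<otimes>\<^bsub>R\<^esub> zint (int p)) = \<zero>\<^bsub>R\<^esub>"
      using Zp_integral[of "lam v" "a \<oplus>\<^bsub>R\<^esub> \<ominus>\<^bsub>R\<^esub> (b \<otimes>\<^bsub>R\<^esub> zint (int p))"] v a(1) b(1) by simp
    then have "a = b \<otimes>\<^bsub>R\<^esub> zint (int p)" using a(1) b(1) R.minus_equality[of a "\<ominus>\<^bsub>R\<^esub> (b \<otimes>\<^bsub>R\<^esub> zint (int p))"] by simp
    then show "a 1 = 0" by (simp add: Zp_simps zint_def)
  qed
  have mem_cv: "a \<odot>\<^bsub>H\<^esub> v \<in> translate (zint (a 1) \<odot>\<^bsub>H\<^esub> v) (cyc ?v)" if a: "a \<in> carrier R" for a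
  proof -
    obtain w where w: "w \<in> carrier R" "a = zint (a 1) \<oplus>\<^bsub>R\<^esub> (zint (int p ^ 1) \<otimes>\<^bsub>R\<^esub> w)" using Zp_split[OF a] .
    have "a \<odot>\<^bsub>H\<^esub> v = (zint (a 1) \<oplus>\<^bsub>R\<^esub> (zint (int p) \<otimes>\<^bsub>R\<^esub> w)) \<odot>\<^bsub>H\<^esub> v" using arg_cong[OF w(2), of "\<lambda>a. a \<odot>\<^bsub>H\<^esub> v"] by simp
    also have "\<dots> = zint (a 1) \<odot>\<^bsub>H\<^esub> v \<oplus>\<^bsub>H\<^esub> w \<odot>\<^bsub>H\<^esub> ?v"
      using w(1) v(1) by (simp add: H.smult_l_distr H.smult_assoc1[symmetric] R.m_comm)
    finally show ?thesis using w(1) unfolding translate_def cyc_def by blast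
  qed
  let ?T = "\<lambda>c. translate (zint (int c) \<odot>\<^bsub>H\<^esub> v) (cyc ?v)"
  have T: "\<exists>a. a \<in> carrier R \<and> a 1 = int c \<and> x = a \<odot>\<^bsub>H\<^esub> v" if c: "c < p" and x: "x \<in> ?T c" for c x
  proof -
    obtain b where b: "b \<in> carrier R" "x = zint (int c) \<odot>\<^bsub>H\<^esub> v \<oplus>\<^bsub>H\<^esub> b \<odot>\<^bsub>H\<^esub> ?v" using x unfolding translate_def cyc_def by blast
    let ?a = "zint (int c) \<oplus>\<^bsub>R\<^esub> (b \<otimes>\<^bsub>R\<^esub> zint (int p))"
    have "x = ?a \<odot>\<^bsub>H\<^esub> v" using b v(1) by (simp add: H.smult_l_distr H.smult_assoc1)
    moreover have "?a 1 = int c" using c by (simp add: Zp_simps zint_def)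
    ultimately show ?thesis using b(1) by (intro exI[of _ ?a]) simp
  qed
  \<comment> \<open>The scalar is determined by the multiple of \<open>v\<close>, since
    \<open>lam v\<close> is not zero; so its residue modulo \<open>p\<close> separates the
    translates.\<close>
  have uniq: "a 1 = b 1" if ab: "a \<in> carrier R" "b \<in> carrier R" "a \<odot>\<^bsub>H\<^esub> v = b \<odot>\<^bsub>H\<^esub> v" for a b
  proof -
    have "lam v \<otimes>\<^bsub>R\<^esub> (a \<oplus>\<^bsub>R\<^esub> \<ominus>\<^bsub>R\<^esub> b) = \<zero>\<^bsub>R\<^esub>"
      using arg_cong[OF ab(3), of lam] ab(1,2) v(1) by (simp add: lam_smult R.r_distr R.r_minus R.m_comm[of "lam v"] R.r_neg)
    then have "a \<oplus>\<^bsub>R\<^esub> \<ominus>\<^bsub>R\<^esub> b = \<zero>\<^bsub>R\<^esub>" using Zp_integral[of "lam v" "a \<oplus>\<^bsub>R\<^esub> \<ominus>\<^bsub>R\<^esub> b"] v ab by simp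
    then have "a = b" using ab R.minus_equality[of a "\<ominus>\<^bsub>R\<^esub> b"] by simp
    then show ?thesis by simp
  qed
  have cup: "cyc v = (\<Union>c\<in>{..<p}. ?T c)"
  proof (intro equalityI subsetI)
    fix x assume "x \<in> cyc v"
    then obtain a where a: "a \<in> carrier R" "x = a \<odot>\<^bsub>H\<^esub> v" unfolding cyc_def by blast
    have "nat (a 1) < p" "int (nat (a 1)) = a 1" using ZpD(1,2)[OF a(1), of 1] by auto
    then show "x \<in> (\<Union>c\<in>{..<p}. ?T c)" using mem_cv[OF a(1)] a(2) by (intro UN_I[of "nat (a 1)"]) simp_all
  next
    fix x assume "x \<in> (\<Union>c\<in>{..<p}. ?T c)"
    then obtain c where "c < p" "x \<in> ?T c" by blast
    from T[OF this] show "x \<in> cyc v" unfolding cyc_def by blast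
  qed
  have pm: "cyc ?v \<in> sets (haar p H)" by (rule cyc_measurable[OF pv lpv])
  have disj: "disjoint_family_on ?T {..<p}"
    unfolding disjoint_family_on_def
  proof (intro ballI impI)
    fix c d assume cd: "c \<in> {..<p}" "d \<in> {..<p}" "c \<noteq> d"
    have False if x: "x \<in> ?T c" "x \<in> ?T d" for x
    proof -
      obtain a where a: "a \<in> carrier R" "a 1 = int c" "x = a \<odot>\<^bsub>H\<^esub> v" using T[of c x] cd(1) x(1) by auto
      obtain b where b: "b \<in> carrier R" "b 1 = int d" "x = b \<odot>\<^bsub>H\<^esub> v" using T[of d x] cd(2) x(2) by auto
      show False using uniq[OF a(1) b(1)] a b cd(3) by simp
    qed
    then show "?T c \<inter> ?T d = {}" by blast
  qed
  have "measure (haar p H) (cyc v) = (\<Sum>c<p. measure (haar p H) (?T c))"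
    unfolding cup by (rule haar.finite_measure_finite_Union) (use haar_translate(1)[OF pm] disj v(1) in auto)
  also have "\<dots> = real p * measure (haar p H) (cyc ?v)" using haar_translate(2)[OF pm] v(1) by simp
  finally have m: "measure (haar p H) (cyc v) = real p * measure (haar p H) (cyc ?v)" .
  have sub: "cyc ?v \<subseteq> cyc v" by (rule cyc_mono[OF v(1) cyc_smult[OF v(1) cyc_refl[OF v(1)] zint_closed]])
  have "{x \<in> carrier H. cyc x = cyc v} = cyc v - cyc ?v"
  proof (intro equalityI subsetI)
    fix x assume x: "x \<in> {x \<in> carrier H. cyc x = cyc v}"
    then have xv: "x \<in> cyc v" using cyc_refl by blast
    have "x \<notin> cyc ?v"
    proof
      assume "x \<in> cyc ?v"
      then have "cyc v \<subseteq> cyc ?v" using cyc_mono[OF pv] x by blast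
      then have "\<one>\<^bsub>R\<^esub> \<odot>\<^bsub>H\<^esub> v \<in> cyc ?v" using cyc_refl[OF v(1)] v(1) by auto
      then have "\<one>\<^bsub>R\<^esub> 1 = 0" using mem_pv[OF R.one_closed] by blast
      then show False using p_gt_1 by (simp add: Zp_simps)
    qed
    then show "x \<in> cyc v - cyc ?v" using xv by blast
  next
    fix x assume x: "x \<in> cyc v - cyc ?v"
    then obtain a where a: "a \<in> carrier R" "x = a \<odot>\<^bsub>H\<^esub> v" unfolding cyc_def by blast
    have "a 1 \<noteq> 0"
    proof
      assume "a 1 = 0"
      then have "x \<in> translate (zint 0 \<odot>\<^bsub>H\<^esub> v) (cyc ?v)" using mem_cv[OF a(1)] a(2) by simp
      then have "x \<in> cyc ?v" using v(1) cyc_subset[OF pv] by (auto simp: translate_def zint_0)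
      then show False using x by blast
    qed
    then obtain b where "b \<in> carrier R" "a \<otimes>\<^bsub>R\<^esub> b = \<one>\<^bsub>R\<^esub>" using Zp_unit[OF a(1)] by blast
    then have "cyc x = cyc v" using cyc_smult_unit[OF v(1) a(1)] a(2) by blast
    then show "x \<in> {x \<in> carrier H. cyc x = cyc v}" using a v(1) by simp
  qed
  then have "measure (haar p H) {x \<in> carrier H. cyc x = cyc v} = measure (haar p H) (cyc v) - measure (haar p H) (cyc ?v)"
    using haar.finite_measure_Diff[OF cyc_measurable[OF v] pm sub] by simp
  moreover have "(1 - 1 / real p) * (real p * M) = real p * M - M" for M
    using p_gt_1 by (simp add: left_diff_distrib)
  ultimately show ?thesis unfolding m by simp
qed

end

section \<open>Sums over classes as Haar integrals\<close>

context padic_ext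
begin

text \<open>Each class in \<open>X0\<close> that occurs is the class of a non-torsion element and
  stays constant on a small cell around it, and there are countably many cells.\<close>

lemma countable_classes: "countable (cls ` carrier H \<inter> X0 p)"
proof (rule countable_subset)
  show "cls ` carrier H \<inter> X0 p \<subseteq> (\<lambda>C. cls (SOME y. y \<in> C)) ` cells"
  proof
    fix c assume c: "c \<in> cls ` carrier H \<inter> X0 p"
    then obtain h where h: "h \<in> carrier H" "c = cls h" by blast
    have l: "lam h \<noteq> \<zero>\<^bsub>R\<^esub>" using cls_torsion[OF h(1)] h(2) X0_nonempty c by blast
    obtain n where n: "\<forall>z\<in>carrier R. z n = 0 \<longrightarrow> cyc (h \<oplus>\<^bsub>H\<^esub> i z) = cyc h" using cyc_neighbourhood[OF h(1) l] by blast
    let ?C = "cell n (q h) (lam h (n + k))"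
    define y where "y = (SOME y. y \<in> ?C)"
    have y: "y \<in> ?C" unfolding y_def by (rule someI[of _ h]) (rule cell_refl[OF h(1)])
    obtain z where z: "z \<in> carrier R" "z n = 0" "y = h \<oplus>\<^bsub>H\<^esub> i z" using mem_cellE[OF y h(1)] .
    have "cls y = cls h" using n z by (simp add: cls_def quot_elem_eq)
    then have "c = cls (SOME y. y \<in> ?C)" using h(2) by (simp add: y_def)
    moreover have "?C \<in> cells" using h(1) by (intro cellI) simp
    ultimately show "c \<in> (\<lambda>C. cls (SOME y. y \<in> C)) ` cells" by blast
  qed
qed (intro countable_image countable_cells)

lemma class_measurable: "{h \<in> carrier H. cls h = c} \<in> sets (haar p H)"
proof -
  have "cls -` {c} \<inter> space (haar p H) \<in> sets (haar p H)" using cls_measurable by (rule measurable_sets) simp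
  moreover have "cls -` {c} \<inter> space (haar p H) = {h \<in> carrier H. cls h = c}" by (auto simp: haar_facts(1))
  ultimately show ?thesis by simp
qed

text \<open>Classes that do not occur contribute nothing. Without them the sum is countable and may
  be exchanged with the Haar integral; the indicator removes the torsion, whose value
  \<open>{}\<close> is not a class.\<close>

lemma sum_classes:
  fixes f :: "nat monoid set \<Rightarrow> ennreal"
  shows "(\<integral>\<^sup>+ c. f c * emeasure (haar p H) {h \<in> carrier H. cls h = c} \<partial>count_space (X0 p)) =
    (\<integral>\<^sup>+ h. f (cls h) * indicator (carrier H - torsion) h \<partial>haar p H)"
proof -
  let ?A = "cls ` carrier H \<inter> X0 p" and ?E = "\<lambda>c. {h \<in> carrier H. cls h = c}"
  have "(\<integral>\<^sup>+ c. f c * emeasure (haar p H) (?E c) \<partial>count_space (X0 p)) = (\<integral>\<^sup>+ c. f c * emeasure (haar p H) (?E c) \<partial>count_space ?A)"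
  proof (rule nn_integral_count_space_eq)
    fix c assume "c \<in> X0 p - ?A"
    then have e: "?E c = {}" by blast
    show "f c * emeasure (haar p H) (?E c) = 0" unfolding e by simp
  qed blast
  also have "\<dots> = (\<integral>\<^sup>+ c. (\<integral>\<^sup>+ h. f c * indicator (?E c) h \<partial>haar p H) \<partial>count_space ?A)"
    by (rule nn_integral_cong) (simp add: nn_integral_cmult_indicator class_measurable)
  also have "\<dots> = (\<integral>\<^sup>+ h. (\<integral>\<^sup>+ c. f c * indicator (?E c) h \<partial>count_space ?A) \<partial>haar p H)"
    by (rule nn_integral_count_space_nn_integral[OF countable_classes, symmetric])
       (intro borel_measurable_times_ennreal borel_measurable_const borel_measurable_indicator class_measurable)
  also have "\<dots> = (\<integral>\<^sup>+ h. f (cls h) * indicator (carrier H - torsion) h \<partial>haar p H)"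
  proof (rule nn_integral_cong)
    fix h assume "h \<in> space (haar p H)"
    then have h: "h \<in> carrier H" by (simp add: haar_facts(1))
    show "(\<integral>\<^sup>+ c. f c * indicator (?E c) h \<partial>count_space ?A) = f (cls h) * indicator (carrier H - torsion) h"
    proof (cases "lam h = \<zero>\<^bsub>R\<^esub>")
      case True
      then have "cls h = {}" by (rule cls_torsion[OF h])
      then have "c \<noteq> cls h" if "c \<in> ?A" for c using X0_nonempty that by blast
      then have "(\<integral>\<^sup>+ c. f c * indicator (?E c) h \<partial>count_space ?A) = (\<integral>\<^sup>+ c. 0 \<partial>count_space ?A)"
        by (intro nn_integral_cong) (auto simp: indicator_def)
      then show ?thesis using True h by (simp add: torsion_def)
    next
      case False
      have mem: "cls h \<in> ?A" using cls_nontorsion(1)[OF h False] h by blast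
      have "(\<integral>\<^sup>+ c. f c * indicator (?E c) h \<partial>count_space ?A) = (\<integral>\<^sup>+ c. f (cls h) * indicator {cls h} c \<partial>count_space ?A)"
        by (rule nn_integral_cong) (use h in \<open>auto simp: indicator_def\<close>)
      also have "\<dots> = f (cls h) * emeasure (count_space ?A) {cls h}" by (rule nn_integral_cmult_indicator) (use mem in simp)
      also have "\<dots> = f (cls h)" using mem by simp
      finally show ?thesis using False h by (simp add: torsion_def)
    qed
  qed
  finally show ?thesis .
qed

end

section \<open>Surjections from an extension onto a fixed finite group\<close>

context padic_ext_target
begin

lemma Sur_eq_homs: "Sur (add_monoid H) K = {\<psi> \<in> homs. \<psi> ` carrier H = carrier K}"
  by (auto simp: Sur_def epi_def homs_def)

text \<open>The fibres over the elements of \<open>K\<close> are translates of the kernel and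
  partition \<open>H\<close>.\<close>

lemma kernel_measure:
  assumes \<psi>: "\<psi> \<in> Sur (add_monoid H) K"
  shows "kernel (add_monoid H) K \<psi> \<in> sets (haar p H)" "measure (haar p H) (kernel (add_monoid H) K \<psi>) = 1 / real (card (carrier K))"
proof -
  have hom: "\<psi> \<in> hom (add_monoid H) K" and surj: "\<psi> ` carrier H = carrier K" using \<psi> by (auto simp: Sur_def epi_def)
  note ps = psi_add[OF hom] psi_closed[OF hom] psi_zero[OF hom] psi_minus[OF hom]
  let ?N = "kernel (add_monoid H) K \<psi>"
  have N: "?N = {x \<in> carrier H. \<psi> x = \<one>\<^bsub>K\<^esub>}" by (simp add: kernel_def)
  show meas: "?N \<in> sets (haar p H)"
  proof (rule open_measurable)
    show "?N \<subseteq> carrier H" unfolding N by blast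
    fix x assume x: "x \<in> ?N"
    have "x \<oplus>\<^bsub>H\<^esub> i z \<in> ?N" if z: "z \<in> carrier R" "z l = 0" for z
    proof -
      have "\<psi> (i z) = \<one>\<^bsub>K\<^esub>" using psi_smult[OF hom i_closed[OF R.one_closed] z(1)] z i_eq_smult[OF z(1)] by simp
      then show ?thesis using x z(1) by (simp add: N ps)
    qed
    then show "\<exists>n. \<forall>z\<in>carrier R. z n = 0 \<longrightarrow> x \<oplus>\<^bsub>H\<^esub> i z \<in> ?N" by blast
  qed
  define t where "t f = (SOME h. h \<in> carrier H \<and> \<psi> h = f)" for f
  have t: "t f \<in> carrier H \<and> \<psi> (t f) = f" if "f \<in> carrier K" for f
  proof -
    have "\<exists>h. h \<in> carrier H \<and> \<psi> h = f" using that surj by (metis imageE)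
    then show ?thesis unfolding t_def by (rule someI_ex)
  qed
  have fib: "translate (t f) ?N = {x \<in> carrier H. \<psi> x = f}" if f: "f \<in> carrier K" for f
  proof -
    have tf: "t f \<in> carrier H" "\<psi> (t f) = f" using t[OF f] by auto
    have "\<psi> (\<ominus>\<^bsub>H\<^esub> t f \<oplus>\<^bsub>H\<^esub> x) = \<one>\<^bsub>K\<^esub> \<longleftrightarrow> \<psi> x = f" if x: "x \<in> carrier H" for x
    proof -
      have "\<psi> (\<ominus>\<^bsub>H\<^esub> t f \<oplus>\<^bsub>H\<^esub> x) = inv\<^bsub>K\<^esub> f \<otimes>\<^bsub>K\<^esub> \<psi> x" using x tf by (simp add: ps)
      moreover have "inv\<^bsub>K\<^esub> f \<otimes>\<^bsub>K\<^esub> \<psi> x = \<one>\<^bsub>K\<^esub> \<longleftrightarrow> \<psi> x = f"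
        using f ps(2)[OF x] K.inv_solve_left[of "\<one>\<^bsub>K\<^esub>" f "\<psi> x"] by auto
      ultimately show ?thesis by simp
    qed
    then show ?thesis using translate_eq[OF tf(1), of ?N] tf(1) by (auto simp: N)
  qed
  have "1 = measure (haar p H) (\<Union>f\<in>carrier K. translate (t f) ?N)"
  proof -
    have "(\<Union>f\<in>carrier K. translate (t f) ?N) = carrier H" using fib ps(2) by auto
    then show ?thesis using haar_facts(3) by (simp add: measure_def)
  qed
  also have "\<dots> = (\<Sum>f\<in>carrier K. measure (haar p H) (translate (t f) ?N))"
  proof (rule haar.finite_measure_finite_Union[OF finK])
    show "disjoint_family_on (\<lambda>f. translate (t f) ?N) (carrier K)" unfolding disjoint_family_on_def using fib by auto
    show "(\<lambda>f. translate (t f) ?N) ` carrier K \<subseteq> haar.events" using haar_translate(1)[OF meas] t by auto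
  qed
  also have "\<dots> = real (card (carrier K)) * measure (haar p H) ?N" using haar_translate(2)[OF meas] t by simp
  finally have e: "1 = real (card (carrier K)) * measure (haar p H) ?N" .
  then have "card (carrier K) \<noteq> 0" by (metis mult_zero_left of_nat_0 zero_neq_one)
  then show "measure (haar p H) ?N = 1 / real (card (carrier K))" using e by (simp add: field_simps)
qed

lemma finite_Sur: "finite (Sur (add_monoid H) K)"
  unfolding Sur_eq_homs using finite_homs by simp

definition SurC where "SurC = {\<psi> \<in> Sur (add_monoid H) K. \<exists>v\<in>carrier H. kernel (add_monoid H) K \<psi> = cyc v}"

text \<open>These surjections are \<pi> followed by an automorphism of \<open>K\<close>; since
  \<open>K\<close> is finite, a kernel that contains the kernel of \<pi> already equals it.\<close>

lemma card_same_kernel: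
  assumes \<pi>: "\<pi> \<in> Sur (add_monoid H) K"
  shows "card {\<psi> \<in> Sur (add_monoid H) K. kernel (add_monoid H) K \<psi> = kernel (add_monoid H) K \<pi>} = card (auto K)"
proof -
  have hom: "\<pi> \<in> hom (add_monoid H) K" and surj: "\<pi> ` carrier H = carrier K" using \<pi> by (auto simp: Sur_def epi_def)
  have epi: "\<pi> \<in> epi (add_monoid H) K" using \<pi> by (simp add: Sur_def)
  have b: "bij_betw (\<lambda>\<sigma>. restrict (\<sigma> \<circ> \<pi>) (carrier (add_monoid H))) (Sur K K)
     {\<psi> \<in> Sur (add_monoid H) K. kernel (add_monoid H) K \<pi> \<subseteq> kernel (add_monoid H) K \<psi>}"
    by (rule Sur_factor[OF H.M.a_group K.is_group K.is_group epi])
  have "kernel (add_monoid H) K \<psi> = kernel (add_monoid H) K \<pi>"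
    if "\<psi> \<in> Sur (add_monoid H) K" "kernel (add_monoid H) K \<pi> \<subseteq> kernel (add_monoid H) K \<psi>" for \<psi>
  proof -
    have "\<psi> \<in> {\<psi> \<in> Sur (add_monoid H) K. kernel (add_monoid H) K \<pi> \<subseteq> kernel (add_monoid H) K \<psi>}" using that by blast
    then obtain \<sigma> where \<sigma>: "\<sigma> \<in> Sur K K" "\<psi> = restrict (\<sigma> \<circ> \<pi>) (carrier (add_monoid H))"
      using b unfolding bij_betw_def by blast
    have sh: "\<sigma> \<in> hom K K" "\<sigma> ` carrier K = carrier K" using \<sigma>(1) by (auto simp: Sur_def epi_def)
    interpret \<sigma>: group_hom K K \<sigma> using sh(1) by unfold_locales
    have inj: "inj_on \<sigma> (carrier K)" using sh(2) finK by (simp add: eq_card_imp_inj_on)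
    have "\<sigma> (\<pi> x) = \<one>\<^bsub>K\<^esub> \<longleftrightarrow> \<pi> x = \<one>\<^bsub>K\<^esub>" if "x \<in> carrier H" for x
      using inj_on_eq_iff[OF inj psi_closed[OF hom that] K.one_closed] by simp
    then show ?thesis using \<sigma>(2) by (auto simp: kernel_def)
  qed
  then have "{\<psi> \<in> Sur (add_monoid H) K. kernel (add_monoid H) K \<psi> = kernel (add_monoid H) K \<pi>} =
    {\<psi> \<in> Sur (add_monoid H) K. kernel (add_monoid H) K \<pi> \<subseteq> kernel (add_monoid H) K \<psi>}" by blast
  then show ?thesis using bij_betw_same_card[OF b] auto_eq_Sur[OF finK] by simp
qed

text \<open>The quotient is \<open>K\<close> exactly when \<open>cyc h\<close> is one of the cyclic
  kernels. Distinct kernels have disjoint sets of generators, each of measure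
  \<open>(1 - 1/p) / |K|\<close>, and each kernel belongs to \<open>|Aut K|\<close> members of
  \<open>SurC\<close>.\<close>

lemma quotient_probability:
  "real (card (auto K)) * measure (haar p H) {h \<in> carrier H. quot_elem p H h \<cong> K} =
   real (card SurC) * ((1 - 1 / real p) / real (card (carrier K)))"
proof -
  let ?ker = "kernel (add_monoid H) K"
  let ?NN = "?ker ` SurC" and ?g = "\<lambda>N. {h \<in> carrier H. cyc h = N}"
  have fin: "finite SurC" unfolding SurC_def using finite_Sur by simp
  have gm: "?g N \<in> sets (haar p H) \<and> measure (haar p H) (?g N) = (1 - 1 / real p) / real (card (carrier K))" if N: "N \<in> ?NN" for N
  proof -
    obtain \<psi>' where \<psi>': "\<psi>' \<in> SurC" "N = ?ker \<psi>'" using N by blast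
    then obtain \<psi> v where \<psi>: "\<psi> \<in> Sur (add_monoid H) K" "v \<in> carrier H" "?ker \<psi> = cyc v" "N = cyc v"
      unfolding SurC_def by blast
    have hom: "\<psi> \<in> hom (add_monoid H) K" using \<psi>(1) by (auto simp: Sur_def epi_def)
    have lv: "lam v \<noteq> \<zero>\<^bsub>R\<^esub>" by (rule lam_kernel_generator[OF hom \<psi>(2,3)])
    have "lam h \<noteq> \<zero>\<^bsub>R\<^esub>" if "h \<in> carrier H" "cyc h = N" for h
      using cyc_lam_zero[OF that(1), of v] cyc_refl[OF \<psi>(2)] lv that(2) \<psi>(4) by blast
    then have "?g N = {h \<in> carrier H. lam h \<noteq> \<zero>\<^bsub>R\<^esub> \<and> cyc h = N}" by blast
    then have "?g N \<in> sets (haar p H)" using nontorsion_cyc_measurable[of "\<lambda>M. M = N"] by simp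
    then show ?thesis using generators_measure[OF \<psi>(2) lv] kernel_measure(2)[OF \<psi>(1)] \<psi>(3,4) by simp
  qed
  have "{h \<in> carrier H. quot_elem p H h \<cong> K} = (\<Union>N\<in>?NN. ?g N)"
    using quot_epi_iff[OF _ K.is_group] by (auto simp: SurC_def) metis
  then have "measure (haar p H) {h \<in> carrier H. quot_elem p H h \<cong> K} = measure (haar p H) (\<Union>N\<in>?NN. ?g N)" by (simp only:)
  also have "\<dots> = (\<Sum>N\<in>?NN. measure (haar p H) (?g N))"
  proof (rule haar.finite_measure_finite_Union)
    show "?g ` ?NN \<subseteq> haar.events" using gm by blast
    show "disjoint_family_on ?g ?NN" unfolding disjoint_family_on_def by blast
  qed (use fin in blast)
  also have "\<dots> = real (card ?NN) * ((1 - 1 / real p) / real (card (carrier K)))" using gm by simp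
  finally have m: "measure (haar p H) {h \<in> carrier H. quot_elem p H h \<cong> K} = real (card ?NN) * ((1 - 1 / real p) / real (card (carrier K)))" .
  have "card SurC = (\<Sum>N\<in>?NN. card {\<psi> \<in> SurC. ?ker \<psi> = N})"
    using fin sum.group[of SurC ?NN ?ker "\<lambda>_. 1::nat"] by simp
  also have "\<dots> = (\<Sum>N\<in>?NN. card (auto K))"
  proof (rule sum.cong[OF refl])
    fix N assume "N \<in> ?NN"
    then obtain \<pi> where \<pi>: "\<pi> \<in> SurC" "N = ?ker \<pi>" by blast
    have "{\<psi> \<in> SurC. ?ker \<psi> = N} = {\<psi> \<in> Sur (add_monoid H) K. ?ker \<psi> = ?ker \<pi>}" using \<pi> by (auto simp: SurC_def)
    then show "card {\<psi> \<in> SurC. ?ker \<psi> = N} = card (auto K)" using card_same_kernel[of \<pi>] \<pi> by (simp add: SurC_def)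
  qed
  finally have "card SurC = card ?NN * card (auto K)" by simp
  then show ?thesis unfolding m by simp
qed

lemma card_Sur_quotient:
  assumes h: "h \<in> carrier H" and B: "group B" "quot_elem p H h \<cong> B"
  shows "card (Sur B K) = card {\<psi> \<in> Sur (add_monoid H) K. h \<in> kernel (add_monoid H) K \<psi>}"
proof -
  obtain \<pi> where \<pi>: "\<pi> \<in> Sur (add_monoid H) B" "kernel (add_monoid H) B \<pi> = cyc h"
    using quot_epi_iff[OF h B(1)] B(2) by blast
  have "\<pi> \<in> epi (add_monoid H) B" using \<pi>(1) by (simp add: Sur_def)
  from bij_betw_same_card[OF Sur_factor[OF H.M.a_group B(1) K.is_group this]]
  have "card (Sur B K) = card {\<psi> \<in> Sur (add_monoid H) K. cyc h \<subseteq> kernel (add_monoid H) K \<psi>}" using \<pi>(2) by simp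
  moreover have "cyc h \<subseteq> kernel (add_monoid H) K \<psi> \<longleftrightarrow> h \<in> kernel (add_monoid H) K \<psi>" if "\<psi> \<in> Sur (add_monoid H) K" for \<psi>
  proof
    have hom: "\<psi> \<in> hom (add_monoid H) K" using that by (auto simp: Sur_def epi_def)
    assume "h \<in> kernel (add_monoid H) K \<psi>"
    then show "cyc h \<subseteq> kernel (add_monoid H) K \<psi>" using psi_smult[OF hom h] h by (auto simp: cyc_def kernel_def)
  qed (use cyc_refl[OF h] in blast)
  ultimately show ?thesis by (metis (mono_tags, lifting) Collect_cong)
qed

text \<open>Surjections from the quotient by \<open>h\<close> are the surjections from
  \<open>H\<close> that kill \<open>h\<close>, so after exchanging sum and integral each surjection
  contributes the measure of its kernel. The torsion is negligible.\<close>

lemma moment_sum: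
  "(\<integral>\<^sup>+ c. ennreal (real (card (Sur (rep c) K))) * emeasure (haar p H) {h \<in> carrier H. cls h = c} \<partial>count_space (X0 p)) =
   ennreal (real (card (Sur (add_monoid H) K)) / real (card (carrier K)))"
proof -
  let ?S = "Sur (add_monoid H) K" and ?ker = "kernel (add_monoid H) K"
  have "(\<integral>\<^sup>+ c. ennreal (real (card (Sur (rep c) K))) * emeasure (haar p H) {h \<in> carrier H. cls h = c} \<partial>count_space (X0 p)) =
    (\<integral>\<^sup>+ h. ennreal (real (card (Sur (rep (cls h)) K))) * indicator (carrier H - torsion) h \<partial>haar p H)"
    by (rule sum_classes)
  also have "\<dots> = (\<integral>\<^sup>+ h. (\<Sum>\<psi>\<in>?S. indicator (?ker \<psi>) h) \<partial>haar p H)"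
  proof (rule nn_integral_cong_AE)
    have "AE h in haar p H. h \<notin> torsion"
      by (rule AE_not_in) (use torsion_null in \<open>simp add: null_sets_def haar.emeasure_eq_measure\<close>)
    then show "AE h in haar p H. ennreal (real (card (Sur (rep (cls h)) K))) * indicator (carrier H - torsion) h = (\<Sum>\<psi>\<in>?S. indicator (?ker \<psi>) h)"
    proof (rule AE_mp[OF _ AE_I2], intro impI)
      fix h assume "h \<in> space (haar p H)" "h \<notin> torsion"
      then have h: "h \<in> carrier H" "lam h \<noteq> \<zero>\<^bsub>R\<^esub>" by (auto simp: haar_facts(1) torsion_def)
      have "card (Sur (rep (cls h)) K) = card {\<psi> \<in> ?S. h \<in> ?ker \<psi>}"
        by (rule card_Sur_quotient[OF h(1) _ cls_nontorsion(2)[OF h]]) (rule fin_ab_p_groupD(2)[OF X0_rep(1)[OF cls_nontorsion(1)[OF h]]])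
      moreover have "(\<Sum>\<psi>\<in>?S. indicator (?ker \<psi>) h :: ennreal) = of_nat (card {\<psi> \<in> ?S. h \<in> ?ker \<psi>})"
        using finite_Sur by (simp add: indicator_def sum.If_cases Int_def)
      ultimately show "ennreal (real (card (Sur (rep (cls h)) K))) * indicator (carrier H - torsion) h = (\<Sum>\<psi>\<in>?S. indicator (?ker \<psi>) h)"
        using h \<open>h \<notin> torsion\<close> by (simp add: ennreal_of_nat_eq_real_of_nat)
    qed
  qed
  also have "\<dots> = (\<Sum>\<psi>\<in>?S. emeasure (haar p H) (?ker \<psi>))"
    by (subst nn_integral_sum) (simp_all add: kernel_measure(1) borel_measurable_indicator)
  also have "\<dots> = (\<Sum>\<psi>\<in>?S. ennreal (1 / real (card (carrier K))))"
    by (rule sum.cong[OF refl]) (simp add: haar.emeasure_eq_measure kernel_measure(2))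
  also have "\<dots> = ennreal (real (card ?S) / real (card (carrier K)))"
    by (simp add: ennreal_of_nat_eq_real_of_nat ennreal_mult[symmetric])
  finally show ?thesis .
qed

end

section \<open>Classification of extensions by characters\<close>

lemma padic_extI:
  assumes "prime p" "fin_ab_p_group p G" "order G = p ^ k" "is_extension p G (H, i, q)"
  shows "padic_ext p H G i q k"
proof -
  have m: "Module.module (Zp p) H" using assms(4) by (simp add: is_extension_def)
  interpret padic_module p H
    by (intro padic_module.intro padic_prime.intro assms(1) m)
  show ?thesis
  proof (intro padic_ext.intro padic_ext_axioms.intro)
    show "padic_module p H" by unfold_locales
    show "comm_group G" "finite (carrier G)" using fin_ab_p_groupD[OF assms(2)] by auto
  qed (use assms in \<open>auto simp: is_extension_def\<close>)
qed

context padic_ext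
begin

text \<open>\<open>lam\<close> is defined by \<open>i\<close> and the module structure alone, so
  every morphism of extensions preserves it.\<close>

lemma chi_morphism:
  assumes "padic_ext p H' G i' q' k" and f: "f \<in> mod_hom (Zp p) H H'"
    and fi: "\<And>a. a \<in> carrier R \<Longrightarrow> f (i a) = i' a" and fq: "\<And>x. x \<in> carrier H \<Longrightarrow> q' (f x) = q x"
  shows "padic_ext.chi p H' G i' q' k = chi"
proof -
  interpret E: padic_ext p H' G i' q' k by fact
  have fc: "f x \<in> carrier H'" if "x \<in> carrier H" for x using f that by (auto simp: mod_hom_def hom_def)
  have fs: "f (a \<odot>\<^bsub>H\<^esub> x) = a \<odot>\<^bsub>H'\<^esub> f x" if "a \<in> carrier R" "x \<in> carrier H" for a x
    using f that by (auto simp: mod_hom_def)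
  have l: "E.lam (f x) = lam x" if x: "x \<in> carrier H" for x
  proof (rule E.lam_eqI)
    have "i' (lam x) = f (i (lam x))" by (rule fi[symmetric]) (rule lam_closed[OF x])
    also have "\<dots> = f (pk \<odot>\<^bsub>H\<^esub> x)" unfolding i_lam[OF x] ..
    also have "\<dots> = pk \<odot>\<^bsub>H'\<^esub> f x" by (rule fs[OF zint_closed x])
    finally show "i' (lam x) = pk \<odot>\<^bsub>H'\<^esub> f x" .
  qed (use x fc in auto)
  show ?thesis
  proof (rule chars_eqI[OF E.chi_char chi_char])
    fix g assume g: "g \<in> carrier G"
    obtain x where x: "x \<in> carrier H" "q x = g" by (rule q_lift[OF g])
    have "E.chi (q' (f x)) = eps k (lam x)" using E.chi_q[OF fc[OF x(1)]] l[OF x(1)] by simp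
    then show "E.chi g = chi g" using chi_q[OF x(1)] fq[OF x(1)] x(2) by simp
  qed
qed

text \<open>In the coordinates \<open>(lam, q)\<close> both modules are the same fibre product. The
  isomorphism matches coordinates, and its linearity follows because an element is determined by
  them.\<close>

lemma chi_eq_imp_iso:
  assumes "padic_ext p H' G i' q' k" and eq: "padic_ext.chi p H' G i' q' k = chi"
  shows "\<exists>f\<in>mod_iso (Zp p) H H'. (\<forall>a\<in>carrier R. f (i a) = i' a) \<and> (\<forall>x\<in>carrier H. q' (f x) = q x)"
proof -
  interpret E: padic_ext p H' G i' q' k by fact
  define f where "f x = (SOME y. y \<in> carrier H' \<and> E.lam y = lam x \<and> q' y = q x)" for x
  have f: "f x \<in> carrier H' \<and> E.lam (f x) = lam x \<and> q' (f x) = q x" if x: "x \<in> carrier H" for x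
  proof -
    have "eps k (lam x) = E.chi (q x)" using chi_q[OF x] eq by simp
    then obtain y where "y \<in> carrier H'" "E.lam y = lam x" "q' y = q x"
      using E.lam_q_surj[OF lam_closed[OF x] q_closed[OF x]] by blast
    then have "\<exists>y. y \<in> carrier H' \<and> E.lam y = lam x \<and> q' y = q x" by blast
    then show ?thesis unfolding f_def by (rule someI_ex)
  qed
  have fI: "f x = y" if "x \<in> carrier H" "y \<in> carrier H'" "E.lam y = lam x" "q' y = q x" for x y
    using E.lam_q_inj[of "f x" y] f[OF that(1)] that by simp
  have add: "f (x \<oplus>\<^bsub>H\<^esub> y) = f x \<oplus>\<^bsub>H'\<^esub> f y" if "x \<in> carrier H" "y \<in> carrier H" for x y
    by (rule fI) (use f[OF that(1)] f[OF that(2)] that in \<open>simp_all add: E.lam_add lam_add E.q_add q_add\<close>)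
  \<comment> \<open>Both \<open>q\<close> and \<open>q'\<close> turn a scalar \<open>a\<close> into
    the exponent \<open>a k\<close>, since \<open>G\<close> has exponent \<open>p^k\<close>.\<close>
  have sm: "f (a \<odot>\<^bsub>H\<^esub> x) = a \<odot>\<^bsub>H'\<^esub> f x" if "a \<in> carrier R" "x \<in> carrier H" for a x
  proof (rule fI)
    show "q' (a \<odot>\<^bsub>H'\<^esub> f x) = q (a \<odot>\<^bsub>H\<^esub> x)"
      using E.add_hom_smult[OF G.is_group E.qh.homh _ that(1) G_pow, of "f x"]
        add_hom_smult[OF G.is_group qh.homh that(2,1) G_pow] f[OF that(2)] by simp
  qed (use f[OF that(2)] that in \<open>simp_all add: E.lam_smult lam_smult\<close>)
  have "bij_betw f (carrier H) (carrier H')"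
    unfolding bij_betw_def
  proof
    show "inj_on f (carrier H)"
    proof (rule inj_onI)
      fix x y assume xy: "x \<in> carrier H" "y \<in> carrier H" "f x = f y"
      show "x = y" by (rule lam_q_inj[OF xy(1,2)]) (use f[OF xy(1)] f[OF xy(2)] xy(3) in auto)
    qed
    show "f ` carrier H = carrier H'"
    proof (intro equalityI subsetI)
      fix y assume y: "y \<in> carrier H'"
      have "eps k (E.lam y) = chi (q' y)" using E.chi_q[OF y] eq by simp
      then obtain x where x: "x \<in> carrier H" "lam x = E.lam y" "q x = q' y"
        using lam_q_surj[OF E.lam_closed[OF y] E.q_closed[OF y]] by blast
      then show "y \<in> f ` carrier H" using fI[OF x(1) y] by auto
    qed (use f in auto)
  qed
  moreover have "f \<in> mod_hom (Zp p) H H'" using f add sm by (auto simp: mod_hom_def hom_def)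
  moreover have "f (i a) = i' a" if a: "a \<in> carrier R" for a
    by (rule fI) (use a in \<open>simp_all add: lam_i E.lam_i\<close>)
  ultimately show ?thesis using f by (auto simp: mod_iso_def)
qed

text \<open>The law of \<open>d\<close> is evaluated at a chosen representative of the isomorphism
  class of \<open>H\<close>; this gives the representative the structure of an extension with the
  same character.\<close>

lemma transport:
  assumes H': "Module.module (Zp p) H'" and f: "f \<in> mod_iso (Zp p) H' H"
  obtains i' q' where "padic_ext p H' G i' q' k" "padic_ext.chi p H' G i' q' k = chi"
proof -
  interpret H': Module.module "Zp p" H' by fact
  have bij: "bij_betw f (carrier H') (carrier H)" using f by (simp add: mod_iso_def)
  have fh: "f \<in> mod_hom (Zp p) H' H" using f by (simp add: mod_iso_def)
  have fc: "f x \<in> carrier H" and fa: "y \<in> carrier H' \<Longrightarrow> f (x \<oplus>\<^bsub>H'\<^esub> y) = f x \<oplus>\<^bsub>H\<^esub> f y" if "x \<in> carrier H'" for x y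
    using fh that by (auto simp: mod_hom_def hom_def)
  have fs: "f (a \<odot>\<^bsub>H'\<^esub> x) = a \<odot>\<^bsub>H\<^esub> f x" if "a \<in> carrier R" "x \<in> carrier H'" for a x
    using fh that by (auto simp: mod_hom_def)
  define i' where "i' z = inv_into (carrier H') f (i z)" for z
  define q' where "q' x = q (f x)" for x
  have i': "i' z \<in> carrier H'" "f (i' z) = i z" if "z \<in> carrier R" for z
    using bij i_closed[OF that] by (auto simp: i'_def bij_betw_def inv_into_into f_inv_into_f)
  have inj: "x = y" if "x \<in> carrier H'" "y \<in> carrier H'" "f x = f y" for x y
    using bij that by (meson bij_betw_def inj_onD)
  have E: "padic_ext p H' G i' q' k"
  proof unfold_locales
    show "i' \<in> mod_hom (Zp p) (Zp_self p) H'"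
      unfolding mod_hom_def hom_def Zp_self_simps
    proof (clarsimp simp: Zp_self_simps, intro conjI ballI)
      show "i' \<in> carrier R \<rightarrow> carrier H'" using i' by auto
      show "i' (x \<oplus>\<^bsub>R\<^esub> y) = i' x \<oplus>\<^bsub>H'\<^esub> i' y" if "x \<in> carrier R" "y \<in> carrier R" for x y
        by (rule inj) (use i' that in \<open>simp_all add: fa i_add\<close>)
      show "i' (a \<otimes>\<^bsub>R\<^esub> x) = a \<odot>\<^bsub>H'\<^esub> i' x" if "a \<in> carrier R" "x \<in> carrier R" for a x
        by (rule inj) (use i' that in \<open>simp_all add: fs i_mult\<close>)
    qed
    show "inj_on i' (carrier R)"
    proof (rule inj_onI)
      fix x y assume "x \<in> carrier R" "y \<in> carrier R" "i' x = i' y"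
      then show "x = y" using i'(2)[of x] i'(2)[of y] i_eq_iff[of x y] by simp
    qed
    show "q' \<in> epi (add_monoid H') G"
    proof -
      have "q' ` carrier H' = carrier G" using bij q_surj unfolding q'_def bij_betw_def by (metis image_image)
      then show ?thesis using fc fa by (auto simp: epi_def hom_def q'_def q_add)
    qed
    show "kernel (add_monoid H') G q' = i' ` carrier R"
    proof (intro equalityI subsetI)
      fix x assume "x \<in> kernel (add_monoid H') G q'"
      then have x: "x \<in> carrier H'" "q (f x) = \<one>\<^bsub>G\<^esub>" by (auto simp: kernel_def q'_def)
      then obtain z where z: "z \<in> carrier R" "f x = i z" using q_ker[OF fc[OF x(1)]] by blast
      then have "x = i' z" using inj[of x "i' z"] x i' by simp
      then show "x \<in> i' ` carrier R" using z by blast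
    next
      fix x assume "x \<in> i' ` carrier R"
      then show "x \<in> kernel (add_monoid H') G q'" using i' by (auto simp: kernel_def q'_def)
    qed
  qed (rule finG, rule ordG)
  then interpret E: padic_ext p H' G i' q' k .
  have "chi = E.chi"
    by (rule E.chi_morphism[OF padic_ext_axioms fh]) (auto simp: i' q'_def)
  then show ?thesis using that[OF E] by simp
qed

text \<open>This puts \<open>H\<close> into its own class, so that the class is nonempty and has a
  representative. The rank is at most one because \<open>(lam t) s\<close> and
  \<open>(lam s) t\<close> differ by torsion, which \<open>p^k\<close> kills.\<close>

lemma rank1: "rank1_module p H"
proof -
  have gen: "fin_gen (Zp p) H"
    unfolding fin_gen_def
  proof (intro exI[of _ "insert (i \<one>\<^bsub>R\<^esub>) (lift ` carrier G)"] conjI allI impI)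
    show "finite (insert (i \<one>\<^bsub>R\<^esub>) (lift ` carrier G))" using finG by simp
    show "insert (i \<one>\<^bsub>R\<^esub>) (lift ` carrier G) \<subseteq> carrier H" using lift(1) by auto
    fix N assume N: "submodule N R H \<and> insert (i \<one>\<^bsub>R\<^esub>) (lift ` carrier G) \<subseteq> N"
    then interpret N: submodule N R H by simp
    show "N = carrier H"
    proof
      show "N \<subseteq> carrier H" using N.subset by simp
      show "carrier H \<subseteq> N"
      proof
        fix x assume x: "x \<in> carrier H"
        obtain z where z: "z \<in> carrier R" "x = lift (q x) \<oplus>\<^bsub>H\<^esub> i z"
          using q_eqE[OF x lift(1)[OF q_closed[OF x]]] lift(2)[OF q_closed[OF x]] by metis
        have "z \<odot>\<^bsub>H\<^esub> i \<one>\<^bsub>R\<^esub> \<in> N" using N z(1) by (intro N.smult_closed) auto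
        then have "i z \<in> N" using i_eq_smult[OF z(1)] by simp
        moreover have "lift (q x) \<in> N" using N x by auto
        ultimately show "x \<in> N" using N.m_closed[of "lift (q x)" "i z"] z(2) by simp
      qed
    qed
  qed
  have ind: "lin_indep (Zp p) H {i \<one>\<^bsub>R\<^esub>}"
  proof -
    have one: "a (i \<one>\<^bsub>R\<^esub>) = \<zero>\<^bsub>R\<^esub>" if a: "a \<in> {i \<one>\<^bsub>R\<^esub>} \<rightarrow> carrier R" and z: "(\<Oplus>\<^bsub>H\<^esub>s\<in>{i \<one>\<^bsub>R\<^esub>}. a s \<odot>\<^bsub>H\<^esub> s) = \<zero>\<^bsub>H\<^esub>" for a
    proof -
      have aR: "a (i \<one>\<^bsub>R\<^esub>) \<in> carrier R" using a by auto
      have "a (i \<one>\<^bsub>R\<^esub>) \<odot>\<^bsub>H\<^esub> i \<one>\<^bsub>R\<^esub> = \<zero>\<^bsub>H\<^esub>" using z aR by (simp add: H.M.finsum_insert)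
      then have "i (a (i \<one>\<^bsub>R\<^esub>)) = i \<zero>\<^bsub>R\<^esub>" using i_eq_smult[OF aR] by (simp add: i_zero)
      then show ?thesis using i_eq_iff[OF aR R.zero_closed] by simp
    qed
    show ?thesis unfolding lin_indep_def
    proof (intro conjI ballI impI)
      fix a s assume "a \<in> {i \<one>\<^bsub>R\<^esub>} \<rightarrow> carrier R" "(\<Oplus>\<^bsub>H\<^esub>s\<in>{i \<one>\<^bsub>R\<^esub>}. a s \<odot>\<^bsub>H\<^esub> s) = \<zero>\<^bsub>H\<^esub>" "s \<in> {i \<one>\<^bsub>R\<^esub>}"
      then show "a s = \<zero>\<^bsub>R\<^esub>" using one[of a] by (metis singletonD)
    qed auto
  qed
  have tors: "pk \<odot>\<^bsub>H\<^esub> x = \<zero>\<^bsub>H\<^esub>" if "x \<in> carrier H" "lam x = \<zero>\<^bsub>R\<^esub>" for x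
    using i_lam[OF that(1)] that(2) by (simp add: i_zero)
  have pk0: "pk \<noteq> \<zero>\<^bsub>R\<^esub>" using p_gt_1 by (simp add: zint_eq_0)
  have bound: "card S \<le> 1" if S: "lin_indep (Zp p) H S" for S
  proof (rule ccontr)
    assume "\<not> card S \<le> 1"
    then obtain s t where st: "s \<in> S" "t \<in> S" "s \<noteq> t"
      by (metis card_le_Suc0_iff_eq One_nat_def S lin_indep_def)
    have fin: "finite S" and sub: "S \<subseteq> carrier H" using S by (auto simp: lin_indep_def)
    have sH: "s \<in> carrier H" "t \<in> carrier H" using st sub by auto
    have free: "a = \<zero>\<^bsub>R\<^esub> \<and> b = \<zero>\<^bsub>R\<^esub>" if ab: "a \<in> carrier R" "b \<in> carrier R" "a \<odot>\<^bsub>H\<^esub> s \<oplus>\<^bsub>H\<^esub> b \<odot>\<^bsub>H\<^esub> t = \<zero>\<^bsub>H\<^esub>" for a b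
    proof -
      define c where "c x = (if x = s then a else if x = t then b else \<zero>\<^bsub>R\<^esub>)" for x
      have "(\<Oplus>\<^bsub>H\<^esub>x\<in>S. c x \<odot>\<^bsub>H\<^esub> x) = (\<Oplus>\<^bsub>H\<^esub>x\<in>S. (if s = x then a \<odot>\<^bsub>H\<^esub> x else \<zero>\<^bsub>H\<^esub>) \<oplus>\<^bsub>H\<^esub> (if t = x then b \<odot>\<^bsub>H\<^esub> x else \<zero>\<^bsub>H\<^esub>))"
        by (rule H.M.finsum_cong') (use sub st ab sH in \<open>auto simp: c_def\<close>)
      also have "\<dots> = (\<Oplus>\<^bsub>H\<^esub>x\<in>S. if s = x then a \<odot>\<^bsub>H\<^esub> x else \<zero>\<^bsub>H\<^esub>) \<oplus>\<^bsub>H\<^esub> (\<Oplus>\<^bsub>H\<^esub>x\<in>S. if t = x then b \<odot>\<^bsub>H\<^esub> x else \<zero>\<^bsub>H\<^esub>)"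
        by (rule H.M.finsum_addf) (use sub ab sH in auto)
      also have "(\<Oplus>\<^bsub>H\<^esub>x\<in>S. if s = x then a \<odot>\<^bsub>H\<^esub> x else \<zero>\<^bsub>H\<^esub>) = a \<odot>\<^bsub>H\<^esub> s"
        by (rule H.M.finsum_singleton) (use sub ab st fin in auto)
      also have "(\<Oplus>\<^bsub>H\<^esub>x\<in>S. if t = x then b \<odot>\<^bsub>H\<^esub> x else \<zero>\<^bsub>H\<^esub>) = b \<odot>\<^bsub>H\<^esub> t"
        by (rule H.M.finsum_singleton) (use sub ab st fin in auto)
      finally have "(\<Oplus>\<^bsub>H\<^esub>x\<in>S. c x \<odot>\<^bsub>H\<^esub> x) = \<zero>\<^bsub>H\<^esub>" using ab(3) by simp
      moreover have "c \<in> S \<rightarrow> carrier R" using ab by (auto simp: c_def)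
      ultimately have "\<forall>x\<in>S. c x = \<zero>\<^bsub>R\<^esub>" using S by (auto simp: lin_indep_def)
      then have "c s = \<zero>\<^bsub>R\<^esub>" "c t = \<zero>\<^bsub>R\<^esub>" using st by auto
      then show ?thesis using st(3) by (auto simp: c_def)
    qed
    have nz: "lam t \<noteq> \<zero>\<^bsub>R\<^esub>"
      using free[of "\<zero>\<^bsub>R\<^esub>" pk] tors[OF sH(2)] sH pk0 by auto
    let ?d = "lam t \<odot>\<^bsub>H\<^esub> s \<oplus>\<^bsub>H\<^esub> (\<ominus>\<^bsub>R\<^esub> lam s) \<odot>\<^bsub>H\<^esub> t"
    have "lam ?d = \<zero>\<^bsub>R\<^esub>" using sH by (simp add: lam_add lam_smult R.l_minus R.m_comm[of "lam s"] R.r_neg)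
    then have "pk \<odot>\<^bsub>H\<^esub> ?d = \<zero>\<^bsub>H\<^esub>" using tors[of ?d] sH by simp
    then have "(pk \<otimes>\<^bsub>R\<^esub> lam t) \<odot>\<^bsub>H\<^esub> s \<oplus>\<^bsub>H\<^esub> (pk \<otimes>\<^bsub>R\<^esub> (\<ominus>\<^bsub>R\<^esub> lam s)) \<odot>\<^bsub>H\<^esub> t = \<zero>\<^bsub>H\<^esub>"
      using sH by (simp add: H.smult_r_distr H.smult_assoc1)
    then have "pk \<otimes>\<^bsub>R\<^esub> lam t = \<zero>\<^bsub>R\<^esub>" using free[of "pk \<otimes>\<^bsub>R\<^esub> lam t" "pk \<otimes>\<^bsub>R\<^esub> (\<ominus>\<^bsub>R\<^esub> lam s)"] sH by simp
    then show False using zint_pow_cancel[of "lam t" k] sH nz by simp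
  qed
  have "has_rank (Zp p) H 1"
    unfolding has_rank_def using ind bound by (intro conjI exI[of _ "{i \<one>\<^bsub>R\<^esub>}"]) auto
  then show ?thesis using gen H.module_axioms by (simp add: rank1_module_def)
qed

end

section \<open>The extension with a given character\<close>

locale padic_char = padic_prime p + G: comm_group G for p :: nat and G :: "('g, 'm) monoid_scheme" +
  fixes k :: nat and \<kappa> :: "'g \<Rightarrow> complex"
  assumes finG: "finite (carrier G)" and ordG: "order G = p ^ k" and char: "\<kappa> \<in> chars G (carrier G)"
begin

text \<open>The fibre product of \<open>\<kappa>\<close> with \<open>\<rat>\<^sub>p \<rightarrow> \<rat>\<^sub>p/\<int>\<^sub>p\<close>, where \<open>a\<close> stands for \<open>a / p\<^sup>k\<close>. The ring fields
  \<open>mult\<close> and \<open>one\<close> play no role in a module.\<close>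

definition char_ext :: "(padic, padic \<times> 'g) module" where
  "char_ext = \<lparr>carrier = {(a, g). a \<in> carrier R \<and> g \<in> carrier G \<and> eps k a = \<kappa> g},
     monoid.mult = (\<lambda>x y. x), one = (\<zero>\<^bsub>R\<^esub>, \<one>\<^bsub>G\<^esub>), zero = (\<zero>\<^bsub>R\<^esub>, \<one>\<^bsub>G\<^esub>),
     add = (\<lambda>(a, g) (b, h). (a \<oplus>\<^bsub>R\<^esub> b, g \<otimes>\<^bsub>G\<^esub> h)),
     smult = (\<lambda>z (a, g). (z \<otimes>\<^bsub>R\<^esub> a, g [^]\<^bsub>G\<^esub> nat (z k)))\<rparr>"

definition char_incl :: "padic \<Rightarrow> padic \<times> 'g" where
  "char_incl z = (zint (int p ^ k) \<otimes>\<^bsub>R\<^esub> z, \<one>\<^bsub>G\<^esub>)"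

lemma char_ext_simps:
  "(a, g) \<in> carrier char_ext \<longleftrightarrow> a \<in> carrier R \<and> g \<in> carrier G \<and> eps k a = \<kappa> g"
  "(a, g) \<oplus>\<^bsub>char_ext\<^esub> (b, h) = (a \<oplus>\<^bsub>R\<^esub> b, g \<otimes>\<^bsub>G\<^esub> h)"
  "z \<odot>\<^bsub>char_ext\<^esub> (a, g) = (z \<otimes>\<^bsub>R\<^esub> a, g [^]\<^bsub>G\<^esub> nat (z k))"
  "\<zero>\<^bsub>char_ext\<^esub> = (\<zero>\<^bsub>R\<^esub>, \<one>\<^bsub>G\<^esub>)"
  by (simp_all add: char_ext_def)

lemma G_pow_mod:
  assumes "g \<in> carrier G"
  shows "g [^]\<^bsub>G\<^esub> (n mod p ^ k) = g [^]\<^bsub>G\<^esub> n"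
proof -
  have "g [^]\<^bsub>G\<^esub> (p ^ k * (n div p ^ k)) = \<one>\<^bsub>G\<^esub>"
    using G.pow_order_eq_1[OF assms] assms by (simp add: ordG G.nat_pow_pow[symmetric])
  then show ?thesis using G.nat_pow_mult[OF assms, of "p ^ k * (n div p ^ k)" "n mod p ^ k"] assms by simp
qed

lemma nat_coord:
  assumes "z \<in> carrier R" "w \<in> carrier R"
  shows "nat ((z \<oplus>\<^bsub>R\<^esub> w) k) = (nat (z k) + nat (w k)) mod p ^ k"
    "nat ((z \<otimes>\<^bsub>R\<^esub> w) k) = (nat (z k) * nat (w k)) mod p ^ k"
  using ZpD(1)[OF assms(1), of k] ZpD(1)[OF assms(2), of k]
  by (simp_all add: Zp_simps nat_mod_distrib nat_add_distrib nat_mult_distrib nat_power_eq)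

lemma eps_mult:
  assumes "z \<in> carrier R" "a \<in> carrier R"
  shows "eps k (z \<otimes>\<^bsub>R\<^esub> a) = eps k a ^ nat (z k)"
proof -
  have "eps k (z \<otimes>\<^bsub>R\<^esub> a) = cis (2 * pi * real_of_int (z k * a k) / real p ^ k)"
    by (simp add: eps_def Zp_simps cis_mod)
  also have "\<dots> = cis (real (nat (z k)) * (2 * pi * real_of_int (a k) / real p ^ k))"
    using ZpD(1)[OF assms(1), of k] by (simp add: mult_ac)
  also have "\<dots> = eps k a ^ nat (z k)" unfolding eps_def Complex.DeMoivre ..
  finally show ?thesis .
qed

lemma module_char_ext: "Module.module (Zp p) char_ext"
proof (rule moduleI)
  show "cring R" by (rule cring_Zp)
  show "abelian_group char_ext"
  proof (rule abelian_groupI)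
    fix x y assume "x \<in> carrier char_ext" "y \<in> carrier char_ext"
    then show "x \<oplus>\<^bsub>char_ext\<^esub> y \<in> carrier char_ext"
      by (cases x; cases y) (simp add: char_ext_simps eps_add charsD(3)[OF char])
  next
    show "\<zero>\<^bsub>char_ext\<^esub> \<in> carrier char_ext" by (simp add: char_ext_simps charsD(2)[OF char])
  next
    fix x y z assume "x \<in> carrier char_ext" "y \<in> carrier char_ext" "z \<in> carrier char_ext"
    then show "x \<oplus>\<^bsub>char_ext\<^esub> y \<oplus>\<^bsub>char_ext\<^esub> z = x \<oplus>\<^bsub>char_ext\<^esub> (y \<oplus>\<^bsub>char_ext\<^esub> z)"
      by (cases x; cases y; cases z) (simp add: char_ext_simps R.a_assoc G.m_assoc)
  next
    fix x y assume "x \<in> carrier char_ext" "y \<in> carrier char_ext"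
    then show "x \<oplus>\<^bsub>char_ext\<^esub> y = y \<oplus>\<^bsub>char_ext\<^esub> x"
      by (cases x; cases y) (simp add: char_ext_simps R.a_comm G.m_comm)
  next
    fix x assume x: "x \<in> carrier char_ext"
    then show "\<zero>\<^bsub>char_ext\<^esub> \<oplus>\<^bsub>char_ext\<^esub> x = x" by (cases x) (simp add: char_ext_simps)
    obtain a g where ag: "x = (a, g)" "a \<in> carrier R" "g \<in> carrier G" "eps k a = \<kappa> g" using x by (cases x) (auto simp: char_ext_simps)
    have "eps k (\<ominus>\<^bsub>R\<^esub> a) * eps k a = 1" using eps_add[of k "\<ominus>\<^bsub>R\<^esub> a" a] ag(2) by (simp add: R.l_neg)
    moreover have "\<kappa> (inv\<^bsub>G\<^esub> g) * \<kappa> g = 1" by (rule chars_inv(1)[OF G.is_group G.subgroup_self char ag(3)])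
    ultimately have "eps k (\<ominus>\<^bsub>R\<^esub> a) = \<kappa> (inv\<^bsub>G\<^esub> g)" using ag(4) by (metis mult_right_cancel mult_zero_right zero_neq_one)
    then have "(\<ominus>\<^bsub>R\<^esub> a, inv\<^bsub>G\<^esub> g) \<in> carrier char_ext" using ag by (simp add: char_ext_simps)
    moreover have "(\<ominus>\<^bsub>R\<^esub> a, inv\<^bsub>G\<^esub> g) \<oplus>\<^bsub>char_ext\<^esub> x = \<zero>\<^bsub>char_ext\<^esub>" using ag by (simp add: char_ext_simps R.l_neg)
    ultimately show "\<exists>y\<in>carrier char_ext. y \<oplus>\<^bsub>char_ext\<^esub> x = \<zero>\<^bsub>char_ext\<^esub>" by blast
  qed
next
  fix z x assume "z \<in> carrier R" "x \<in> carrier char_ext"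
  then show "z \<odot>\<^bsub>char_ext\<^esub> x \<in> carrier char_ext"
    by (cases x) (simp add: char_ext_simps eps_mult chars_pow[OF G.is_group G.subgroup_self char])
next
  fix z w x assume zw: "z \<in> carrier R" "w \<in> carrier R" and "x \<in> carrier char_ext"
  then obtain a g where ag: "x = (a, g)" "a \<in> carrier R" "g \<in> carrier G" by (cases x) (auto simp: char_ext_simps)
  show "(z \<oplus>\<^bsub>R\<^esub> w) \<odot>\<^bsub>char_ext\<^esub> x = z \<odot>\<^bsub>char_ext\<^esub> x \<oplus>\<^bsub>char_ext\<^esub> w \<odot>\<^bsub>char_ext\<^esub> x"
    using ag zw by (simp add: char_ext_simps nat_coord G_pow_mod G.nat_pow_mult R.l_distr)
  show "(z \<otimes>\<^bsub>R\<^esub> w) \<odot>\<^bsub>char_ext\<^esub> x = z \<odot>\<^bsub>char_ext\<^esub> (w \<odot>\<^bsub>char_ext\<^esub> x)"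
    using ag zw by (simp add: char_ext_simps nat_coord G_pow_mod G.nat_pow_pow R.m_assoc mult.commute)
next
  fix z x y assume "z \<in> carrier R" "x \<in> carrier char_ext" "y \<in> carrier char_ext"
  then show "z \<odot>\<^bsub>char_ext\<^esub> (x \<oplus>\<^bsub>char_ext\<^esub> y) = z \<odot>\<^bsub>char_ext\<^esub> x \<oplus>\<^bsub>char_ext\<^esub> z \<odot>\<^bsub>char_ext\<^esub> y"
    by (cases x; cases y) (simp add: char_ext_simps R.r_distr G.pow_mult_distrib G.m_comm)
next
  fix x assume "x \<in> carrier char_ext"
  then obtain a g where ag: "x = (a, g)" "a \<in> carrier R" "g \<in> carrier G" by (cases x) (auto simp: char_ext_simps)
  have "nat (\<one>\<^bsub>R\<^esub> k) = 1 mod p ^ k" by (simp add: Zp_simps nat_mod_distrib nat_power_eq)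
  then have "g [^]\<^bsub>G\<^esub> nat (\<one>\<^bsub>R\<^esub> k) = g" using G_pow_mod[OF ag(3), of 1] ag(3) by simp
  then show "\<one>\<^bsub>R\<^esub> \<odot>\<^bsub>char_ext\<^esub> x = x" using ag by (simp add: char_ext_simps)
qed

lemma char_incl_closed: "z \<in> carrier R \<Longrightarrow> char_incl z \<in> carrier char_ext"
  using eps_shift[of z 0 k] ZpD[of z 0] by (simp add: char_incl_def char_ext_simps charsD(2)[OF char] eps_def)

lemma char_ext_is_extension: "is_extension p G (char_ext, char_incl, snd)"
  unfolding is_extension_def prod.case
proof (intro conjI)
  interpret M: Module.module "Zp p" char_ext by (rule module_char_ext)
  show "Module.module (Zp p) char_ext" by (rule module_char_ext)
  have s: "carrier (Zp_self p) = carrier R" "add (Zp_self p) = add R" "smult (Zp_self p) = mult R"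
    by (simp_all add: Zp_self_def ring.defs)
  show "char_incl \<in> mod_hom (Zp p) (Zp_self p) char_ext"
    unfolding mod_hom_def hom_def
    by (auto simp: s char_incl_closed) (auto simp: char_incl_def char_ext_simps R.r_distr R.m_lcomm)
  show "inj_on char_incl (carrier R)"
  proof (rule inj_onI)
    fix x y assume xy: "x \<in> carrier R" "y \<in> carrier R" "char_incl x = char_incl y"
    have "zint (int p ^ k) \<otimes>\<^bsub>R\<^esub> (x \<oplus>\<^bsub>R\<^esub> \<ominus>\<^bsub>R\<^esub> y) = \<zero>\<^bsub>R\<^esub>"
      using xy by (simp add: char_incl_def R.r_distr R.r_minus R.r_neg)
    then have "x \<oplus>\<^bsub>R\<^esub> \<ominus>\<^bsub>R\<^esub> y = \<zero>\<^bsub>R\<^esub>" using zint_pow_cancel[of "x \<oplus>\<^bsub>R\<^esub> \<ominus>\<^bsub>R\<^esub> y" k] xy by simp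
    then show "x = y" using xy R.minus_equality[of x "\<ominus>\<^bsub>R\<^esub> y"] by simp
  qed
  show "snd \<in> epi (add_monoid char_ext) G"
  proof -
    have "\<exists>a. (a, g) \<in> carrier char_ext" if g: "g \<in> carrier G" for g
    proof -
      have "\<kappa> g ^ p ^ k = \<kappa> (g [^]\<^bsub>G\<^esub> (p ^ k))" using chars_pow[OF G.is_group G.subgroup_self char g] by simp
      also have "\<dots> = 1" using G.pow_order_eq_1[OF g] charsD(2)[OF char] by (simp add: ordG)
      finally obtain a where "\<kappa> g = eps k (zint a)" using eps_root_ex by blast
      then show ?thesis using g by (intro exI[of _ "zint a"]) (simp add: char_ext_simps)
    qed
    then have "carrier G \<subseteq> snd ` carrier char_ext" by (metis image_eqI snd_conv subsetI)
    moreover have "snd ` carrier char_ext \<subseteq> carrier G"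
    proof
      fix g assume "g \<in> snd ` carrier char_ext"
      then obtain a where "(a, g) \<in> carrier char_ext" by auto
      then show "g \<in> carrier G" unfolding char_ext_simps by blast
    qed
    ultimately have "snd ` carrier char_ext = carrier G" by blast
    moreover have "snd (x \<oplus>\<^bsub>char_ext\<^esub> y) = snd x \<otimes>\<^bsub>G\<^esub> snd y" for x y by (cases x; cases y) (simp add: char_ext_simps)
    ultimately show ?thesis by (auto simp: epi_def hom_def)
  qed
  show "kernel (add_monoid char_ext) G snd = char_incl ` carrier R"
  proof (intro equalityI subsetI)
    fix x assume "x \<in> kernel (add_monoid char_ext) G snd"
    then obtain a where a: "x = (a, \<one>\<^bsub>G\<^esub>)" "a \<in> carrier R" "eps k a = \<kappa> \<one>\<^bsub>G\<^esub>" by (cases x) (auto simp: kernel_def char_ext_simps)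
    then have "a k = 0" using eps_eq_1 charsD(2)[OF char] by simp
    then obtain w where "w \<in> carrier R" "a = zint (int p ^ k) \<otimes>\<^bsub>R\<^esub> w" using Zp_divide[OF a(2)] by blast
    then show "x \<in> char_incl ` carrier R" using a(1) by (auto simp: char_incl_def)
  next
    fix x assume "x \<in> char_incl ` carrier R"
    then show "x \<in> kernel (add_monoid char_ext) G snd" using char_incl_closed by (auto simp: kernel_def char_incl_def)
  qed
qed

lemma fin_ab: "fin_ab_p_group p G"
  using finG ordG G.comm_group_axioms by (auto simp: fin_ab_p_group_def)

lemma char_ext_chi: "padic_ext.chi p char_ext G char_incl snd k = \<kappa>"
proof -
  interpret E: padic_ext p char_ext G char_incl snd k
    by (rule padic_extI[OF prime_p fin_ab ordG char_ext_is_extension])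
  show ?thesis
  proof (rule chars_eqI[OF E.chi_char char])
    fix g assume g: "g \<in> carrier G"
    obtain x where x: "x \<in> carrier char_ext" "snd x = g" by (rule E.q_lift[OF g])
    then obtain a where a: "x = (a, g)" "a \<in> carrier R" "eps k a = \<kappa> g" by (cases x) (auto simp: char_ext_simps)
    \<comment> \<open>The scalar \<open>p^k\<close> acts on the group coordinate with exponent
      \<open>0\<close>, so \<open>p^k (a, g)\<close> is \<open>char_incl a\<close>.\<close>
    have "zint (int p ^ k) k = 0" by (simp add: zint_def)
    then have "E.lam x = a"
      by (intro E.lam_eqI) (use x a in \<open>simp_all add: char_incl_def char_ext_simps\<close>)
    then show "E.chi g = \<kappa> g" using E.chi_q[OF x(1)] x(2) a(3) by simp
  qed
qed

end

section \<open>Equivalence classes of extensions correspond to characters\<close>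

definition ext_char :: "nat \<Rightarrow> ('g, 'm) monoid_scheme \<Rightarrow> nat \<Rightarrow> 'g extension \<Rightarrow> 'g \<Rightarrow> complex" where
  "ext_char p G k = (\<lambda>(H, i, q). padic_ext.chi p H G i q k)"

lemma ext_equiv_iff:
  assumes "prime p" "fin_ab_p_group p G" "order G = p ^ k"
  shows "(x, y) \<in> ext_equiv p G \<longleftrightarrow> is_extension p G x \<and> is_extension p G y \<and> ext_char p G k x = ext_char p G k y"
proof -
  obtain H i q H' i' q' where xy: "x = (H, i, q)" "y = (H', i', q')" by (metis prod_cases3)
  have "(\<exists>f \<in> mod_iso (Zp p) H H'. (\<forall>a\<in>carrier (Zp p). f (i a) = i' a) \<and> (\<forall>x\<in>carrier H. q' (f x) = q x)) \<longleftrightarrow>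
    ext_char p G k x = ext_char p G k y" if e: "is_extension p G x" "is_extension p G y"
  proof -
    interpret E: padic_ext p H G i q k by (rule padic_extI[OF assms]) (use e xy in simp)
    have E': "padic_ext p H' G i' q' k" by (rule padic_extI[OF assms]) (use e xy in simp)
    show ?thesis
    proof
      assume "\<exists>f \<in> mod_iso (Zp p) H H'. (\<forall>a\<in>carrier (Zp p). f (i a) = i' a) \<and> (\<forall>x\<in>carrier H. q' (f x) = q x)"
      then obtain f where f: "f \<in> mod_iso (Zp p) H H'" "\<forall>a\<in>carrier (Zp p). f (i a) = i' a" "\<forall>x\<in>carrier H. q' (f x) = q x" by blast
      have "padic_ext.chi p H' G i' q' k = E.chi"
        by (rule E.chi_morphism[OF E', of f]) (use f in \<open>auto simp: mod_iso_def\<close>)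
      then show "ext_char p G k x = ext_char p G k y" by (simp add: ext_char_def xy)
    next
      assume "ext_char p G k x = ext_char p G k y"
      then have "padic_ext.chi p H' G i' q' k = E.chi" by (simp add: ext_char_def xy)
      then show "\<exists>f \<in> mod_iso (Zp p) H H'. (\<forall>a\<in>carrier (Zp p). f (i a) = i' a) \<and> (\<forall>x\<in>carrier H. q' (f x) = q x)"
        by (rule E.chi_eq_imp_iso[OF E'])
    qed
  qed
  then show ?thesis unfolding xy by (auto simp: ext_equiv_def)
qed

lemma Ext_rep:
  assumes "prime p" "fin_ab_p_group p G" "order G = p ^ k" "e \<in> Ext p G"
  shows "is_extension p G (rep e)" "e = ext_equiv p G `` {rep e}"
proof -
  obtain x where x: "is_extension p G x" "e = ext_equiv p G `` {x}" using assms(4) by (auto simp: Ext_def quotient_def)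
  have "x \<in> e" unfolding x(2) using ext_equiv_iff[OF assms(1-3), of x x] x(1) by simp
  then have "e \<noteq> {}" by blast
  then have "rep e \<in> e" by (rule rep_in)
  then have r: "(x, rep e) \<in> ext_equiv p G" using x(2) by auto
  then have h: "is_extension p G (rep e)" "ext_char p G k x = ext_char p G k (rep e)"
    using ext_equiv_iff[OF assms(1-3)] by auto
  then show "is_extension p G (rep e)" by simp
  have "(x, y) \<in> ext_equiv p G \<longleftrightarrow> (rep e, y) \<in> ext_equiv p G" for y
    unfolding ext_equiv_iff[OF assms(1-3)] using h x(1) by simp
  then show "e = ext_equiv p G `` {rep e}" using x(2) by blast
qed

text \<open>A uniformly random class of extensions becomes a uniformly random character. Injectivity
  rests on \<open>chi_eq_imp_iso\<close>, surjectivity on the fibre product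
  \<open>char_ext\<close>.\<close>

lemma bij_Ext_chars:
  assumes "prime p" "fin_ab_p_group p G" "order G = p ^ k"
  shows "bij_betw (\<lambda>e. ext_char p G k (rep e)) (Ext p G) (chars G (carrier G))"
  unfolding bij_betw_def
proof
  note R = Ext_rep[OF assms]
  show "inj_on (\<lambda>e. ext_char p G k (rep e)) (Ext p G)"
  proof (rule inj_onI)
    fix e e' assume e: "e \<in> Ext p G" "e' \<in> Ext p G" "ext_char p G k (rep e) = ext_char p G k (rep e')"
    have "(rep e, y) \<in> ext_equiv p G \<longleftrightarrow> (rep e', y) \<in> ext_equiv p G" for y
      unfolding ext_equiv_iff[OF assms] using R(1)[OF e(1)] R(1)[OF e(2)] e(3) by simp
    then have "ext_equiv p G `` {rep e} = ext_equiv p G `` {rep e'}" by blast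
    then show "e = e'" using R(2)[OF e(1)] R(2)[OF e(2)] by simp
  qed
  show "(\<lambda>e. ext_char p G k (rep e)) ` Ext p G = chars G (carrier G)"
  proof (intro equalityI subsetI)
    fix \<kappa> assume "\<kappa> \<in> (\<lambda>e. ext_char p G k (rep e)) ` Ext p G"
    then obtain e where e: "e \<in> Ext p G" "\<kappa> = ext_char p G k (rep e)" by blast
    obtain H i q where r: "rep e = (H, i, q)" by (metis prod_cases3)
    have "padic_ext p H G i q k" by (rule padic_extI[OF assms]) (use R(1)[OF e(1)] r in simp)
    then show "\<kappa> \<in> chars G (carrier G)" using padic_ext.chi_char e(2) r by (simp add: ext_char_def)
  next
    fix \<kappa> assume \<kappa>: "\<kappa> \<in> chars G (carrier G)"
    interpret padic_char p G k \<kappa>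
      by (intro padic_char.intro padic_prime.intro padic_char_axioms.intro) (use assms \<kappa> fin_ab_p_groupD[OF assms(2)] in auto)
    let ?x = "(char_ext, char_incl, snd)"
    let ?e = "ext_equiv p G `` {?x}"
    have e: "?e \<in> Ext p G" using char_ext_is_extension by (auto simp: Ext_def quotient_def)
    have "rep ?e \<in> ?e"
    proof (rule rep_in)
      have "?x \<in> ?e" using ext_equiv_iff[OF assms, of ?x ?x] char_ext_is_extension by simp
      then show "?e \<noteq> {}" by blast
    qed
    then have "(?x, rep ?e) \<in> ext_equiv p G" by simp
    then have "ext_char p G k (rep ?e) = ext_char p G k ?x" using ext_equiv_iff[OF assms] by metis
    also have "\<dots> = \<kappa>" using char_ext_chi by (simp add: ext_char_def)
    finally have "\<kappa> = ext_char p G k (rep ?e)" by (rule sym)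
    then show "\<kappa> \<in> (\<lambda>e. ext_char p G k (rep e)) ` Ext p G" using e by (rule image_eqI)
  qed
qed

section \<open>Summation over all extensions\<close>

definition pair_char :: "('g, 'm) monoid_scheme \<Rightarrow> ('g \<Rightarrow> complex) \<Rightarrow> ('g \<times> 'c) set \<times> ('g \<times> 'c \<Rightarrow> complex) \<Rightarrow> bool" where
  "pair_char G \<kappa> e \<longleftrightarrow> (\<forall>g f. (g, f) \<in> fst e \<longrightarrow> snd e (g, f) ^ card (slice2 G (fst e)) = \<kappa> g)"

lemma (in padic_ext_target) chi_pairs_eq: "chi_pairs = {e \<in> pairs G K. pair_char G chi e}"
  by (auto simp: chi_pairs_def pair_char_def)

text \<open>The order of the slice as exponent makes the power of \<theta> trivial on the slice, so
  this power descends along the projection of \<open>E\<close> onto \<open>G\<close>.\<close>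

lemma pair_char_exists:
  assumes G: "group G" and K: "group K" and e: "e \<in> pairs G K"
  shows "\<exists>\<kappa>\<in>chars G (carrier G). pair_char G \<kappa> e"
proof -
  obtain E \<theta> where E: "e = (E, \<theta>)" by (cases e)
  interpret G: group G by fact
  interpret K: group K by fact
  have sub: "subgroup E (G \<times>\<times> K)" and ch: "\<theta> \<in> chars (G \<times>\<times> K) E" and fst: "fst ` E = carrier G"
    using e E by (auto simp: pairs_def)
  note D = subgroup_DirProdD[OF G K sub] and S = subgroup_slice2[OF G K sub]
  let ?n = "card (slice2 G E)"
  have wd: "\<theta> (g, f) ^ ?n = \<theta> (g, f') ^ ?n" if h: "(g, f) \<in> E" "(g, f') \<in> E" for g f f'
  proof -
    have g: "g \<in> carrier G" "f \<in> carrier K" "f' \<in> carrier K" using D(4,5) h by auto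
    let ?t = "inv\<^bsub>K\<^esub> f' \<otimes>\<^bsub>K\<^esub> f"
    have "(inv\<^bsub>G\<^esub> g \<otimes>\<^bsub>G\<^esub> g, ?t) \<in> E" by (rule D(1)[OF D(2)[OF h(2)] h(1)])
    then have t: "(\<one>\<^bsub>G\<^esub>, ?t) \<in> E" using g by simp
    have "\<theta> (\<one>\<^bsub>G\<^esub>, ?t) ^ ?n = \<theta> ((\<one>\<^bsub>G\<^esub>, ?t) [^]\<^bsub>G \<times>\<times> K\<^esub> ?n)"
      by (rule chars_pow[OF DirProd_group[OF G K] sub ch t, symmetric])
    also have "(\<one>\<^bsub>G\<^esub>, ?t) [^]\<^bsub>G \<times>\<times> K\<^esub> m = (\<one>\<^bsub>G\<^esub>, ?t [^]\<^bsub>K\<^esub> m)" for m :: nat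
      by (induction m) (use g in auto)
    also have "?t [^]\<^bsub>K\<^esub> ?n = \<one>\<^bsub>K\<^esub>" by (rule K.subgroup_pow_card[OF S]) (use t in \<open>simp add: slice2_def\<close>)
    also have "\<theta> (\<one>\<^bsub>G\<^esub>, \<one>\<^bsub>K\<^esub>) = 1" using charsD(2)[OF ch] by simp
    finally have one: "\<theta> (\<one>\<^bsub>G\<^esub>, ?t) ^ ?n = 1" .
    have "\<theta> (g \<otimes>\<^bsub>G\<^esub> \<one>\<^bsub>G\<^esub>, f' \<otimes>\<^bsub>K\<^esub> ?t) = \<theta> (g, f') * \<theta> (\<one>\<^bsub>G\<^esub>, ?t)" by (rule char_DirProd_mult[OF ch h(2) t])
    moreover have "f' \<otimes>\<^bsub>K\<^esub> ?t = f" using g by (simp add: K.m_assoc[symmetric])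
    ultimately show ?thesis using one g by (simp add: power_mult_distrib)
  qed
  define \<kappa> where "\<kappa> = (\<lambda>g\<in>carrier G. \<theta> (g, SOME f. (g, f) \<in> E) ^ ?n)"
  have \<kappa>: "\<kappa> g = \<theta> (g, f) ^ ?n" if "(g, f) \<in> E" for g f
  proof -
    have s: "(g, SOME f. (g, f) \<in> E) \<in> E" by (rule someI[of "\<lambda>f. (g, f) \<in> E", OF that])
    show ?thesis unfolding \<kappa>_def restrict_apply'[OF D(4)[OF that]] by (rule wd[OF s that])
  qed
  have "\<kappa> (x \<otimes>\<^bsub>G\<^esub> y) = \<kappa> x * \<kappa> y" if xy: "x \<in> carrier G" "y \<in> carrier G" for x y
  proof -
    have "x \<in> fst ` E" "y \<in> fst ` E" using xy fst by simp_all
    then obtain f f' where f: "(x, f) \<in> E" "(y, f') \<in> E" by auto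
    show ?thesis
      unfolding \<kappa>[OF f(1)] \<kappa>[OF f(2)] \<kappa>[OF D(1)[OF f]] char_DirProd_mult[OF ch f] by (rule power_mult_distrib)
  qed
  moreover have "\<kappa> \<one>\<^bsub>G\<^esub> = 1" using \<kappa>[OF D(3)] charsD(2)[OF ch] by simp
  ultimately have "\<kappa> \<in> chars G (carrier G)" by (auto simp: chars_def \<kappa>_def)
  moreover have "pair_char G \<kappa> e" using \<kappa> by (simp add: pair_char_def E)
  ultimately show ?thesis by blast
qed

lemma pair_char_unique:
  assumes "e \<in> pairs G K" "\<kappa> \<in> chars G (carrier G)" "\<kappa>' \<in> chars G (carrier G)" "pair_char G \<kappa> e" "pair_char G \<kappa>' e"
  shows "\<kappa> = \<kappa>'"
proof (rule chars_eqI[OF assms(2,3)])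
  fix g assume g: "g \<in> carrier G"
  have "fst ` fst e = carrier G" using assms(1) unfolding pairs_def by (cases e) simp
  then obtain f where f: "(g, f) \<in> fst e" using g by (metis imageE prod.collapse)
  then show "\<kappa> g = \<kappa>' g" using assms(4,5) unfolding pair_char_def by metis
qed

text \<open>Every pair is compatible with exactly one character of \<open>G\<close>.\<close>

lemma sum_chars_pairs:
  assumes "comm_group G" "comm_group K" "finite (carrier G)" "finite (carrier K)"
  shows "(\<Sum>\<kappa>\<in>chars G (carrier G). card {e \<in> pairs G K. pair_char G \<kappa> e \<and> Q e}) = card {e \<in> pairs G K. Q e}"
proof -
  interpret G: comm_group G by fact
  have fp: "finite (pairs G K)" by (rule finite_pairs[OF assms])
  have "{e \<in> pairs G K. Q e} = (\<Union>\<kappa>\<in>chars G (carrier G). {e \<in> pairs G K. pair_char G \<kappa> e \<and> Q e})"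
    using pair_char_exists[OF G.is_group comm_group.axioms(2)[OF assms(2)]] by blast
  moreover have "card (\<Union>\<kappa>\<in>chars G (carrier G). {e \<in> pairs G K. pair_char G \<kappa> e \<and> Q e}) =
     (\<Sum>\<kappa>\<in>chars G (carrier G). card {e \<in> pairs G K. pair_char G \<kappa> e \<and> Q e})"
  proof (rule card_UN_disjoint)
    show "finite (chars G (carrier G))" by (rule G.card_chars(2)[OF assms(3) G.subgroup_self])
    show "\<forall>\<kappa>\<in>chars G (carrier G). finite {e \<in> pairs G K. pair_char G \<kappa> e \<and> Q e}" using fp by simp
    show "\<forall>\<kappa>\<in>chars G (carrier G). \<forall>\<kappa>'\<in>chars G (carrier G). \<kappa> \<noteq> \<kappa>' \<longrightarrow>
      {e \<in> pairs G K. pair_char G \<kappa> e \<and> Q e} \<inter> {e \<in> pairs G K. pair_char G \<kappa>' e \<and> Q e} = {}"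
      using pair_char_unique by blast
  qed
  ultimately show ?thesis by simp
qed

section \<open>Pairs with symmetric conditions\<close>

definition bipairs :: "('g, 'm) monoid_scheme \<Rightarrow> ('c, 'n) monoid_scheme \<Rightarrow> (('g \<times> 'c) set \<times> ('g \<times> 'c \<Rightarrow> complex)) set" where
  "bipairs G K = {e \<in> pairs G K. snd ` fst e = carrier K \<and> inj_on (\<lambda>g. snd e (g, \<one>\<^bsub>K\<^esub>)) (slice1 K (fst e))}"

definition swap_pair :: "('g \<times> 'c) set \<times> ('g \<times> 'c \<Rightarrow> complex) \<Rightarrow> ('c \<times> 'g) set \<times> ('c \<times> 'g \<Rightarrow> complex)" where
  "swap_pair e = (prod.swap ` fst e, restrict (snd e \<circ> prod.swap) (prod.swap ` fst e))"

lemma swap_pair_bipairs: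
  assumes G: "group G" and K: "group K" and e: "e \<in> bipairs G K"
  shows "swap_pair e \<in> bipairs K G" "swap_pair (swap_pair e) = e"
proof -
  obtain E \<theta> where E: "e = (E, \<theta>)" by (cases e)
  have sub: "subgroup E (G \<times>\<times> K)" and ch: "\<theta> \<in> chars (G \<times>\<times> K) E" and fst: "fst ` E = carrier G" and snd: "snd ` E = carrier K"
    and i2: "inj_on (\<lambda>f. \<theta> (\<one>\<^bsub>G\<^esub>, f)) (slice2 G E)" and i1: "inj_on (\<lambda>g. \<theta> (g, \<one>\<^bsub>K\<^esub>)) (slice1 K E)"
    using e E by (auto simp: bipairs_def pairs_def)
  note D = subgroup_DirProdD[OF G K sub]
  let ?E = "prod.swap ` E" and ?\<theta> = "restrict (\<theta> \<circ> prod.swap) (prod.swap ` E)"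
  have mem: "(f, g) \<in> ?E \<longleftrightarrow> (g, f) \<in> E" for f g by force
  have th: "?\<theta> (f, g) = \<theta> (g, f)" if "(g, f) \<in> E" for f g using that by (simp add: mem)
  have "subgroup ?E (K \<times>\<times> G)"
  proof (rule group.subgroupI[OF DirProd_group[OF K G]])
    show "?E \<subseteq> carrier (K \<times>\<times> G)" using D(4,5) by auto
    show "?E \<noteq> {}" using D(3) by blast
    fix a b assume "a \<in> ?E" "b \<in> ?E"
    then obtain g f g' f' where ab: "a = (f, g)" "(g, f) \<in> E" "b = (f', g')" "(g', f') \<in> E" by auto
    show "a \<otimes>\<^bsub>K \<times>\<times> G\<^esub> b \<in> ?E" using D(1)[OF ab(2,4)] ab mem by simp
    have "inv\<^bsub>K \<times>\<times> G\<^esub> a = (inv\<^bsub>K\<^esub> f, inv\<^bsub>G\<^esub> g)" using inv_DirProd[OF K G] D(4,5) ab by metis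
    then show "inv\<^bsub>K \<times>\<times> G\<^esub> a \<in> ?E" using D(2)[OF ab(2)] mem by simp
  qed
  moreover have "?\<theta> \<in> chars (K \<times>\<times> G) ?E"
  proof -
    have "?\<theta> (x \<otimes>\<^bsub>K \<times>\<times> G\<^esub> y) = ?\<theta> x * ?\<theta> y" if "x \<in> ?E" "y \<in> ?E" for x y
    proof -
      obtain g f g' f' where xy: "x = (f, g)" "(g, f) \<in> E" "y = (f', g')" "(g', f') \<in> E" using \<open>x \<in> ?E\<close> \<open>y \<in> ?E\<close> by auto
      then show ?thesis using th[OF xy(2)] th[OF xy(4)] th[OF D(1)[OF xy(2,4)]] char_DirProd_mult[OF ch xy(2,4)] by simp
    qed
    moreover have "?\<theta> \<one>\<^bsub>K \<times>\<times> G\<^esub> = 1" using th[OF D(3)] charsD(2)[OF ch] by simp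
    ultimately show ?thesis unfolding chars_def by blast
  qed
  moreover have "fst ` ?E = carrier K" "snd ` ?E = carrier G" using fst snd by (simp_all add: image_image)
  moreover have s: "slice2 K ?E = slice1 K E" "slice1 G ?E = slice2 G E" by (auto simp: slice1_def slice2_def mem)
  moreover have "inj_on (\<lambda>g. ?\<theta> (\<one>\<^bsub>K\<^esub>, g)) (slice1 K E)"
    using i1 by (rule inj_on_cong[THEN iffD1, rotated]) (simp add: slice1_def mem)
  moreover have "inj_on (\<lambda>f. ?\<theta> (f, \<one>\<^bsub>G\<^esub>)) (slice2 G E)"
    using i2 by (rule inj_on_cong[THEN iffD1, rotated]) (simp add: slice2_def mem)
  ultimately show "swap_pair e \<in> bipairs K G" unfolding bipairs_def pairs_def swap_pair_def E by simp
  have "prod.swap ` ?E = E" by (simp add: image_image)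
  moreover have "restrict (?\<theta> \<circ> prod.swap) E = \<theta>"
  proof (rule extensionalityI[of _ E])
    show "\<theta> \<in> extensional E" by (rule charsD(1)[OF ch])
    show "restrict (?\<theta> \<circ> prod.swap) E x = \<theta> x" if "x \<in> E" for x
      using that th by (cases x) (simp add: mem)
  qed simp
  ultimately show "swap_pair (swap_pair e) = e" by (simp add: swap_pair_def E)
qed

lemma card_bipairs_swap:
  assumes "group G" "group K"
  shows "card (bipairs G K) = card (bipairs K G)"
proof -
  have "bij_betw swap_pair (bipairs G K) (bipairs K G)"
    by (rule bij_betw_byWitness[where f' = swap_pair])
       (use swap_pair_bipairs[OF assms] swap_pair_bipairs[OF assms(2,1)] in auto)
  then show ?thesis by (rule bij_betw_same_card)
qed

section \<open>Homomorphisms from the p-adic integers to a finite group\<close>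

locale padic_target = padic_prime p + G: comm_group G + F: comm_group F
  for p :: nat and G :: "('g, 'm) monoid_scheme" and F :: "('f, 'n) monoid_scheme" +
  fixes l :: nat
  assumes finG: "finite (carrier G)" and finF: "finite (carrier F)" and ordF: "order F = p ^ l"
begin

lemma F_pow: "y \<in> carrier F \<Longrightarrow> y [^]\<^bsub>F\<^esub> (p ^ l) = \<one>\<^bsub>F\<^esub>"
  using F.pow_order_eq_1 ordF by simp

context
  fixes \<phi> assumes \<phi>: "\<phi> \<in> Zp_Hom p F"
begin

lemma phi_closed: "z \<in> carrier R \<Longrightarrow> \<phi> z \<in> carrier F"
  and phi_add: "z \<in> carrier R \<Longrightarrow> w \<in> carrier R \<Longrightarrow> \<phi> (z \<oplus>\<^bsub>R\<^esub> w) = \<phi> z \<otimes>\<^bsub>F\<^esub> \<phi> w"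
  and phi_ext: "\<phi> \<in> extensional (carrier R)"
  using \<phi> by (auto simp: Zp_Hom_def hom_def)

lemma phi_zint_mult: "w \<in> carrier R \<Longrightarrow> \<phi> (zint (int n) \<otimes>\<^bsub>R\<^esub> w) = \<phi> w [^]\<^bsub>F\<^esub> n"
proof (induction n)
  case 0
  have "\<phi> \<zero>\<^bsub>R\<^esub> \<otimes>\<^bsub>F\<^esub> \<phi> \<zero>\<^bsub>R\<^esub> = \<phi> \<zero>\<^bsub>R\<^esub>" using phi_add[of "\<zero>\<^bsub>R\<^esub>" "\<zero>\<^bsub>R\<^esub>"] by simp
  then have "\<phi> \<zero>\<^bsub>R\<^esub> = \<one>\<^bsub>F\<^esub>" using phi_closed[OF R.zero_closed] F.l_cancel_one by blast
  then show ?case using 0 by (simp add: zint_0)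
next
  case (Suc n)
  have "zint (int (Suc n)) \<otimes>\<^bsub>R\<^esub> w = zint (int n) \<otimes>\<^bsub>R\<^esub> w \<oplus>\<^bsub>R\<^esub> w"
    using Suc.prems zint_add[of "int n" 1] by (simp add: zint_1 R.l_distr add.commute)
  then show ?case using Suc phi_add[of "zint (int n) \<otimes>\<^bsub>R\<^esub> w" w] by simp
qed

text \<open>Additivity suffices: a homomorphism to a group of exponent \<open>p^l\<close> kills
  \<open>p^l Z_p\<close>, so it is determined by its value at \<open>1\<close>.\<close>

lemma phi_eq:
  assumes z: "z \<in> carrier R"
  shows "\<phi> z = \<phi> \<one>\<^bsub>R\<^esub> [^]\<^bsub>F\<^esub> nat (z l)"
proof -
  obtain w where w: "w \<in> carrier R" "z = zint (z l) \<oplus>\<^bsub>R\<^esub> (zint (int p ^ l) \<otimes>\<^bsub>R\<^esub> w)" using Zp_split[OF z] .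
  have "\<phi> z = \<phi> (zint (z l) \<oplus>\<^bsub>R\<^esub> (zint (int p ^ l) \<otimes>\<^bsub>R\<^esub> w))" by (rule arg_cong[OF w(2)])
  also have "\<dots> = \<phi> (zint (z l)) \<otimes>\<^bsub>F\<^esub> \<phi> (zint (int (p ^ l)) \<otimes>\<^bsub>R\<^esub> w)" using w(1) by (simp add: phi_add)
  also have "\<phi> (zint (int (p ^ l)) \<otimes>\<^bsub>R\<^esub> w) = \<one>\<^bsub>F\<^esub>" unfolding phi_zint_mult[OF w(1)] by (rule F_pow[OF phi_closed[OF w(1)]])
  also have "\<phi> (zint (z l)) = \<phi> \<one>\<^bsub>R\<^esub> [^]\<^bsub>F\<^esub> nat (z l)"
    using phi_zint_mult[OF R.one_closed, of "nat (z l)"] ZpD(1)[OF z] by simp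
  finally show ?thesis using phi_closed[OF R.one_closed] by simp
qed

lemma phi_image: "\<phi> ` carrier R = range (\<lambda>n::nat. \<phi> \<one>\<^bsub>R\<^esub> [^]\<^bsub>F\<^esub> n)"
proof -
  have "\<phi> \<one>\<^bsub>R\<^esub> [^]\<^bsub>F\<^esub> n \<in> \<phi> ` carrier R" for n :: nat
    using phi_zint_mult[OF R.one_closed, of n] by (metis R.one_closed R.m_closed zint_closed image_eqI)
  moreover have "\<phi> z \<in> range (\<lambda>n::nat. \<phi> \<one>\<^bsub>R\<^esub> [^]\<^bsub>F\<^esub> n)" if "z \<in> carrier R" for z
    unfolding phi_eq[OF that] by (rule rangeI)
  ultimately show ?thesis by blast
qed

lemma subgroup_phi_image: "subgroup (\<phi> ` carrier R) F"
proof -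
  have "group_hom (add_monoid R) F \<phi>"
    using \<phi> R.a_group F.is_group by (simp add: group_hom_def group_hom_axioms_def Zp_Hom_def)
  then have "subgroup (\<phi> ` carrier (add_monoid R)) F" by (rule group_hom.img_is_subgroup)
  then show ?thesis by simp
qed

end

lemma phi_unique:
  assumes "\<phi> \<in> Zp_Hom p F" "\<phi>' \<in> Zp_Hom p F" "\<phi> \<one>\<^bsub>R\<^esub> = \<phi>' \<one>\<^bsub>R\<^esub>"
  shows "\<phi> = \<phi>'"
proof (rule extensionalityI[OF phi_ext[OF assms(1)] phi_ext[OF assms(2)]])
  fix z assume z: "z \<in> carrier R"
  show "\<phi> z = \<phi>' z" unfolding phi_eq[OF assms(1) z] phi_eq[OF assms(2) z] assms(3) ..
qed

lemma finite_Zp_Hom: "finite (Zp_Hom p F)"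
proof (rule inj_on_finite[of "\<lambda>\<phi>. \<phi> \<one>\<^bsub>R\<^esub>"])
  show "inj_on (\<lambda>\<phi>. \<phi> \<one>\<^bsub>R\<^esub>) (Zp_Hom p F)" using phi_unique by (auto intro: inj_onI)
  show "(\<lambda>\<phi>. \<phi> \<one>\<^bsub>R\<^esub>) ` Zp_Hom p F \<subseteq> carrier F" using phi_closed by auto
qed (rule finF)

lemma F_pow_mod:
  assumes "g \<in> carrier F"
  shows "g [^]\<^bsub>F\<^esub> (n mod p ^ l) = g [^]\<^bsub>F\<^esub> n"
proof -
  have "g [^]\<^bsub>F\<^esub> (p ^ l * (n div p ^ l)) = \<one>\<^bsub>F\<^esub>"
    using F_pow[OF assms] assms by (simp add: F.nat_pow_pow[symmetric])
  then show ?thesis using F.nat_pow_mult[OF assms, of "p ^ l * (n div p ^ l)" "n mod p ^ l"] assms by simp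
qed

lemma phi_exists:
  assumes x: "x \<in> carrier F"
  obtains \<phi> where "\<phi> \<in> Zp_Hom p F" "\<phi> \<one>\<^bsub>R\<^esub> = x"
proof
  define \<phi> where "\<phi> = (\<lambda>z\<in>carrier R. x [^]\<^bsub>F\<^esub> nat (z l))"
  have "nat ((z \<oplus>\<^bsub>R\<^esub> w) l) = (nat (z l) + nat (w l)) mod p ^ l" if "z \<in> carrier R" "w \<in> carrier R" for z w
    using ZpD(1)[OF that(1), of l] ZpD(1)[OF that(2), of l]
    by (simp add: Zp_simps nat_mod_distrib nat_add_distrib nat_power_eq)
  then show "\<phi> \<in> Zp_Hom p F"
    using x by (auto simp: Zp_Hom_def hom_def \<phi>_def F_pow_mod F.nat_pow_mult)
  have "nat (\<one>\<^bsub>R\<^esub> l) = 1 mod p ^ l" by (simp add: Zp_simps nat_mod_distrib nat_power_eq)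
  then show "\<phi> \<one>\<^bsub>R\<^esub> = x" using F_pow_mod[OF x, of 1] x by (simp add: \<phi>_def)
qed

end

section \<open>Pairs projecting onto the second factor\<close>

lemma root_pow_eq_1:
  assumes "N > 0"
  shows "cis (2 * pi / real N) ^ n = 1 \<longleftrightarrow> N dvd n"
proof -
  have N: "cis (2 * pi / real N) ^ N = 1" using assms by (simp add: Complex.DeMoivre)
  have "cis (2 * pi / real N) ^ n = cis (2 * pi / real N) ^ (N * (n div N) + n mod N)" by simp
  also have "\<dots> = cis (2 * pi / real N) ^ (n mod N)" unfolding power_add power_mult N by simp
  also have "\<dots> = cis (2 * pi * real (n mod N) / real N)" by (simp add: Complex.DeMoivre mult_ac)
  finally have e: "cis (2 * pi / real N) ^ n = cis (2 * pi * real (n mod N) / real N)" .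
  have inj: "inj_on (\<lambda>j. cis (2 * pi * real j / real N)) {..<N}"
    using Complex.bij_betw_roots_unity[OF assms] unfolding bij_betw_def by blast
  show ?thesis
  proof
    assume "cis (2 * pi / real N) ^ n = 1"
    then have "cis (2 * pi * real (n mod N) / real N) = cis (2 * pi * real 0 / real N)" using e by simp
    then have "n mod N = 0" using inj_onD[OF inj, of "n mod N" 0] assms by simp
    then show "N dvd n" by blast
  next
    assume "N dvd n"
    then show "cis (2 * pi / real N) ^ n = 1" using e by simp
  qed
qed

lemma (in group) mem_coset_class_iff:
  assumes "subgroup I G" "C \<in> rcosets I" "f \<in> carrier G"
  shows "f \<in> C \<longleftrightarrow> I #> f = C"
proof -
  obtain b where b: "b \<in> carrier G" "C = I #> b" using assms(2) by (auto simp: RCOSETS_def)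
  show ?thesis
    using repr_independence[OF _ b(1) assms(1), of f] rcos_self[OF assms(3,1)] b(2) by auto
qed

lemma pow_DirProd_one:
  assumes "group G" "group K" "x \<in> carrier K"
  shows "(\<one>\<^bsub>G\<^esub>, x) [^]\<^bsub>G \<times>\<times> K\<^esub> (n::nat) = (\<one>\<^bsub>G\<^esub>, x [^]\<^bsub>K\<^esub> n)"
proof -
  interpret G: group G by fact
  interpret K: group K by fact
  show ?thesis by (induction n) (use assms in auto)
qed

context padic_target
begin

text \<open>The fibre product of \<open>s\<close> with the projection from \<open>F\<close> onto the
  cokernel of \<phi>; its slice over \<open>1\<close> is the image of \<phi>.\<close>

definition equalizer where
  "equalizer \<phi> s = {(g, f). g \<in> carrier G \<and> f \<in> carrier F \<and> (\<phi> ` carrier R) #>\<^bsub>F\<^esub> f = s g}"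

text \<open>A normalisation: in a pair \<theta> is injective on the slice, so exactly one element of
  the slice has the primitive root \<open>cis (2 * pi / |I|)\<close> as its value. Taking that
  element for \<open>\<phi> 1\<close> makes \<phi> recoverable from the pair.\<close>

definition root_chars where
  "root_chars \<phi> s = {\<theta> \<in> chars (G \<times>\<times> F) (equalizer \<phi> s).
     \<theta> (\<one>\<^bsub>G\<^esub>, \<phi> \<one>\<^bsub>R\<^esub>) = cis (2 * pi / real (card (\<phi> ` carrier R)))}"

lemma mem_equalizer: "(g, f) \<in> equalizer \<phi> s \<longleftrightarrow> g \<in> carrier G \<and> f \<in> carrier F \<and> (\<phi> ` carrier R) #>\<^bsub>F\<^esub> f = s g"
  by (simp add: equalizer_def)

lemma GF: "group (G \<times>\<times> F)" "comm_group (G \<times>\<times> F)" "finite (carrier (G \<times>\<times> F))"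
  using DirProd_group[OF G.is_group F.is_group] comm_group_DirProd[OF G.comm_group_axioms F.comm_group_axioms] finG finF by auto

context
  fixes \<phi> s assumes \<phi>: "\<phi> \<in> Zp_Hom p F" and s: "s \<in> Sur G (coker p F \<phi>)"
begin

abbreviation (input) I where "I \<equiv> \<phi> ` carrier R"

lemma I: "subgroup I F" by (rule subgroup_phi_image[OF \<phi>])

lemma finI: "finite I" "card I > 0"
  using finite_subset[OF subgroup.subset[OF I] finF] subgroup.one_closed[OF I] by (auto simp: card_gt_0_iff)

lemma quot_F: "coker p F \<phi> = F Mod I" by (simp add: coker_def)

lemma s_props: "s \<in> hom G (F Mod I)" "s ` carrier G = rcosets\<^bsub>F\<^esub> I" "s \<in> extensional (carrier G)"
  using s by (auto simp: Sur_def epi_def quot_F FactGroup_def)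

lemma s_in: "g \<in> carrier G \<Longrightarrow> s g \<in> rcosets\<^bsub>F\<^esub> I"
  using s_props(2) by blast

lemma s_one: "s \<one>\<^bsub>G\<^esub> = I"
proof -
  interpret S: group_hom G "F Mod I" s
    using s_props(1) G.is_group comm_group.axioms(2)[OF FactGroup_epi(3)[OF F.comm_group_axioms I]]
    by (simp add: group_hom_def group_hom_axioms_def)
  show ?thesis using S.hom_one by (simp add: FactGroup_def)
qed

lemma subgroup_equalizer: "subgroup (equalizer \<phi> s) (G \<times>\<times> F)"
proof (rule group.subgroupI[OF GF(1)])
  show "equalizer \<phi> s \<subseteq> carrier (G \<times>\<times> F)" by (auto simp: equalizer_def)
  have "I #>\<^bsub>F\<^esub> \<one>\<^bsub>F\<^esub> = I" using F.coset_join2[OF F.one_closed I subgroup.one_closed[OF I]] .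
  then have "(\<one>\<^bsub>G\<^esub>, \<one>\<^bsub>F\<^esub>) \<in> equalizer \<phi> s" by (simp add: mem_equalizer s_one)
  then show "equalizer \<phi> s \<noteq> {}" by blast
  interpret S: group_hom G "F Mod I" s
    using s_props(1) G.is_group comm_group.axioms(2)[OF FactGroup_epi(3)[OF F.comm_group_axioms I]]
    by (simp add: group_hom_def group_hom_axioms_def)
  have "(\<lambda>x. I #>\<^bsub>F\<^esub> x) \<in> hom F (F Mod I)" using FactGroup_epi(1)[OF F.comm_group_axioms I] by (simp add: epi_def)
  then interpret C: group_hom F "F Mod I" "\<lambda>x. I #>\<^bsub>F\<^esub> x"
    using F.is_group comm_group.axioms(2)[OF FactGroup_epi(3)[OF F.comm_group_axioms I]]
    by (simp add: group_hom_def group_hom_axioms_def)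
  fix a b assume "a \<in> equalizer \<phi> s" "b \<in> equalizer \<phi> s"
  then obtain g f g' f' where ab: "a = (g, f)" "g \<in> carrier G" "f \<in> carrier F" "I #>\<^bsub>F\<^esub> f = s g"
    "b = (g', f')" "g' \<in> carrier G" "f' \<in> carrier F" "I #>\<^bsub>F\<^esub> f' = s g'"
    by (cases a; cases b) (auto simp: mem_equalizer)
  show "a \<otimes>\<^bsub>G \<times>\<times> F\<^esub> b \<in> equalizer \<phi> s"
    unfolding ab(1,5) mult_DirProd mem_equalizer
    using ab C.hom_mult[OF ab(3,7)] S.hom_mult[OF ab(2,6)] by simp
  have "I #>\<^bsub>F\<^esub> (inv\<^bsub>F\<^esub> f) = s (inv\<^bsub>G\<^esub> g)" using C.hom_inv[OF ab(3)] S.hom_inv[OF ab(2)] ab(4) by simp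
  then show "inv\<^bsub>G \<times>\<times> F\<^esub> a \<in> equalizer \<phi> s"
    unfolding ab(1) inv_DirProd[OF G.is_group F.is_group ab(2,3)] mem_equalizer using ab by simp
qed

lemma fst_equalizer: "fst ` equalizer \<phi> s = carrier G"
proof -
  have "\<exists>f. (g, f) \<in> equalizer \<phi> s" if g: "g \<in> carrier G" for g
    using s_in[OF g] g by (auto simp: mem_equalizer RCOSETS_def)
  then have "carrier G \<subseteq> fst ` equalizer \<phi> s" by (metis fst_conv image_eqI subsetI)
  then show ?thesis by (auto simp: mem_equalizer)
qed

lemma snd_equalizer: "snd ` equalizer \<phi> s = carrier F"
proof -
  have "\<exists>g. (g, f) \<in> equalizer \<phi> s" if f: "f \<in> carrier F" for f
  proof -
    have "I #>\<^bsub>F\<^esub> f \<in> s ` carrier G" unfolding s_props(2) using f by (auto simp: RCOSETS_def)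
    then show ?thesis using f by (auto simp: mem_equalizer)
  qed
  then have "carrier F \<subseteq> snd ` equalizer \<phi> s" by (metis snd_conv image_eqI subsetI)
  then show ?thesis by (auto simp: mem_equalizer)
qed

lemma fibre_equalizer: "g \<in> carrier G \<Longrightarrow> {f. (g, f) \<in> equalizer \<phi> s} = s g"
proof -
  assume g: "g \<in> carrier G"
  have "s g \<subseteq> carrier F" using F.rcosets_part_G[OF I] s_in[OF g] by blast
  then show ?thesis using F.mem_coset_class_iff[OF I s_in[OF g]] g by (auto simp: mem_equalizer)
qed

lemma slice2_equalizer: "slice2 G (equalizer \<phi> s) = I"
  using fibre_equalizer[OF G.one_closed] s_one by (simp add: slice2_def)

lemma card_equalizer: "card (equalizer \<phi> s) = card (carrier G) * card I"
proof -
  have "(g, f) \<in> equalizer \<phi> s \<longleftrightarrow> g \<in> carrier G \<and> f \<in> s g" for g f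
  proof (cases "g \<in> carrier G")
    case True
    have "f \<in> {f. (g, f) \<in> equalizer \<phi> s} \<longleftrightarrow> f \<in> s g" unfolding fibre_equalizer[OF True] ..
    then show ?thesis using True by simp
  qed (simp add: mem_equalizer)
  then have "equalizer \<phi> s = Sigma (carrier G) s" by auto
  moreover have "card (s g) = card I" if "g \<in> carrier G" for g
    using F.card_rcosets_equal[OF s_in[OF that]] subgroup.subset[OF I] by simp
  moreover have "finite (s g)" if "g \<in> carrier G" for g
  proof (rule finite_subset[OF _ finF])
    show "s g \<subseteq> carrier F" using F.rcosets_part_G[OF I] s_in[OF that] by blast
  qed
  ultimately show ?thesis using finG by (simp add: card_SigmaI)
qed

lemma one_I: "\<phi> \<one>\<^bsub>R\<^esub> \<in> I" "\<phi> \<one>\<^bsub>R\<^esub> \<in> carrier F"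
  using phi_closed[OF \<phi>] by auto

lemma one_equalizer: "(\<one>\<^bsub>G\<^esub>, \<phi> \<one>\<^bsub>R\<^esub>) \<in> equalizer \<phi> s"
proof -
  have "\<phi> \<one>\<^bsub>R\<^esub> \<in> slice2 G (equalizer \<phi> s)" unfolding slice2_equalizer by (rule one_I(1))
  then show ?thesis by (simp only: slice2_def mem_Collect_eq)
qed

text \<open>The value at the generator \<open>\<phi> 1\<close> fixes \<theta> on the slice, whose
  index in the fibre product is \<open>|G|\<close>.\<close>

lemma card_root_chars: "card (root_chars \<phi> s) = card (carrier G)"
proof -
  have cI: "card ({\<one>\<^bsub>G\<^esub>} \<times> I) = card I" by (simp add: card_cartesian_product)
  have "card (root_chars \<phi> s) * card ({\<one>\<^bsub>G\<^esub>} \<times> I) = card (equalizer \<phi> s)"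
    unfolding root_chars_def
  proof (rule comm_group.card_chars_value[OF GF(2,3) subgroup_equalizer one_equalizer])
    show "subgroup ({\<one>\<^bsub>G\<^esub>} \<times> I) (G \<times>\<times> F)"
      by (rule DirProd_subgroups[OF G.is_group G.triv_subgroup F.is_group I])
    show "(\<one>\<^bsub>G\<^esub>, \<phi> \<one>\<^bsub>R\<^esub>) \<in> {\<one>\<^bsub>G\<^esub>} \<times> I" using one_I by simp
    show "cis (2 * pi / real (card I)) ^ card ({\<one>\<^bsub>G\<^esub>} \<times> I) = 1"
      unfolding cI by (rule iffD2[OF root_pow_eq_1[OF finI(2)] dvd_refl])
    fix U assume U: "subgroup U (G \<times>\<times> F)" "(\<one>\<^bsub>G\<^esub>, \<phi> \<one>\<^bsub>R\<^esub>) \<in> U"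
    have "(\<one>\<^bsub>G\<^esub>, \<phi> \<one>\<^bsub>R\<^esub> [^]\<^bsub>F\<^esub> n) \<in> U" for n :: nat
      using group.subgroup_nat_pow_closed[OF GF(1) U, of n] pow_DirProd_one[OF G.is_group F.is_group one_I(2)] by simp
    then show "{\<one>\<^bsub>G\<^esub>} \<times> I \<subseteq> U" unfolding phi_image[OF \<phi>] by blast
  qed
  then show ?thesis unfolding cI card_equalizer using finI(2) by simp
qed

lemma root_chars_pow:
  assumes "\<theta> \<in> root_chars \<phi> s"
  shows "\<theta> (\<one>\<^bsub>G\<^esub>, \<phi> \<one>\<^bsub>R\<^esub> [^]\<^bsub>F\<^esub> (n::nat)) = cis (2 * pi / real (card I)) ^ n"
proof -
  have \<theta>: "\<theta> \<in> chars (G \<times>\<times> F) (equalizer \<phi> s)" "\<theta> (\<one>\<^bsub>G\<^esub>, \<phi> \<one>\<^bsub>R\<^esub>) = cis (2 * pi / real (card I))"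
    using assms unfolding root_chars_def by blast+
  have "\<theta> ((\<one>\<^bsub>G\<^esub>, \<phi> \<one>\<^bsub>R\<^esub>) [^]\<^bsub>G \<times>\<times> F\<^esub> n) = \<theta> (\<one>\<^bsub>G\<^esub>, \<phi> \<one>\<^bsub>R\<^esub>) ^ n"
    by (rule chars_pow[OF GF(1) subgroup_equalizer \<theta>(1) one_equalizer])
  then show ?thesis unfolding pow_DirProd_one[OF G.is_group F.is_group one_I(2)] \<theta>(2) .
qed

text \<open>The powers of \<open>\<phi> 1\<close> exhaust the slice, and the value at
  \<open>\<phi> 1\<close> is a primitive root of order \<open>|I|\<close>; so powers with equal
  values have exponents congruent modulo \<open>|I|\<close> and are equal.\<close>

lemma root_chars_pairs:
  assumes "\<theta> \<in> root_chars \<phi> s"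
  shows "(equalizer \<phi> s, \<theta>) \<in> pairs G F"
proof -
  have ch: "\<theta> \<in> chars (G \<times>\<times> F) (equalizer \<phi> s)" using assms by (simp add: root_chars_def)
  have "inj_on (\<lambda>f. \<theta> (\<one>\<^bsub>G\<^esub>, f)) I"
  proof (rule inj_onI)
    fix f f' assume "f \<in> I" "f' \<in> I" and eq: "\<theta> (\<one>\<^bsub>G\<^esub>, f) = \<theta> (\<one>\<^bsub>G\<^esub>, f')"
    then obtain n m :: nat where nm: "f = \<phi> \<one>\<^bsub>R\<^esub> [^]\<^bsub>F\<^esub> n" "f' = \<phi> \<one>\<^bsub>R\<^esub> [^]\<^bsub>F\<^esub> m"
      unfolding phi_image[OF \<phi>] by blast
    have key: "\<phi> \<one>\<^bsub>R\<^esub> [^]\<^bsub>F\<^esub> n = \<phi> \<one>\<^bsub>R\<^esub> [^]\<^bsub>F\<^esub> m"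
      if nm: "n \<le> m" "cis (2 * pi / real (card I)) ^ n = cis (2 * pi / real (card I)) ^ m" for n m :: nat
    proof -
      have "cis (2 * pi / real (card I)) ^ n * cis (2 * pi / real (card I)) ^ (m - n) = cis (2 * pi / real (card I)) ^ n"
        unfolding power_add[symmetric] using nm by simp
      then have "cis (2 * pi / real (card I)) ^ (m - n) = 1" by simp
      then obtain t where t: "m - n = card I * t" using root_pow_eq_1[OF finI(2)] by (auto elim: dvdE)
      have "\<phi> \<one>\<^bsub>R\<^esub> [^]\<^bsub>F\<^esub> (m - n) = \<one>\<^bsub>F\<^esub>"
        unfolding t F.nat_pow_pow[OF one_I(2), symmetric] F.subgroup_pow_card[OF I one_I(1)] by simp
      then show ?thesis using F.nat_pow_mult[OF one_I(2), of n "m - n"] nm(1) one_I(2) by simp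
    qed
    show "f = f'"
    proof (cases "n \<le> m")
      case True then show ?thesis unfolding nm using key[of n m] eq root_chars_pow[OF assms] nm by simp
    next
      case False then show ?thesis unfolding nm using key[of m n] eq root_chars_pow[OF assms] nm by simp
    qed
  qed
  then show ?thesis using subgroup_equalizer fst_equalizer ch slice2_equalizer by (simp add: pairs_def)
qed

end

text \<open>Being injective, \<theta> takes on the slice every root of unity of the right order, so
  the slice is cyclic and the element with the primitive root as its value serves as
  \<open>\<phi> 1\<close>. The fibres of \<open>E\<close> over \<open>G\<close> are cosets of the
  slice, and they are the values of \<open>s\<close>.\<close>

lemma onto_pairs_eq:
  assumes "e \<in> pairs G F" "snd ` fst e = carrier F"
  shows "\<exists>\<phi>\<in>Zp_Hom p F. \<exists>s\<in>Sur G (coker p F \<phi>). \<exists>\<theta>\<in>root_chars \<phi> s. e = (equalizer \<phi> s, \<theta>)"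
proof -
  obtain E \<theta> where E: "e = (E, \<theta>)" by (cases e)
  have snd: "snd ` E = carrier F" using assms(2) E by simp
  have sub: "subgroup E (G \<times>\<times> F)" and ch: "\<theta> \<in> chars (G \<times>\<times> F) E" and fst: "fst ` E = carrier G"
    and inj: "inj_on (\<lambda>f. \<theta> (\<one>\<^bsub>G\<^esub>, f)) (slice2 G E)"
    using assms(1) unfolding E pairs_def by simp_all
  note D = subgroup_DirProdD[OF G.is_group F.is_group sub]
  let ?I = "slice2 G E"
  have I: "subgroup ?I F" by (rule subgroup_slice2[OF G.is_group F.is_group sub])
  have finI: "finite ?I" "card ?I > 0"
    using finite_subset[OF subgroup.subset[OF I] finF] subgroup.one_closed[OF I] by (auto simp: card_gt_0_iff)
  let ?N = "card ?I" and ?z = "cis (2 * pi / real (card ?I))"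
  have pw: "\<theta> (\<one>\<^bsub>G\<^esub>, t [^]\<^bsub>F\<^esub> n) = \<theta> (\<one>\<^bsub>G\<^esub>, t) ^ n" if t: "t \<in> ?I" for t and n :: nat
  proof -
    have tE: "(\<one>\<^bsub>G\<^esub>, t) \<in> E" and tF: "t \<in> carrier F" using t D(5) by (auto simp: slice2_def)
    show ?thesis using chars_pow[OF GF(1) sub ch tE, of n] pow_DirProd_one[OF G.is_group F.is_group tF, of n] by simp
  qed
  have root: "\<theta> (\<one>\<^bsub>G\<^esub>, t) ^ ?N = 1" if t: "t \<in> ?I" for t
    using pw[OF t, of ?N] F.subgroup_pow_card[OF I t] charsD(2)[OF ch] by simp
  have img: "(\<lambda>f. \<theta> (\<one>\<^bsub>G\<^esub>, f)) ` ?I = {z. z ^ ?N = 1}"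
  proof (rule card_subset_eq)
    show "finite {z::complex. z ^ ?N = 1}" using finI(2) by (rule finite_nth_roots)
    show "(\<lambda>f. \<theta> (\<one>\<^bsub>G\<^esub>, f)) ` ?I \<subseteq> {z. z ^ ?N = 1}" using root by auto
    show "card ((\<lambda>f. \<theta> (\<one>\<^bsub>G\<^esub>, f)) ` ?I) = card {z::complex. z ^ ?N = 1}"
      using card_image[OF inj] card_nth_roots[of 1 ?N] finI(2) by simp
  qed
  have "?z \<in> {z. z ^ ?N = 1}" using root_pow_eq_1[OF finI(2), of ?N] by simp
  then obtain x where x: "x \<in> ?I" "\<theta> (\<one>\<^bsub>G\<^esub>, x) = ?z" unfolding img[symmetric] by auto
  have xF: "x \<in> carrier F" using x(1) subgroup.mem_carrier[OF I] by blast
  obtain \<phi> where \<phi>: "\<phi> \<in> Zp_Hom p F" "\<phi> \<one>\<^bsub>R\<^esub> = x" by (rule phi_exists[OF xF])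
  have gen: "\<phi> ` carrier R = ?I"
  proof
    show "\<phi> ` carrier R \<subseteq> ?I" unfolding phi_image[OF \<phi>(1)] \<phi>(2) using F.subgroup_nat_pow_closed[OF I x(1)] by blast
    show "?I \<subseteq> \<phi> ` carrier R"
    proof
      fix t assume t: "t \<in> ?I"
      have "\<theta> (\<one>\<^bsub>G\<^esub>, t) \<in> {z. z ^ ?N = 1}" using root[OF t] by simp
      also have "\<dots> = (\<lambda>j. cis (2 * pi * real j / real ?N)) ` {..<?N}"
        using Complex.bij_betw_roots_unity[OF finI(2)] unfolding bij_betw_def by blast
      finally obtain j where "\<theta> (\<one>\<^bsub>G\<^esub>, t) = cis (2 * pi * real j / real ?N)" by blast
      then have "\<theta> (\<one>\<^bsub>G\<^esub>, t) = \<theta> (\<one>\<^bsub>G\<^esub>, x [^]\<^bsub>F\<^esub> j)" unfolding pw[OF x(1)] x(2) by (simp add: Complex.DeMoivre mult_ac)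
      then have "t = x [^]\<^bsub>F\<^esub> j" by (rule inj_onD[OF inj _ t F.subgroup_nat_pow_closed[OF I x(1)]])
      then show "t \<in> \<phi> ` carrier R" unfolding phi_image[OF \<phi>(1)] \<phi>(2) by blast
    qed
  qed
  have cl: "f' \<in> ?I #>\<^bsub>F\<^esub> f \<longleftrightarrow> (g, f') \<in> E" if f: "(g, f) \<in> E" for g f f'
  proof
    assume "f' \<in> ?I #>\<^bsub>F\<^esub> f"
    then obtain t where t: "(\<one>\<^bsub>G\<^esub>, t) \<in> E" "f' = t \<otimes>\<^bsub>F\<^esub> f" by (auto simp: r_coset_def slice2_def)
    then show "(g, f') \<in> E" using D(1)[OF t(1) f] D(4)[OF f] by simp
  next
    assume f': "(g, f') \<in> E"
    have "(g \<otimes>\<^bsub>G\<^esub> inv\<^bsub>G\<^esub> g, f' \<otimes>\<^bsub>F\<^esub> inv\<^bsub>F\<^esub> f) \<in> E" by (rule D(1)[OF f' D(2)[OF f]])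
    then have "f' \<otimes>\<^bsub>F\<^esub> inv\<^bsub>F\<^esub> f \<in> ?I" using D(4)[OF f] by (simp add: slice2_def)
    moreover have "f' = (f' \<otimes>\<^bsub>F\<^esub> inv\<^bsub>F\<^esub> f) \<otimes>\<^bsub>F\<^esub> f" using D(5)[OF f] D(5)[OF f'] by (simp add: F.m_assoc)
    ultimately show "f' \<in> ?I #>\<^bsub>F\<^esub> f" unfolding r_coset_def by blast
  qed
  define s where "s = (\<lambda>g\<in>carrier G. {f. (g, f) \<in> E})"
  have sg: "s g = ?I #>\<^bsub>F\<^esub> f" if "(g, f) \<in> E" for g f
    using cl[OF that] D(4)[OF that] by (auto simp: s_def)
  have lift: "\<exists>f. (g, f) \<in> E" if "g \<in> carrier G" for g
  proof -
    have "g \<in> fst ` E" using that fst by simp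
    then show ?thesis by auto
  qed
  have "s \<in> Sur G (F Mod ?I)"
  proof -
    note C = FactGroup_epi(1)[OF F.comm_group_axioms I]
    have "s \<in> hom G (F Mod ?I)"
    proof (rule homI)
      fix g assume "g \<in> carrier G"
      then obtain f where f: "(g, f) \<in> E" using lift by blast
      show "s g \<in> carrier (F Mod ?I)" unfolding sg[OF f] FactGroup_def RCOSETS_def using D(5)[OF f] by auto
    next
      fix g g' assume "g \<in> carrier G" "g' \<in> carrier G"
      then obtain f f' where f: "(g, f) \<in> E" "(g', f') \<in> E" using lift by blast
      show "s (g \<otimes>\<^bsub>G\<^esub> g') = s g \<otimes>\<^bsub>F Mod ?I\<^esub> s g'"
        unfolding sg[OF f(1)] sg[OF f(2)] sg[OF D(1)[OF f]]
        using C D(5)[OF f(1)] D(5)[OF f(2)] by (auto simp: epi_def hom_def)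
    qed
    moreover have "s ` carrier G = carrier (F Mod ?I)"
    proof
      show "s ` carrier G \<subseteq> carrier (F Mod ?I)" using \<open>s \<in> hom G (F Mod ?I)\<close> by (auto simp: hom_def)
      show "carrier (F Mod ?I) \<subseteq> s ` carrier G"
      proof
        fix C assume "C \<in> carrier (F Mod ?I)"
        then obtain f where f: "f \<in> carrier F" "C = ?I #>\<^bsub>F\<^esub> f" by (auto simp: FactGroup_def RCOSETS_def)
        then have "f \<in> snd ` E" using snd by simp
        then obtain g where g: "(g, f) \<in> E" by auto
        then show "C \<in> s ` carrier G" using sg[OF g] f(2) D(4)[OF g] by blast
      qed
    qed
    ultimately show ?thesis by (auto simp: Sur_def epi_def s_def)
  qed
  then have s: "s \<in> Sur G (coker p F \<phi>)" by (simp add: coker_def gen)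
  have "E = equalizer \<phi> s"
  proof -
    have "(g, f) \<in> E \<longleftrightarrow> (g, f) \<in> equalizer \<phi> s" for g f
    proof
      assume h: "(g, f) \<in> E"
      then show "(g, f) \<in> equalizer \<phi> s" using sg[OF h] D(4,5)[OF h] by (simp add: mem_equalizer gen)
    next
      assume h: "(g, f) \<in> equalizer \<phi> s"
      then have g: "g \<in> carrier G" "f \<in> carrier F" "?I #>\<^bsub>F\<^esub> f = s g" by (auto simp: mem_equalizer gen)
      then obtain f' where f': "(g, f') \<in> E" using lift by blast
      have "f \<in> ?I #>\<^bsub>F\<^esub> f'" using F.rcos_self[OF g(2) I] g(3) sg[OF f'] by simp
      then show "(g, f) \<in> E" using cl[OF f'] by blast
    qed
    then show ?thesis by auto
  qed
  moreover have "\<theta> \<in> root_chars \<phi> s" using ch x(2) \<phi>(2) gen calculation by (simp add: root_chars_def)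
  ultimately show ?thesis using \<phi>(1) s E by blast
qed

text \<open>Nothing is counted twice: the slice of the subgroup gives the image of \<phi>, its
  fibres give \<open>s\<close>, and \<theta> singles out \<open>\<phi> 1\<close> in the slice. Each
  choice of \<phi> and \<open>s\<close> carries \<open>|G|\<close> characters.\<close>

lemma card_onto_pairs:
  "card {e \<in> pairs G F. snd ` fst e = carrier F} = card (carrier G) * (\<Sum>\<phi>\<in>Zp_Hom p F. card (Sur G (coker p F \<phi>)))"
proof -
  let ?A = "SIGMA \<phi>:Zp_Hom p F. Sur G (coker p F \<phi>)"
  let ?T = "SIGMA a:?A. root_chars (fst a) (snd a)"
  let ?V = "{e \<in> pairs G F. snd ` fst e = carrier F}"
  let ?h = "\<lambda>(a, \<theta>). (equalizer (fst a) (snd a), \<theta>)"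
  have inj: "inj_on ?h ?T"
  proof (rule inj_onI)
    fix u v assume uv: "u \<in> ?T" "v \<in> ?T" "?h u = ?h v"
    obtain \<phi> s \<theta> \<phi>' s' \<theta>' where u: "u = ((\<phi>, s), \<theta>)" and v: "v = ((\<phi>', s'), \<theta>')" by (metis surj_pair)
    have h: "\<phi> \<in> Zp_Hom p F" "s \<in> Sur G (coker p F \<phi>)" "\<theta> \<in> root_chars \<phi> s"
      "\<phi>' \<in> Zp_Hom p F" "s' \<in> Sur G (coker p F \<phi>')" "\<theta>' \<in> root_chars \<phi>' s'"
      and eq: "equalizer \<phi> s = equalizer \<phi>' s'" "\<theta> = \<theta>'" using uv u v by auto
    have I: "\<phi> ` carrier R = \<phi>' ` carrier R" using slice2_equalizer[OF h(1,2)] slice2_equalizer[OF h(4,5)] eq(1) by simp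
    have pr: "(equalizer \<phi> s, \<theta>) \<in> pairs G F" by (rule root_chars_pairs[OF h(1,2,3)])
    have inj: "inj_on (\<lambda>f. \<theta> (\<one>\<^bsub>G\<^esub>, f)) (\<phi> ` carrier R)"
      using pr slice2_equalizer[OF h(1,2)] by (simp add: pairs_def)
    have "\<phi> \<one>\<^bsub>R\<^esub> = \<phi>' \<one>\<^bsub>R\<^esub>"
    proof (rule inj_onD[OF inj])
      show "\<theta> (\<one>\<^bsub>G\<^esub>, \<phi> \<one>\<^bsub>R\<^esub>) = \<theta> (\<one>\<^bsub>G\<^esub>, \<phi>' \<one>\<^bsub>R\<^esub>)" using h(3,6) eq(2) I by (simp add: root_chars_def)
      show "\<phi> \<one>\<^bsub>R\<^esub> \<in> \<phi> ` carrier R" by simp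
      show "\<phi>' \<one>\<^bsub>R\<^esub> \<in> \<phi> ` carrier R" unfolding I by simp
    qed
    then have p: "\<phi> = \<phi>'" by (rule phi_unique[OF h(1,4)])
    have "s = s'"
    proof (rule extensionalityI[OF s_props(3)[OF h(1,2)] s_props(3)[OF h(4,5)]])
      fix g assume g: "g \<in> carrier G"
      show "s g = s' g" using fibre_equalizer[OF h(1,2) g] fibre_equalizer[OF h(4,5) g] eq(1) by simp
    qed
    then show "u = v" using p eq(2) u v by simp
  qed
  have "?h ` ?T = ?V"
  proof
    show "?h ` ?T \<subseteq> ?V"
    proof
      fix e assume "e \<in> ?h ` ?T"
      then obtain \<phi> s \<theta> where h: "\<phi> \<in> Zp_Hom p F" "s \<in> Sur G (coker p F \<phi>)" "\<theta> \<in> root_chars \<phi> s" "e = (equalizer \<phi> s, \<theta>)"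
        by auto
      show "e \<in> ?V" unfolding h(4) using root_chars_pairs[OF h(1-3)] snd_equalizer[OF h(1,2)] by simp
    qed
    show "?V \<subseteq> ?h ` ?T"
    proof
      fix e assume "e \<in> ?V"
      then have "\<exists>\<phi>\<in>Zp_Hom p F. \<exists>s\<in>Sur G (coker p F \<phi>). \<exists>\<theta>\<in>root_chars \<phi> s. e = (equalizer \<phi> s, \<theta>)"
        by (intro onto_pairs_eq) simp_all
      then obtain \<phi> s \<theta> where h: "\<phi> \<in> Zp_Hom p F" "s \<in> Sur G (coker p F \<phi>)" "\<theta> \<in> root_chars \<phi> s" "e = (equalizer \<phi> s, \<theta>)"
        by blast
      show "e \<in> ?h ` ?T" by (rule image_eqI[of _ _ "((\<phi>, s), \<theta>)"]) (use h in auto)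
    qed
  qed
  then have e: "card ?V = card ?T" using card_image[OF inj] by simp
  have fin: "finite (Sur G (coker p F \<phi>))" for \<phi>
  proof -
    have "finite (carrier (coker p F \<phi>))"
      using finF by (simp add: coker_def FactGroup_def RCOSETS_def)
    then have "finite (carrier G \<rightarrow>\<^sub>E carrier (coker p F \<phi>))" using finG by (intro finite_PiE) auto
    moreover have "Sur G (coker p F \<phi>) \<subseteq> carrier G \<rightarrow>\<^sub>E carrier (coker p F \<phi>)"
      by (auto simp: Sur_def epi_def hom_def PiE_def)
    ultimately show ?thesis by (rule finite_subset[rotated])
  qed
  have fA: "finite ?A" using finite_Zp_Hom fin by (rule finite_SigmaI)
  have "card (root_chars (fst a) (snd a)) = card (carrier G)" if "a \<in> ?A" for a
    using card_root_chars[of "fst a" "snd a"] that by auto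
  moreover have "finite (root_chars \<phi> s)" if "\<phi> \<in> Zp_Hom p F" "s \<in> Sur G (coker p F \<phi>)" for \<phi> s
  proof (rule card_ge_0_finite)
    show "card (root_chars \<phi> s) > 0" unfolding card_root_chars[OF that] using finG G.one_closed by (auto simp: card_gt_0_iff)
  qed
  ultimately have "card ?T = (\<Sum>a\<in>?A. card (carrier G))" using fA by (subst card_SigmaI) auto
  also have "\<dots> = card (carrier G) * (\<Sum>\<phi>\<in>Zp_Hom p F. card (Sur G (coker p F \<phi>)))"
    using finite_Zp_Hom fin by (simp add: card_SigmaI mult.commute)
  finally show ?thesis using e by simp
qed

end

section \<open>Reversibility and moments\<close>

lemma order_pos:
  assumes "fin_ab_p_group p G"
  shows "order G > 0"
  using fin_ab_p_groupD(3)[OF assms] group.is_monoid[OF fin_ab_p_groupD(2)[OF assms]]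
  by (metis Coset.order_def card_gt_0_iff empty_iff monoid.one_closed)

text \<open>\<open>class1\<close> and \<open>rep\<close> replace the middle term by an isomorphic
  copy. The copy is again an extension with the same character, and only the character enters the
  counts.\<close>

lemma d_law_rep:
  fixes G :: "nat monoid"
  assumes "prime p" "fin_ab_p_group p G" "order G = p ^ k" "is_extension p G x"
  obtains H :: padic_module and i q where
    "padic_ext p H G i q k" "padic_ext.chi p H G i q k = ext_char p G k x"
    "\<forall>c. emeasure (d_law p (class1 p (fst x))) {c} = emeasure (haar p H) {h \<in> carrier H. padic_ext.cls p H h = c}"
proof -
  obtain H i q where x: "x = (H, i, q)" by (metis prod_cases3)
  interpret E: padic_ext p H G i q k using padic_extI[OF assms(1-3)] assms(4) x by simp
  define H' where "H' = rep (class1 p H)"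
  have "(\<lambda>y. y) \<in> mod_iso (Zp p) H H" by (simp add: mod_iso_def mod_hom_def hom_def bij_betw_def)
  then have "H \<in> class1 p H" unfolding class1_def using E.rank1 by blast
  then have "class1 p H \<noteq> {}" by blast
  then have "H' \<in> class1 p H" unfolding H'_def by (rule rep_in)
  then obtain f where "Module.module (Zp p) H'" "f \<in> mod_iso (Zp p) H' H"
    by (auto simp: class1_def rank1_module_def)
  then obtain i' q' where E': "padic_ext p H' G i' q' k" "padic_ext.chi p H' G i' q' k = E.chi"
    by (rule E.transport)
  interpret E': padic_ext p H' G i' q' k by (rule E'(1))
  have "emeasure (d_law p (class1 p (fst x))) {c} = emeasure (haar p H') {h \<in> carrier H'. E'.cls h = c}" for c
  proof -
    have "d_law p (class1 p (fst x)) = distr (haar p H') (count_space UNIV) E'.cls"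
      unfolding d_law_def x fst_conv H'_def[symmetric] E'.cls_def ..
    then have "emeasure (d_law p (class1 p (fst x))) {c} = emeasure (haar p H') (E'.cls -` {c} \<inter> space (haar p H'))"
      using emeasure_distr[OF E'.cls_measurable, of "{c}"] by simp
    moreover have "E'.cls -` {c} \<inter> space (haar p H') = {h \<in> carrier H'. E'.cls h = c}" by (auto simp: E'.haar_facts(1))
    ultimately show ?thesis by simp
  qed
  then show thesis by (intro that[OF E'(1)] allI) (simp_all add: E'(2) x ext_char_def)
qed

lemma finite_Ext:
  assumes "prime p" "fin_ab_p_group p G"
  shows "finite (Ext p G)" "card (Ext p G) = order G"
proof -
  interpret G: comm_group G by (rule fin_ab_p_groupD(1)[OF assms(2)])
  note fin = fin_ab_p_groupD(3)[OF assms(2)]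
  obtain k where k: "order G = p ^ k" using fin_ab_p_groupD(4)[OF assms(2)] by blast
  note b = bij_Ext_chars[OF assms k]
  show "finite (Ext p G)" using bij_betw_finite[OF b] G.card_chars(2)[OF fin G.subgroup_self] by simp
  show "card (Ext p G) = order G"
    using bij_betw_same_card[OF b] G.card_chars(1)[OF fin G.subgroup_self] by (simp add: Coset.order_def)
qed

lemma Delta0_prob_sum:
  assumes "prime p" "c \<in> X0 p"
  shows "Delta0_prob p c c' =
    (\<Sum>e\<in>Ext p (rep c). emeasure (d_law p (class1 p (fst (rep e)))) {c'}) / of_nat (order (rep c))"
proof -
  note G = X0_rep(1)[OF assms(2)]
  note E = finite_Ext[OF assms(1) G]
  have "order (rep c) > 0" by (rule order_pos[OF G])
  then have "Ext p (rep c) \<noteq> {}" using E(2) by force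
  then show ?thesis
    using E by (simp add: Delta0_prob_def dstar_law_def nn_integral_pmf_of_set)
qed

lemma sum_Ext_pairs:
  assumes p: "prime p" and G: "fin_ab_p_group p G" "order G = p ^ k" and K: "fin_ab_p_group p K"
  shows "(\<Sum>e\<in>Ext p G. card {d \<in> pairs G K. pair_char G (ext_char p G k (rep e)) d \<and> Q d}) = card {d \<in> pairs G K. Q d}"
  unfolding sum_chars_pairs[OF fin_ab_p_groupD(1)[OF G(1)] fin_ab_p_groupD(1)[OF K] fin_ab_p_groupD(3)[OF G(1)] fin_ab_p_groupD(3)[OF K], of Q, symmetric]
  by (rule sum.reindex_bij_betw[OF bij_Ext_chars[OF p G]])

lemma padic_ext_targetI:
  assumes "padic_ext p H G i q k" "fin_ab_p_group p K"
  obtains l where "padic_ext_target p H G i q k K l"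
proof -
  obtain l where "order K = p ^ l" using fin_ab_p_groupD(4)[OF assms(2)] by blast
  then have "padic_ext_target p H G i q k K l"
    by (intro padic_ext_target.intro padic_ext_target_axioms.intro assms(1) fin_ab_p_groupD(1,3)[OF assms(2)])
  then show thesis by (rule that)
qed

lemma card_auto_pos:
  assumes "group K" "finite (carrier K)"
  shows "card (auto K) > 0"
proof -
  interpret group K by fact
  have "auto K \<subseteq> carrier K \<rightarrow>\<^sub>E carrier K" by (auto simp: auto_eq_Sur[OF assms(2)] Sur_def epi_def hom_def PiE_def)
  moreover have "finite (carrier K \<rightarrow>\<^sub>E carrier K)" using assms(2) by (intro finite_PiE) auto
  moreover have "(\<lambda>x\<in>carrier K. x) \<in> auto K" by (rule id_in_auto)
  ultimately show ?thesis by (metis card_gt_0_iff empty_iff finite_subset)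
qed

text \<open>For one extension the probability is a constant that depends only on
  \<open>rep c'\<close> times the number of symmetric pairs compatible with its character; the sum
  over extensions collects all of \<open>bipairs\<close>.\<close>

lemma Delta0_prob_eq:
  assumes p: "prime p" and c: "c \<in> X0 p" and c': "c' \<in> X0 p"
  shows "Delta0_prob p c c' = ennreal (real (card (bipairs (rep c) (rep c'))) * (1 - 1 / real p) /
    (real (order (rep c)) * real (order (rep c')) * real (card (auto (rep c')))))"
proof -
  let ?G = "rep c" and ?K = "rep c'"
  note G = X0_rep(1)[OF c] and K = X0_rep(1)[OF c']
  obtain k where k: "order ?G = p ^ k" using fin_ab_p_groupD(4)[OF G] by blast
  let ?Q = "\<lambda>d. snd ` fst d = carrier ?K \<and> inj_on (\<lambda>g. snd d (g, \<one>\<^bsub>?K\<^esub>)) (slice1 ?K (fst d))"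
  let ?N = "\<lambda>e. card {d \<in> pairs ?G ?K. pair_char ?G (ext_char p ?G k (rep e)) d \<and> ?Q d}"
  let ?w = "(1 - 1 / real p) / real (order ?K) / real (card (auto ?K))"
  have a: "card (auto ?K) > 0" by (rule card_auto_pos[OF fin_ab_p_groupD(2,3)[OF K]])
  have o: "order ?G > 0"
    by (rule order_pos[OF G])
  have w: "?w \<ge> 0" using prime_gt_0_nat[OF p] by (simp add: field_simps)
  have "emeasure (d_law p (class1 p (fst (rep e)))) {c'} = ennreal (real (?N e) * ?w)" if e: "e \<in> Ext p ?G" for e
  proof -
    obtain H :: padic_module and i q where H: "padic_ext p H ?G i q k" "padic_ext.chi p H ?G i q k = ext_char p ?G k (rep e)"
      "\<forall>c. emeasure (d_law p (class1 p (fst (rep e)))) {c} = emeasure (haar p H) {h \<in> carrier H. padic_ext.cls p H h = c}"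
      by (rule d_law_rep[OF p G k Ext_rep(1)[OF p G k e]])
    obtain l where "padic_ext_target p H ?G i q k ?K l" by (rule padic_ext_targetI[OF H(1) K])
    then interpret T: padic_ext_target p H ?G i q k ?K l .
    have "T.SurC = {\<psi> \<in> T.homs. \<psi> ` carrier H = carrier ?K \<and> (\<exists>v\<in>carrier H. kernel (add_monoid H) ?K \<psi> = T.cyc v)}"
      unfolding T.SurC_def T.Sur_eq_homs by blast
    then have n: "card T.SurC = ?N e"
      unfolding T.card_surj_cyclic_homs T.chi_pairs_eq H(2) by (simp add: T.card_surj_cyclic_homs T.chi_pairs_eq H(2) conj_ac)
    have "{h \<in> carrier H. T.cls h = c'} = {h \<in> carrier H. quot_elem p H h \<cong> ?K}"
      using T.cls_eq_iff[OF _ c'] by blast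
    then have "emeasure (d_law p (class1 p (fst (rep e)))) {c'} = ennreal (measure (haar p H) {h \<in> carrier H. quot_elem p H h \<cong> ?K})"
      unfolding H(3)[rule_format] by (simp add: T.haar.emeasure_eq_measure)
    also have "measure (haar p H) {h \<in> carrier H. quot_elem p H h \<cong> ?K} = real (?N e) * ?w"
      using eq_divide_imp[of "real (card (auto ?K))", OF _ trans[OF mult.commute T.quotient_probability]] a
      unfolding n by (simp add: Coset.order_def)
    finally show ?thesis .
  qed
  then have "Delta0_prob p c c' = (\<Sum>e\<in>Ext p ?G. ennreal (real (?N e) * ?w)) / of_nat (order ?G)"
    unfolding Delta0_prob_sum[OF p c] by (simp only: cong: sum.cong)
  also have "(\<Sum>e\<in>Ext p ?G. ennreal (real (?N e) * ?w)) = ennreal (\<Sum>e\<in>Ext p ?G. real (?N e) * ?w)"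
    using w by (intro sum_ennreal mult_nonneg_nonneg) simp_all
  also have "(\<Sum>e\<in>Ext p ?G. real (?N e) * ?w) = real (card (bipairs ?G ?K)) * ?w"
    unfolding sum_distrib_right[symmetric] of_nat_sum[symmetric] bipairs_def
    by (subst sum_Ext_pairs[OF p G k K]) (rule refl)
  also have "ennreal (real (card (bipairs ?G ?K)) * ?w) / of_nat (order ?G) = ennreal (real (card (bipairs ?G ?K)) * ?w / real (order ?G))"
    unfolding ennreal_of_nat_eq_real_of_nat by (rule divide_ennreal[OF mult_nonneg_nonneg[OF of_nat_0_le_iff w]]) (use o in simp)
  finally show ?thesis by (simp add: mult_ac)
qed

text \<open>After multiplication by \<open>mu0\<close> the orders and the automorphism counts of
  both groups stand in both denominators, and \<open>card_bipairs_swap\<close> matches the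
  numerators. The factor \<open>r\<close> is to be a number of surjections onto
  \<open>F\<close>.\<close>

lemma Delta0_prob_reversible:
  assumes p: "prime p" and c: "c \<in> X0 p" and c': "c' \<in> X0 p" and r: "r \<ge> 0"
  shows "ennreal (r * mu0 p (rep c)) * Delta0_prob p c c' = ennreal (mu0 p (rep c')) * (ennreal r * Delta0_prob p c' c)"
proof -
  note G = fin_ab_p_groupD[OF X0_rep(1)[OF c]] and K = fin_ab_p_groupD[OF X0_rep(1)[OF c']]
  have w: "1 - 1 / real p \<ge> 0" using prime_gt_0_nat[OF p] by (simp add: field_simps)
  show ?thesis
    unfolding Delta0_prob_eq[OF p c c'] Delta0_prob_eq[OF p c' c] card_bipairs_swap[OF G(2) K(2)]
    using w r by (simp add: ennreal_mult''[symmetric] mu0_def mult_ac)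
qed

text \<open>The expected number of surjections onto \<open>F\<close> after one step from
  \<open>c\<close>. The \<open>1/|G|\<close> of the uniform choice of an extension cancels the
  \<open>|G|\<close> of \<open>card_onto_pairs\<close>, and \<open>1/|F|\<close> is the measure of
  the kernel of a surjection onto \<open>F\<close>.\<close>

lemma Delta0_dual_Sur:
  assumes p: "prime p" and F: "fin_ab_p_group p F" and c: "c \<in> X0 p"
  shows "(\<integral>\<^sup>+ c'. ennreal (real (card (Sur (rep c') F))) * Delta0_prob p c c' \<partial>count_space (X0 p)) =
    ennreal (1 / real (order F) * (\<Sum>\<phi>\<in>Zp_Hom p F. real (card (Sur (rep c) (coker p F \<phi>)))))"
proof -
  let ?G = "rep c"
  note G = X0_rep(1)[OF c]
  obtain k where k: "order ?G = p ^ k" using fin_ab_p_groupD(4)[OF G] by blast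
  have o: "order ?G > 0"
    by (rule order_pos[OF G])
  let ?N = "\<lambda>e. card {d \<in> pairs ?G F. pair_char ?G (ext_char p ?G k (rep e)) d \<and> snd ` fst d = carrier F}"
  let ?S = "\<lambda>c'. ennreal (real (card (Sur (rep c') F)))"
  let ?L = "\<lambda>e c'. emeasure (d_law p (class1 p (fst (rep e)))) {c'}"
  have L: "(\<integral>\<^sup>+ c'. ?S c' * ?L e c' \<partial>count_space (X0 p)) = ennreal (real (?N e) / real (order F))" if e: "e \<in> Ext p ?G" for e
  proof -
    obtain H :: padic_module and i q where H: "padic_ext p H ?G i q k" "padic_ext.chi p H ?G i q k = ext_char p ?G k (rep e)"
      "\<forall>c. emeasure (d_law p (class1 p (fst (rep e)))) {c} = emeasure (haar p H) {h \<in> carrier H. padic_ext.cls p H h = c}"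
      by (rule d_law_rep[OF p G k Ext_rep(1)[OF p G k e]])
    obtain l where "padic_ext_target p H ?G i q k F l" by (rule padic_ext_targetI[OF H(1) F])
    then interpret T: padic_ext_target p H ?G i q k F l .
    have "card (Sur (add_monoid H) F) = ?N e"
      unfolding T.Sur_eq_homs T.card_surj_homs T.chi_pairs_eq H(2) by simp
    then show ?thesis using T.moment_sum unfolding H(3)[rule_format] by (simp add: Coset.order_def)
  qed
  have "(\<integral>\<^sup>+ c'. ?S c' * Delta0_prob p c c' \<partial>count_space (X0 p)) =
    (\<integral>\<^sup>+ c'. (\<Sum>e\<in>Ext p ?G. ?S c' * ?L e c') / of_nat (order ?G) \<partial>count_space (X0 p))"
    unfolding Delta0_prob_sum[OF p c] by (simp add: sum_distrib_left ennreal_times_divide)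
  also have "\<dots> = (\<integral>\<^sup>+ c'. (\<Sum>e\<in>Ext p ?G. ?S c' * ?L e c') \<partial>count_space (X0 p)) / of_nat (order ?G)"
    by (rule nn_integral_divide) simp
  also have "(\<integral>\<^sup>+ c'. (\<Sum>e\<in>Ext p ?G. ?S c' * ?L e c') \<partial>count_space (X0 p)) = (\<Sum>e\<in>Ext p ?G. ennreal (real (?N e) / real (order F)))"
    by (subst nn_integral_sum) (simp_all add: L)
  also have "\<dots> = ennreal (\<Sum>e\<in>Ext p ?G. real (?N e) / real (order F))"
    by (rule sum_ennreal) simp
  also have "(\<Sum>e\<in>Ext p ?G. real (?N e) / real (order F)) = real (card {d \<in> pairs ?G F. snd ` fst d = carrier F}) / real (order F)"
    unfolding sum_divide_distrib[symmetric] of_nat_sum[symmetric] by (subst sum_Ext_pairs[OF p G k F]) (rule refl)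
  also have "ennreal \<dots> / of_nat (order ?G) = ennreal (real (card {d \<in> pairs ?G F. snd ` fst d = carrier F}) / real (order F) / real (order ?G))"
    unfolding ennreal_of_nat_eq_real_of_nat by (rule divide_ennreal) (use o in simp_all)
  finally have m: "(\<integral>\<^sup>+ c'. ?S c' * Delta0_prob p c c' \<partial>count_space (X0 p)) =
    ennreal (real (card {d \<in> pairs ?G F. snd ` fst d = carrier F}) / real (order F) / real (order ?G))" .
  obtain l where l: "order F = p ^ l" using fin_ab_p_groupD(4)[OF F] by blast
  interpret T: padic_target p ?G F l
    by (intro padic_target.intro padic_prime.intro padic_target_axioms.intro p fin_ab_p_groupD[OF G] fin_ab_p_groupD[OF F] l)
  show ?thesis unfolding m T.card_onto_pairs using o by (simp add: Coset.order_def)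
qed

lemma emeasure_point_measure_subset:
  assumes "A \<subseteq> S"
  shows "emeasure (point_measure S f) A = (\<integral>\<^sup>+ x. f x * indicator A x \<partial>count_space S)"
  using assms unfolding point_measure_def by (intro emeasure_density) simp_all

lemma emeasure_Moment_singleton:
  assumes "c \<in> X0 p"
  shows "emeasure (Moment p F) {c} = ennreal (real (card (Sur (rep c) F)) * mu0 p (rep c))"
  unfolding Moment_def using assms by (subst emeasure_point_measure_finite2) simp_all

theorem theorem0p4:
  fixes p :: nat and F :: "('f, 'm) monoid_scheme"
  assumes "prime p" and "fin_ab_p_group p F"
  shows "\<forall>A \<subseteq> X0 p. emeasure (Delta0 p (Moment p F)) A =
    ennreal (1 / real (order F)) *
      (\<Sum>\<phi> \<in> Zp_Hom p F. emeasure (Moment p (coker p F \<phi>)) A)"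
proof (intro allI impI)
  fix A assume A: "A \<subseteq> X0 p"
  let ?s = "\<lambda>\<phi> c. real (card (Sur (rep c) (coker p F \<phi>)))"
  \<comment> \<open>Reversibility turns the sum over the sources \<open>c\<close> into the expected
    number of surjections onto \<open>F\<close> after one step from \<open>c'\<close>, weighted by
    \<open>mu0\<close>.\<close>
  have density: "(\<integral>\<^sup>+ c. emeasure (Moment p F) {c} * Delta0_prob p c c' \<partial>count_space (X0 p)) =
    ennreal (1 / real (order F)) * (\<Sum>\<phi>\<in>Zp_Hom p F. ennreal (?s \<phi> c' * mu0 p (rep c')))" if c': "c' \<in> X0 p" for c'
  proof -
    have "(\<integral>\<^sup>+ c. emeasure (Moment p F) {c} * Delta0_prob p c c' \<partial>count_space (X0 p)) =
      (\<integral>\<^sup>+ c. ennreal (mu0 p (rep c')) * (ennreal (real (card (Sur (rep c) F))) * Delta0_prob p c' c) \<partial>count_space (X0 p))"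
      by (rule nn_integral_cong) (simp add: emeasure_Moment_singleton Delta0_prob_reversible[OF assms(1) _ c'])
    also have "\<dots> = ennreal (mu0 p (rep c')) * ennreal (1 / real (order F) * (\<Sum>\<phi>\<in>Zp_Hom p F. ?s \<phi> c'))"
      unfolding Delta0_dual_Sur[OF assms c', symmetric] by (rule nn_integral_cmult) simp
    also have "\<dots> = ennreal (1 / real (order F)) * (ennreal (\<Sum>\<phi>\<in>Zp_Hom p F. ?s \<phi> c') * ennreal (mu0 p (rep c')))"
      by (subst ennreal_mult) (simp_all add: sum_nonneg mult_ac)
    also have "ennreal (\<Sum>\<phi>\<in>Zp_Hom p F. ?s \<phi> c') * ennreal (mu0 p (rep c')) = (\<Sum>\<phi>\<in>Zp_Hom p F. ennreal (?s \<phi> c' * mu0 p (rep c')))"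
      by (simp add: sum_ennreal[symmetric] sum_distrib_right ennreal_mult' del: sum_ennreal)
    finally show ?thesis .
  qed
  have "emeasure (Delta0 p (Moment p F)) A =
    (\<integral>\<^sup>+ c'. (\<integral>\<^sup>+ c. emeasure (Moment p F) {c} * Delta0_prob p c c' \<partial>count_space (X0 p)) * indicator A c' \<partial>count_space (X0 p))"
    unfolding Delta0_def by (rule emeasure_point_measure_subset[OF A])
  also have "\<dots> = (\<integral>\<^sup>+ c'. ennreal (1 / real (order F)) * (\<Sum>\<phi>\<in>Zp_Hom p F. ennreal (?s \<phi> c' * mu0 p (rep c')) * indicator A c') \<partial>count_space (X0 p))"
    by (rule nn_integral_cong) (simp only: space_count_space density sum_distrib_right mult.assoc)
  also have "\<dots> = ennreal (1 / real (order F)) *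
      (\<integral>\<^sup>+ c'. (\<Sum>\<phi>\<in>Zp_Hom p F. ennreal (?s \<phi> c' * mu0 p (rep c')) * indicator A c') \<partial>count_space (X0 p))"
    by (rule nn_integral_cmult) simp
  also have "(\<integral>\<^sup>+ c'. (\<Sum>\<phi>\<in>Zp_Hom p F. ennreal (?s \<phi> c' * mu0 p (rep c')) * indicator A c') \<partial>count_space (X0 p)) =
    (\<Sum>\<phi>\<in>Zp_Hom p F. emeasure (Moment p (coker p F \<phi>)) A)"
    unfolding Moment_def emeasure_point_measure_subset[OF A] by (rule nn_integral_sum) simp
  finally show "emeasure (Delta0 p (Moment p F)) A =
    ennreal (1 / real (order F)) * (\<Sum>\<phi>\<in>Zp_Hom p F. emeasure (Moment p (coker p F \<phi>)) A)" .
qed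

end
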